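(* Let $d\ge1$ and $\vec r=(r_1,\dots,r_d)\in\mathbb{R}^d\setminus\{0\}$. Then for any compact interval $\mathcal I\subset\sigma(\Delta_{\mathbb{Z}^d}^{\vec r})^\circ\setminus\mathrm{Thr}(\Delta_{\mathbb{Z}^d}^{\vec r})$ there exists $c_{\mathcal I}>0$ such that $$E_{\mathcal I}(\Delta_{\mathbb{Z}^d}^{\vec r})\,[\Delta_{\mathbb{Z}^d}^{\vec r},iA_{\mathbb{Z}^d,\vec r}]_\circ\,E_{\mathcal I}(\Delta_{\mathbb{Z}^d}^{\vec r})\ \ge\ c_{\mathcal I}\,E_{\mathcal I}(\Delta_{\mathbb{Z}^d}^{\vec r})$$ in the sense of quadratic forms on $\ell^2(\mathbb{Z}^d)$.
   Context: On $\ell^2(\mathbb{Z}^d)$: $(Q_jf)(n)=n_jf(n)$; $(U_jf)(n)=f(n+e_j)$, $(U_j^*f)(n)=f(n-e_j)$. $E_{\mathcal I}(\cdot)$ denotes spectral projections; $X^\circ$ is the interior of $X$. Fractional Laplacian: $\Delta_{\mathbb{Z}}=2\,\mathrm{id}-U-U^*$ on $\ell^2(\mathbb{Z})$, which under the discrete Fourier transform is multiplication by $2-2\cos\theta$ on $L^2([-\pi,\pi])$. For $r\in\mathbb{R}$, $\Delta_{\mathbb{Z}}^{r}$ is defined by Borel functional calculus (multiplication by $(2-2\cos\theta)^r$ on its maximal domain). $\Delta_{\mathbb{Z}^d}^{\vec r}=\sum_{j=1}^d\mathrm{id}^{\otimes(j-1)}\otimes\Delta_{\mathbb{Z}}^{r_j}\otimes\mathrm{id}^{\otimes(d-j)}$,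 the self-adjoint operator which under Fourier transform is multiplication by $\vartheta_{\vec r}(\theta)=\sum_{j=1}^d(2-2\cos\theta_j)^{r_j}$. Thresholds: with $P=\{j:r_j>0\}$ and $N=\{j:r_j<0\}$, $\mathrm{Thr}(\Delta_{\mathbb{Z}^d}^{\vec r})=\{\sum_{j\in N}4^{r_j}+\sum_{j\in P}\epsilon_j4^{r_j}:\epsilon_j\in\{0,1\}\}$. Conjugate operator: $A_{\mathbb{Z}^d,\vec r}$ is the self-adjoint closure of $\sum_{j=1}^d-\frac{i\,\mathrm{sign}(r_j)}{2}\big(U_j(Q_j+\tfrac12)-(Q_j+\tfrac12)U_j^*\big)$ on finitely supported functions, with $\mathrm{sign}(r)=1$ if $r\ge0$ and $-1$ if $r<0$. Form commutator: for self-adjoint $H,A$ on a Hilbert space $\mathcal H$ (inner product antilinear in the first slot), $[H,iA]$ is the form $(f,g)\mapsto\langle Hf,iAg\rangle+\langle iAf,Hg\rangle$ on $\mathcal D(H)\cap\mathcal D(A)$. For a compact interval $\mathcal I$, $E_{\mathcal I}(H)[H,iA]_\circ E_{\mathcal I}(H)$ denotes the bounded operator on $E_{\mathcal I}(H)\mathcal H$ associated with the extension by continuity of this form to $E_{\mathcal I}(H)\mathcal H$.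
   Formalization: When some r_j = 0, the thresholds are shifted by the number of such j (each contributes the identity); with the printed Thr the claim fails, e.g. for r = (1,1,0) and I = [4.5, 5.5]. *)

theory Defs
  imports "HOL-Analysis.Analysis"
begin

section \<open>The Hilbert space of square-summable functions\<close>

definition ell2 :: "('a \<Rightarrow> complex) set" where
  "ell2 = {f. (\<lambda>n. (cmod (f n))\<^sup>2) summable_on UNIV}"

text \<open>Antilinear in the first slot.\<close>

definition ip :: "('a \<Rightarrow> complex) \<Rightarrow> ('a \<Rightarrow> complex) \<Rightarrow> complex" where
  "ip f g = (\<Sum>\<^sub>\<infinity>n. cnj (f n) * g n)"

definition l2norm :: "('a \<Rightarrow> complex) \<Rightarrow> real" where
  "l2norm f = sqrt (\<Sum>\<^sub>\<infinity>n. (cmod (f n))\<^sup>2)"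

definition l2_lim :: "(nat \<Rightarrow> 'a \<Rightarrow> complex) \<Rightarrow> ('a \<Rightarrow> complex) \<Rightarrow> bool" where
  "l2_lim F f \<longleftrightarrow> (\<lambda>k. l2norm (\<lambda>n. F k n - f n)) \<longlonglongrightarrow> 0"


section \<open>Operators\<close>

text \<open>
  Possibly unbounded operators are represented by their graphs, so that the domain of \<open>T\<close> is
  \<^term>\<open>Domain T\<close>.  Everywhere defined bounded operators on \<open>ell2\<close> are plain functions, of which
  only the values on \<open>ell2\<close> matter.
\<close>

type_synonym 'a lop = "(('a \<Rightarrow> complex) \<times> ('a \<Rightarrow> complex)) set"

definition app :: "'a lop \<Rightarrow> ('a \<Rightarrow> complex) \<Rightarrow> ('a \<Rightarrow> complex)" where
  "app T f = (THE g. (f, g) \<in> T)"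

definition linear_operator :: "'a lop \<Rightarrow> bool" where
  "linear_operator T \<longleftrightarrow>
     T \<subseteq> ell2 \<times> ell2 \<and> single_valued T \<and> ((\<lambda>n. 0), (\<lambda>n. 0)) \<in> T \<and>
     (\<forall>(f, u) \<in> T. \<forall>(g, v) \<in> T. ((\<lambda>n. f n + g n), (\<lambda>n. u n + v n)) \<in> T) \<and>
     (\<forall>(f, u) \<in> T. \<forall>z. ((\<lambda>n. z * f n), (\<lambda>n. z * u n)) \<in> T)"

definition op_closure :: "'a lop \<Rightarrow> 'a lop" where
  "op_closure T =
     {(f, g). f \<in> ell2 \<and> g \<in> ell2 \<and>
        (\<exists>F G. (\<forall>k. (F k, G k) \<in> T) \<and> l2_lim F f \<and> l2_lim G g)}"

text \<open>\<open>z\<close> is in the resolvent set iff \<open>T - z\<close> maps its domain bijectively onto \<open>ell2\<close>, with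
  bounded inverse.\<close>

definition resolvent_set :: "'a lop \<Rightarrow> complex set" where
  "resolvent_set T =
     {z. (\<forall>g \<in> ell2. \<exists>!f. (f, \<lambda>n. g n + z * f n) \<in> T) \<and>
         (\<exists>C. \<forall>(f, u) \<in> T. l2norm f \<le> C * l2norm (\<lambda>n. u n - z * f n))}"

text \<open>For self-adjoint operators the spectrum is real; it is taken as a subset of the real line
  because its interior is meant there.\<close>

definition real_spectrum :: "'a lop \<Rightarrow> real set" where
  "real_spectrum T = {x. complex_of_real x \<notin> resolvent_set T}"


section \<open>Spectral projections\<close>

text \<open>Linearity and boundedness follow from symmetry and idempotence.\<close>

definition orth_projection :: "(('a \<Rightarrow> complex) \<Rightarrow> ('a \<Rightarrow> complex)) \<Rightarrow> bool" where
  "orth_projection P \<longleftrightarrow>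
     (\<forall>f \<in> ell2. P f \<in> ell2 \<and> P (P f) = P f) \<and>
     (\<forall>f \<in> ell2. \<forall>g \<in> ell2. ip f (P g) = ip (P f) g)"

text \<open>For projections, weak and strong countable additivity are the same.\<close>

definition projection_valued_measure ::
    "(real set \<Rightarrow> ('a \<Rightarrow> complex) \<Rightarrow> ('a \<Rightarrow> complex)) \<Rightarrow> bool" where
  "projection_valued_measure E \<longleftrightarrow>
     (\<forall>S \<in> sets borel. orth_projection (E S)) \<and>
     (\<forall>f \<in> ell2. E UNIV f = f) \<and>
     (\<forall>S \<in> sets borel. \<forall>T \<in> sets borel. \<forall>f \<in> ell2. E (S \<inter> T) f = E S (E T f)) \<and>
     (\<forall>S :: nat \<Rightarrow> real set. range S \<subseteq> sets borel \<longrightarrow> disjoint_family S \<longrightarrow>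
        (\<forall>f \<in> ell2. (\<lambda>k. ip f (E (S k) f)) sums ip f (E (\<Union>k. S k) f)))"

definition scalar_measure ::
    "(real set \<Rightarrow> ('a \<Rightarrow> complex) \<Rightarrow> ('a \<Rightarrow> complex)) \<Rightarrow> ('a \<Rightarrow> complex) \<Rightarrow> real measure" where
  "scalar_measure E f = measure_of UNIV (sets borel) (\<lambda>S. ennreal (Re (ip f (E S f))))"

text \<open>\<open>T\<close> is the integral of the identity function with respect to \<open>E\<close>.  By polarization the
  quadratic form determines \<open>T\<close> on its domain.\<close>

definition is_spectral_measure ::
    "'a lop \<Rightarrow> (real set \<Rightarrow> ('a \<Rightarrow> complex) \<Rightarrow> ('a \<Rightarrow> complex)) \<Rightarrow> bool" where
  "is_spectral_measure T E \<longleftrightarrow>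
     linear_operator T \<and> projection_valued_measure E \<and>
     Domain T = {f \<in> ell2. integrable (scalar_measure E f) (\<lambda>x. x\<^sup>2)} \<and>
     (\<forall>(f, g) \<in> T. ip f g = complex_of_real (LINT x|scalar_measure E f. x))"

text \<open>By the spectral theorem a self-adjoint operator has exactly one spectral measure, up to the
  irrelevant values on non-Borel sets and outside \<open>ell2\<close>.\<close>

definition spectral_proj :: "'a lop \<Rightarrow> real set \<Rightarrow> ('a \<Rightarrow> complex) \<Rightarrow> ('a \<Rightarrow> complex)" where
  "spectral_proj T = (SOME E. is_spectral_measure T E)"


section \<open>Commutators\<close>

definition commutator_form ::
    "'a lop \<Rightarrow> 'a lop \<Rightarrow> ('a \<Rightarrow> complex) \<Rightarrow> ('a \<Rightarrow> complex) \<Rightarrow> complex" where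
  "commutator_form H A f g =
     ip (app H f) (\<lambda>n. \<i> * app A g n) + ip (\<lambda>n. \<i> * app A f n) (app H g)"

definition bounded_operator_on ::
    "('a \<Rightarrow> complex) set \<Rightarrow> (('a \<Rightarrow> complex) \<Rightarrow> ('a \<Rightarrow> complex)) \<Rightarrow> bool" where
  "bounded_operator_on R B \<longleftrightarrow>
     (\<forall>f \<in> R. B f \<in> R) \<and>
     (\<forall>f \<in> R. \<forall>g \<in> R. B (\<lambda>n. f n + g n) = (\<lambda>n. B f n + B g n)) \<and>
     (\<forall>f \<in> R. \<forall>z. B (\<lambda>n. z * f n) = (\<lambda>n. z * B f n)) \<and>
     (\<exists>C. \<forall>f \<in> R. l2norm (B f) \<le> C * l2norm f)"

definition graph_approx ::
    "'a lop \<Rightarrow> ('a \<Rightarrow> complex) set \<Rightarrow> (nat \<Rightarrow> 'a \<Rightarrow> complex) \<Rightarrow> ('a \<Rightarrow> complex) \<Rightarrow> bool" where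
  "graph_approx H D F f \<longleftrightarrow>
     (\<forall>k. F k \<in> D) \<and> l2_lim F f \<and> l2_lim (\<lambda>k. app H (F k)) (app H f)"

text \<open>
  \<open>B\<close> is the bounded operator on the range \<open>R\<close> of \<open>E\<^sub>I(H)\<close> associated with the extension by
  continuity of the form \<open>[H, iA]\<close> from \<open>Dom H \<inter> Dom A\<close> to \<open>R\<close>.  Continuity refers to the graph
  norm of \<open>H\<close>, which on \<open>R\<close> is equivalent to the norm of \<open>ell2\<close>.  The approximability of every
  element of \<open>R\<close> is part of the definition, so that there is at most one such \<open>B\<close> on \<open>R\<close>.
\<close>

definition is_compressed_commutator ::
    "'a lop \<Rightarrow> 'a lop \<Rightarrow> real set \<Rightarrow> (('a \<Rightarrow> complex) \<Rightarrow> ('a \<Rightarrow> complex)) \<Rightarrow> bool" where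
  "is_compressed_commutator H A I B \<longleftrightarrow>
     (let R = spectral_proj H I ` ell2; D = Domain H \<inter> Domain A in
        R \<subseteq> Domain H \<and>
        bounded_operator_on R B \<and>
        (\<forall>f \<in> R. \<exists>F. graph_approx H D F f) \<and>
        (\<forall>f \<in> R. \<forall>g \<in> R. \<forall>F G. graph_approx H D F f \<longrightarrow> graph_approx H D G g \<longrightarrow>
           (\<lambda>k. commutator_form H A (F k) (G k)) \<longlonglongrightarrow> ip f (B g)))"


section \<open>Fourier multipliers on the lattice\<close>

definition torus :: "(real^'d) measure" where
  "torus = restrict_space lborel (cbox (\<chi> j. - pi) (\<chi> j. pi))"

definition L2_torus :: "(real^'d \<Rightarrow> complex) set" where
  "L2_torus = {g \<in> borel_measurable torus. integrable torus (\<lambda>\<theta>. (cmod (g \<theta>))\<^sup>2)}"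

text \<open>The inverse of the discrete Fourier transform
  \<open>f \<mapsto> (2\<pi>)\<^sup>-\<^sup>d\<^sup>/\<^sup>2 \<Sum>\<^sub>n f(n) e\<^sup>-\<^sup>i\<^sup>n\<^sup>\<theta>\<close>, for which \<open>U\<^sub>j\<close> becomes multiplication by
  \<open>e\<^sup>i\<^sup>\<theta>\<close> in the \<open>j\<close>-th variable.\<close>

definition inv_fourier :: "(real^'d \<Rightarrow> complex) \<Rightarrow> (int^'d \<Rightarrow> complex)" where
  "inv_fourier g n =
     complex_of_real ((2 * pi) powr (- real CARD('d) / 2)) *
     (LINT \<theta>|torus. cis (\<Sum>j\<in>UNIV. real_of_int (n $ j) * \<theta> $ j) * g \<theta>)"

text \<open>The operator which under the Fourier transform is multiplication by \<open>\<phi>\<close>, on its maximal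
  domain.\<close>

definition fourier_mult :: "(real^'d \<Rightarrow> real) \<Rightarrow> (int^'d) lop" where
  "fourier_mult \<phi> =
     {(inv_fourier g, inv_fourier (\<lambda>\<theta>. complex_of_real (\<phi> \<theta>) * g \<theta>)) | g.
        g \<in> L2_torus \<and> (\<lambda>\<theta>. complex_of_real (\<phi> \<theta>) * g \<theta>) \<in> L2_torus}"


section \<open>The fractional Laplacian and its conjugate operator\<close>

text \<open>The convention \<open>0 powr s = 0\<close> only affects the null set where some \<open>\<theta>\<^sub>j\<close> is \<open>0\<close>; in
  particular a coordinate with \<open>r\<^sub>j = 0\<close> contributes the identity operator.\<close>

definition frac_symbol :: "real^'d \<Rightarrow> real^'d \<Rightarrow> real" where
  "frac_symbol r \<theta> = (\<Sum>j\<in>UNIV. (2 - 2 * cos (\<theta> $ j)) powr (r $ j))"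

definition frac_laplacian :: "real^'d \<Rightarrow> (int^'d) lop" where
  "frac_laplacian r = fourier_mult (frac_symbol r)"

text \<open>A coordinate with \<open>r\<^sub>j = 0\<close> shifts the operator by the identity, hence the summand counting
  these coordinates; it vanishes when all \<open>r\<^sub>j\<close> are nonzero.\<close>

definition thresholds :: "real^'d \<Rightarrow> real set" where
  "thresholds r =
     {(\<Sum>j | r $ j < 0. 4 powr (r $ j)) + real (card {j. r $ j = 0})
        + (\<Sum>j | r $ j > 0. \<epsilon> j * 4 powr (r $ j)) | \<epsilon>. \<forall>j. \<epsilon> j \<in> {0, 1}}"

definition shift :: "'d \<Rightarrow> (int^'d \<Rightarrow> complex) \<Rightarrow> (int^'d \<Rightarrow> complex)" where
  "shift j f n = f (n + axis j 1)"

definition shift_adj :: "'d \<Rightarrow> (int^'d \<Rightarrow> complex) \<Rightarrow> (int^'d \<Rightarrow> complex)" where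
  "shift_adj j f n = f (n - axis j 1)"

text \<open>\<open>Q\<^sub>j + 1/2\<close>\<close>

definition position_half :: "'d \<Rightarrow> (int^'d \<Rightarrow> complex) \<Rightarrow> (int^'d \<Rightarrow> complex)" where
  "position_half j f n = of_int (n $ j) * f n + f n / 2"

definition sign :: "real \<Rightarrow> real" where
  "sign s = (if s \<ge> 0 then 1 else -1)"

definition conj_op_pre :: "real^'d \<Rightarrow> (int^'d \<Rightarrow> complex) \<Rightarrow> (int^'d \<Rightarrow> complex)" where
  "conj_op_pre r f n =
     (\<Sum>j\<in>UNIV. - (\<i> * complex_of_real (sign (r $ j)) / 2) *
        (shift j (position_half j f) n - position_half j (shift_adj j f) n))"

definition conj_op :: "real^'d \<Rightarrow> (int^'d) lop" where
  "conj_op r = op_closure {(f, conj_op_pre r f) | f. finite {n. f n \<noteq> 0}}"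

end

theory Submission
  imports Defs
begin

text \<open>
  After Fourier transform, \<open>H\<close> is multiplication by \<open>\<phi> = \<Sum>\<^sub>j x\<^sub>j\<^bsup>r\<^sub>j\<^esup>\<close> with \<open>x\<^sub>j = 2 - 2 cos \<theta>\<^sub>j\<close>, and
  \<open>iA\<close> is the first-order differential operator \<open>- \<Sum>\<^sub>j sign(r\<^sub>j) sin \<theta>\<^sub>j \<partial>\<^sub>j\<close> up to a multiplication
  operator, so \<open>[H, iA]\<close> is multiplication by \<open>\<psi> = \<Sum>\<^sub>j |r\<^sub>j| x\<^sub>j\<^bsup>r\<^sub>j\<^esup> (4 - x\<^sub>j) / 2\<close>.  Since
  \<open>0 \<le> \<psi> \<le> 2 (\<Sum>\<^sub>j |r\<^sub>j|) \<phi>\<close>, the form is continuous in the graph norm of \<open>H\<close>; its zeros are the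
  points with \<open>x\<^sub>j \<in> {0, 4}\<close> where \<open>r\<^sub>j > 0\<close> and \<open>x\<^sub>j = 4\<close> where \<open>r\<^sub>j < 0\<close>, where \<open>\<phi>\<close> takes threshold values,
  and compactness gives a positive lower bound on \<open>{\<phi> \<in> I}\<close>.

  To avoid differentiating the possibly singular \<open>\<phi>\<close>, the commutator is first computed for powers of
  \<open>t\<^sub>j = 1 - x\<^sub>j / 4\<close>, where it is lattice algebra, and then \<open>x\<^sub>j\<^bsup>r\<^sub>j\<^esup> = 4\<^bsup>r\<^sub>j\<^esup> (1 - t\<^sub>j)\<^bsup>r\<^sub>j\<^esup>\<close> is expanded into its
  binomial series.  The coefficients eventually have constant sign, so the partial sums and the commutators
  are dominated by \<open>C (1 + \<phi>)\<close> and the limit can be taken on \<open>D(H) \<inter> D(A)\<close>.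
\<close>

text \<open>Besides the commutator, two obstacles shape the proof. \<open>spectral_proj\<close> is
  chosen by \<open>SOME\<close>, and \<open>is_spectral_measure\<close> prescribes only a domain and
  a quadratic form; so every such measure has to be shown equal, on compact intervals, to
  multiplication by the indicator of the set where \<phi> lies in the interval. The comparison works
  with forms alone: a vector carried by a short interval around \<open>c\<close> has little mass
  where \<phi> is far from \<open>c\<close>, and subdivision makes this mass vanish. Secondly, the
  extension by continuity demands that every vector of the spectral range be a graph-norm limit from
  D(H) \<inter> D(A). If some r_j < 0, finitely supported functions may lie outside D(H);
  multiplying trigonometric polynomials by a high power of 1 - t_j keeps the support finite and
  tames the singularity at \<theta>_j = 0. The variable t_j = (1 + cos \<theta>_j) / 2 suits the
  purpose because the singular point x_j = 0 becomes the endpoint t_j = 1 of [0, 1] and because the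
  commutator of t_j is, up to sign, the polynomial 2 t_j (1 - t_j), so that powers of t_j stay
  within lattice algebra.\<close>

lemma measurable_cnj [measurable]:
  "f \<in> borel_measurable M \<Longrightarrow> (\<lambda>x. cnj (f x)) \<in> borel_measurable M"
  by (rule borel_measurable_continuous_on[OF continuous_on_cnj[OF continuous_on_id]])

section \<open>Square-integrable functions on a measure space\<close>

text \<open>Genuine functions, not classes modulo null sets: equalities on the Fourier side hold
  only almost everywhere, and the \<open>_cong_AE\<close> lemmas bridge the gap.\<close>

definition L2 :: "'a measure \<Rightarrow> ('a \<Rightarrow> complex) set" where
  "L2 M = {g \<in> borel_measurable M. integrable M (\<lambda>x. (cmod (g x))\<^sup>2)}"

definition inn :: "'a measure \<Rightarrow> ('a \<Rightarrow> complex) \<Rightarrow> ('a \<Rightarrow> complex) \<Rightarrow> complex" where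
  "inn M f g = (LINT x|M. cnj (f x) * g x)"

definition sqn :: "'a measure \<Rightarrow> ('a \<Rightarrow> complex) \<Rightarrow> real" where
  "sqn M f = (LINT x|M. (cmod (f x))\<^sup>2)"

lemma L2_measurable [measurable_dest]: "g \<in> L2 M \<Longrightarrow> g \<in> borel_measurable M"
  by (simp add: L2_def)

lemma L2_integrable: "g \<in> L2 M \<Longrightarrow> integrable M (\<lambda>x. (cmod (g x))\<^sup>2)"
  by (simp add: L2_def)

lemma L2_dominated:
  assumes "g \<in> L2 M" "h \<in> borel_measurable M" "AE x in M. cmod (h x) \<le> C * cmod (g x)"
  shows "h \<in> L2 M"
proof -
  have "integrable M (\<lambda>x. C\<^sup>2 * (cmod (g x))\<^sup>2)"
    using L2_integrable[OF assms(1)] by simp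
  then have "integrable M (\<lambda>x. (cmod (h x))\<^sup>2)"
  proof (rule Bochner_Integration.integrable_bound)
    show "AE x in M. norm ((cmod (h x))\<^sup>2) \<le> norm (C\<^sup>2 * (cmod (g x))\<^sup>2)"
      using assms(3)
      by eventually_elim (metis abs_of_nonneg norm_ge_zero power2_abs power_mono power_mult_distrib real_norm_def zero_le_power2)
  qed (use assms(2) in measurable)
  then show ?thesis using assms by (simp add: L2_def)
qed

lemma L2_zero [simp]: "(\<lambda>x. 0) \<in> L2 M"
  by (simp add: L2_def)

lemma L2_scale [simp, intro]: "g \<in> L2 M \<Longrightarrow> (\<lambda>x. c * g x) \<in> L2 M"
  by (rule L2_dominated[where C = "cmod c" and g = g]) (auto simp: norm_mult)

lemma L2_cong_AE: "g \<in> L2 M \<Longrightarrow> h \<in> borel_measurable M \<Longrightarrow> AE x in M. g x = h x \<Longrightarrow> h \<in> L2 M"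
  by (rule L2_dominated[where C = 1 and g = g]) auto

lemma cmod_add_square_le: "(cmod (a + b))\<^sup>2 \<le> 2 * (cmod a)\<^sup>2 + 2 * (cmod b)\<^sup>2"
proof -
  have "(cmod (a + b))\<^sup>2 \<le> (cmod a + cmod b)\<^sup>2"
    by (intro power_mono norm_triangle_ineq norm_ge_zero)
  also have "\<dots> \<le> 2 * (cmod a)\<^sup>2 + 2 * (cmod b)\<^sup>2"
    using sum_squares_bound[of "cmod a" "cmod b"] by (simp add: power2_sum)
  finally show ?thesis .
qed

lemma L2_add [simp, intro]:
  assumes "f \<in> L2 M" "g \<in> L2 M"
  shows "(\<lambda>x. f x + g x) \<in> L2 M"
proof -
  have "integrable M (\<lambda>x. 2 * (cmod (f x))\<^sup>2 + 2 * (cmod (g x))\<^sup>2)"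
    using assms by (simp add: L2_integrable)
  then have "integrable M (\<lambda>x. (cmod (f x + g x))\<^sup>2)"
    by (rule Bochner_Integration.integrable_bound) (use assms cmod_add_square_le in auto)
  then show ?thesis using assms by (auto simp: L2_def)
qed

lemma L2_minus [simp, intro]: "g \<in> L2 M \<Longrightarrow> (\<lambda>x. - g x) \<in> L2 M"
  using L2_scale[of g M "-1"] by simp

lemma L2_diff [simp, intro]: "f \<in> L2 M \<Longrightarrow> g \<in> L2 M \<Longrightarrow> (\<lambda>x. f x - g x) \<in> L2 M"
  using L2_add[of f M "\<lambda>x. - g x"] by simp

lemma L2_sum [simp, intro]: "(\<And>i. i \<in> I \<Longrightarrow> f i \<in> L2 M) \<Longrightarrow> (\<lambda>x. \<Sum>i\<in>I. f i x) \<in> L2 M"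
  by (induction I rule: infinite_finite_induct) auto

lemma L2_bounded_mult:
  assumes "g \<in> L2 M" "m \<in> borel_measurable M" "\<And>x. x \<in> space M \<Longrightarrow> cmod (m x) \<le> C"
  shows "(\<lambda>x. m x * g x) \<in> L2 M"
  by (rule L2_dominated[where C = C and g = g])
     (use assms in \<open>auto simp: norm_mult intro!: mult_right_mono\<close>)

lemma integrable_norm_mult:
  assumes "f \<in> L2 M" "g \<in> L2 M"
  shows "integrable M (\<lambda>x. cmod (f x) * cmod (g x))"
proof (rule Bochner_Integration.integrable_bound)
  show "integrable M (\<lambda>x. (cmod (f x))\<^sup>2 + (cmod (g x))\<^sup>2)"
    using assms by (simp add: L2_integrable)
  show "AE x in M. norm (cmod (f x) * cmod (g x)) \<le> norm ((cmod (f x))\<^sup>2 + (cmod (g x))\<^sup>2)"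
  proof (intro AE_I2)
    fix x
    have "2 * cmod (f x) * cmod (g x) \<le> (cmod (f x))\<^sup>2 + (cmod (g x))\<^sup>2" by (rule sum_squares_bound)
    moreover have "0 \<le> cmod (f x) * cmod (g x)" by simp
    ultimately have "cmod (f x) * cmod (g x) \<le> (cmod (f x))\<^sup>2 + (cmod (g x))\<^sup>2" by linarith
    then show "norm (cmod (f x) * cmod (g x)) \<le> norm ((cmod (f x))\<^sup>2 + (cmod (g x))\<^sup>2)"
      by (simp add: abs_mult)
  qed
qed (use assms in auto)

lemma integrable_inn:
  assumes "f \<in> L2 M" "g \<in> L2 M"
  shows "integrable M (\<lambda>x. cnj (f x) * g x)"
  by (rule Bochner_Integration.integrable_bound[OF integrable_norm_mult[OF assms]])
     (use assms in \<open>auto simp: norm_mult\<close>)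

lemma inn_add_right: "f \<in> L2 M \<Longrightarrow> g \<in> L2 M \<Longrightarrow> h \<in> L2 M \<Longrightarrow> inn M f (\<lambda>x. g x + h x) = inn M f g + inn M f h"
  by (simp add: inn_def distrib_left integrable_inn)

lemma inn_add_left: "f \<in> L2 M \<Longrightarrow> g \<in> L2 M \<Longrightarrow> h \<in> L2 M \<Longrightarrow> inn M (\<lambda>x. g x + h x) f = inn M g f + inn M h f"
  by (simp add: inn_def distrib_right integrable_inn)

lemma inn_diff_right: "f \<in> L2 M \<Longrightarrow> g \<in> L2 M \<Longrightarrow> h \<in> L2 M \<Longrightarrow> inn M f (\<lambda>x. g x - h x) = inn M f g - inn M f h"
  by (simp add: inn_def right_diff_distrib integrable_inn)

lemma inn_diff_left: "f \<in> L2 M \<Longrightarrow> g \<in> L2 M \<Longrightarrow> h \<in> L2 M \<Longrightarrow> inn M (\<lambda>x. g x - h x) f = inn M g f - inn M h f"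
  by (simp add: inn_def left_diff_distrib integrable_inn)

lemma inn_scale_right: "inn M f (\<lambda>x. c * g x) = c * inn M f g"
  unfolding inn_def by (subst mult.left_commute) simp

lemma inn_commute: "cnj (inn M f g) = inn M g f"
proof -
  have "cnj (inn M f g) = (LINT x|M. cnj (cnj (f x) * g x))"
    by (simp only: inn_def Bochner_Integration.integral_cnj)
  then show ?thesis by (simp add: inn_def mult.commute)
qed

lemma inn_self: "inn M f f = complex_of_real (sqn M f)"
  unfolding inn_def sqn_def
  by (subst integral_complex_of_real[symmetric]) (simp only: complex_norm_square mult.commute)

lemma sqn_nonneg [simp]: "0 \<le> sqn M f"
  by (simp add: sqn_def)

lemma sqn_scale: "sqn M (\<lambda>x. c * f x) = (cmod c)\<^sup>2 * sqn M f"
  by (simp add: sqn_def norm_mult power_mult_distrib)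

lemma sqn_mono_AE:
  "g \<in> L2 M \<Longrightarrow> h \<in> L2 M \<Longrightarrow> AE x in M. cmod (h x) \<le> cmod (g x) \<Longrightarrow> sqn M h \<le> sqn M g"
  unfolding sqn_def
  by (intro integral_mono_AE L2_integrable) (auto elim!: eventually_mono intro!: power_mono)

lemma sqn_cong_AE:
  "f \<in> borel_measurable M \<Longrightarrow> g \<in> borel_measurable M \<Longrightarrow> AE x in M. f x = g x \<Longrightarrow> sqn M f = sqn M g"
  unfolding sqn_def by (intro integral_cong_AE) auto

lemma inn_cong_AE:
  "f \<in> borel_measurable M \<Longrightarrow> g \<in> borel_measurable M \<Longrightarrow> f' \<in> borel_measurable M \<Longrightarrow>
   g' \<in> borel_measurable M \<Longrightarrow> AE x in M. f x = f' x \<Longrightarrow> AE x in M. g x = g' x \<Longrightarrow> inn M f g = inn M f' g'"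
  unfolding inn_def by (intro integral_cong_AE) auto

lemma sqn_eq_0_iff: "f \<in> L2 M \<Longrightarrow> sqn M f = 0 \<longleftrightarrow> (AE x in M. f x = 0)"
  unfolding sqn_def by (subst integral_nonneg_eq_0_iff_AE) (auto simp: L2_integrable)

lemma sqn_add:
  assumes "f \<in> L2 M" "g \<in> L2 M"
  shows "sqn M (\<lambda>x. f x + g x) = sqn M f + sqn M g + 2 * Re (inn M f g)"
proof -
  have "complex_of_real (sqn M (\<lambda>x. f x + g x)) = inn M f f + inn M g g + (inn M f g + cnj (inn M f g))"
    using assms by (simp add: inn_self[symmetric] inn_add_left inn_add_right inn_commute)
  also have "\<dots> = complex_of_real (sqn M f + sqn M g + 2 * Re (inn M f g))"
    by (simp add: inn_self complex_add_cnj)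
  finally show ?thesis using of_real_eq_iff by blast
qed

lemma sqn_add_le:
  assumes "f \<in> L2 M" "g \<in> L2 M"
  shows "sqn M (\<lambda>x. f x + g x) \<le> 2 * sqn M f + 2 * sqn M g"
proof -
  have "sqn M (\<lambda>x. f x + g x) \<le> (LINT x|M. 2 * (cmod (f x))\<^sup>2 + 2 * (cmod (g x))\<^sup>2)"
    unfolding sqn_def
    using assms by (intro integral_mono L2_integrable cmod_add_square_le) (auto simp: L2_integrable)
  then show ?thesis using assms by (simp add: sqn_def L2_integrable)
qed

lemma sqn_diff_le:
  assumes "f \<in> L2 M" "g \<in> L2 M"
  shows "sqn M (\<lambda>x. f x - g x) \<le> 2 * sqn M f + 2 * sqn M g"
  using sqn_add_le[of f M "\<lambda>x. - g x"] assms by (simp add: sqn_def)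

lemma sqn_sum_le:
  assumes "\<And>i. i \<in> I \<Longrightarrow> f i \<in> L2 M"
  shows "sqn M (\<lambda>x. \<Sum>i\<in>I. f i x) \<le> real (card I) * (\<Sum>i\<in>I. sqn M (f i))"
proof -
  have "(cmod (\<Sum>i\<in>I. f i x))\<^sup>2 \<le> real (card I) * (\<Sum>i\<in>I. (cmod (f i x))\<^sup>2)" for x
  proof -
    have "(cmod (\<Sum>i\<in>I. f i x))\<^sup>2 \<le> (\<Sum>i\<in>I. 1 * cmod (f i x))\<^sup>2"
      by (intro power_mono) (auto intro: norm_sum)
    also have "\<dots> \<le> (\<Sum>i\<in>I. 1\<^sup>2) * (\<Sum>i\<in>I. (cmod (f i x))\<^sup>2)"
      by (rule Cauchy_Schwarz_ineq_sum)
    finally show ?thesis by simp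
  qed
  then have "sqn M (\<lambda>x. \<Sum>i\<in>I. f i x) \<le> (LINT x|M. real (card I) * (\<Sum>i\<in>I. (cmod (f i x))\<^sup>2))"
    unfolding sqn_def
    using assms by (intro integral_mono L2_integrable L2_sum) (auto simp: L2_integrable)
  also have "\<dots> = real (card I) * (\<Sum>i\<in>I. sqn M (f i))"
    using assms by (simp add: sqn_def L2_integrable)
  finally show ?thesis .
qed

text \<open>Integrating the weighted inequality \<open>2 x y \<le> l x^2 + y^2 / l\<close> gives a
  bound for every \<open>l > 0\<close>; optimizing over \<open>l\<close> gives the product of the
  norms.\<close>

lemma Cauchy_Schwarz_inn:
  assumes "f \<in> L2 M" "g \<in> L2 M"
  shows "cmod (inn M f g) \<le> sqrt (sqn M f) * sqrt (sqn M g)"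
proof -
  define A where "A = sqrt (sqn M f)"
  define B where "B = sqrt (sqn M g)"
  define X where "X = (LINT x|M. cmod (f x) * cmod (g x))"
  have A: "sqn M f = A\<^sup>2" "A \<ge> 0" and B: "sqn M g = B\<^sup>2" "B \<ge> 0"
    by (auto simp: A_def B_def)
  have "cmod (inn M f g) \<le> X"
    unfolding inn_def X_def
    by (rule order_trans[OF integral_norm_bound]) (simp add: norm_mult)
  moreover have "X \<le> A * B"
  proof -
    have key: "2 * X \<le> l * A\<^sup>2 + B\<^sup>2 / l" if "l > 0" for l
    proof -
      have "(LINT x|M. 2 * (cmod (f x) * cmod (g x))) \<le> (LINT x|M. l * (cmod (f x))\<^sup>2 + (cmod (g x))\<^sup>2 / l)"
      proof (rule integral_mono)
        fix x
        have "2 * (sqrt l * cmod (f x)) * (cmod (g x) / sqrt l) \<le> (sqrt l * cmod (f x))\<^sup>2 + (cmod (g x) / sqrt l)\<^sup>2"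
          by (rule sum_squares_bound)
        then show "2 * (cmod (f x) * cmod (g x)) \<le> l * (cmod (f x))\<^sup>2 + (cmod (g x))\<^sup>2 / l"
          using that by (simp add: power_mult_distrib power_divide)
      qed (use assms integrable_norm_mult[OF assms] in \<open>auto simp: L2_integrable\<close>)
      then show ?thesis
        using assms by (simp add: X_def A(1)[symmetric] B(1)[symmetric] sqn_def L2_integrable integrable_norm_mult)
    qed
    have "2 * X \<le> 2 * (A * B) + e * (A + B)" if "e > 0" for e
    proof -
      \<comment> \<open>The optimal weight is \<open>B / A\<close>; the shift by \<open>e\<close>
        keeps it defined and positive when \<open>A\<close> or \<open>B\<close> vanishes, and
        \<open>e\<close> is sent to 0 afterwards.\<close>
      define l where "l = (B + e) / (A + e)"
      have l: "l > 0" using that A B by (simp add: l_def add_nonneg_pos)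
      have le: "l * A + l * e = B + e" using that A B by (simp add: l_def flip: distrib_left add_divide_distrib)
      have le': "0 \<le> l * e" using l that by simp
      have "l * A \<le> B + e" using le le' by linarith
      then have 1: "l * A\<^sup>2 \<le> (B + e) * A"
        using A mult_right_mono[of "l * A" "B + e" A] by (simp add: power2_eq_square mult_ac)
      have "B \<le> (A + e) * l" using le that by (simp add: algebra_simps)
      then have "B / l \<le> A + e" using l by (simp add: pos_divide_le_eq)
      then have 2: "B\<^sup>2 / l \<le> (A + e) * B"
        using B mult_right_mono[of "B / l" "A + e" B] by (simp add: power2_eq_square mult_ac)
      show ?thesis using key[OF l] 1 2 by (simp add: algebra_simps)
    qed
    note * = this
    have "2 * X \<le> 2 * (A * B)"
    proof (rule field_le_epsilon)
      fix e :: real assume e: "e > 0"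
      have "2 * X \<le> 2 * (A * B) + e / (A + B + 1) * (A + B)"
        using e A B by (intro *) (simp add: add_nonneg_pos)
      moreover have "e / (A + B + 1) * (A + B) \<le> e"
      proof -
        have "e * (A + B) \<le> e * (A + B + 1)" using e by simp
        then show ?thesis using A B by (simp add: pos_divide_le_eq add_nonneg_pos)
      qed
      ultimately show "2 * X \<le> 2 * (A * B) + e" by linarith
    qed
    then show ?thesis by simp
  qed
  ultimately show ?thesis by (simp add: A_def B_def)
qed

section \<open>Convergence and completeness in \<open>L2\<close>\<close>

definition L2lim :: "'a measure \<Rightarrow> (nat \<Rightarrow> 'a \<Rightarrow> complex) \<Rightarrow> ('a \<Rightarrow> complex) \<Rightarrow> bool" where
  "L2lim M F f \<longleftrightarrow> (\<lambda>k. sqn M (\<lambda>x. F k x - f x)) \<longlonglongrightarrow> 0"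

lemma L2lim_inn:
  assumes "\<And>k. F k \<in> L2 M" "\<And>k. G k \<in> L2 M" "f \<in> L2 M" "g \<in> L2 M" "L2lim M F f" "L2lim M G g"
  shows "(\<lambda>k. inn M (F k) (G k)) \<longlonglongrightarrow> inn M f g"
proof -
  let ?a = "\<lambda>k. sqrt (sqn M (\<lambda>x. F k x - f x))" and ?b = "\<lambda>k. sqrt (sqn M (\<lambda>x. G k x - g x))"
  have a: "?a \<longlonglongrightarrow> 0" and b: "?b \<longlonglongrightarrow> 0"
    using assms(5,6) tendsto_real_sqrt[of _ 0] by (auto simp: L2lim_def)
  have "(\<lambda>k. inn M (F k) (G k) - inn M f g) \<longlonglongrightarrow> 0"
  proof (rule Lim_null_comparison)
    show "\<forall>\<^sub>F k in sequentially. norm (inn M (F k) (G k) - inn M f g)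
        \<le> ?a k * ?b k + ?a k * sqrt (sqn M g) + sqrt (sqn M f) * ?b k"
    proof (intro always_eventually allI)
      fix k
      let ?x = "inn M (\<lambda>x. F k x - f x) (\<lambda>x. G k x - g x)" and ?y = "inn M (\<lambda>x. F k x - f x) g"
        and ?z = "inn M f (\<lambda>x. G k x - g x)"
      have eq: "inn M (F k) (G k) - inn M f g = ?x + ?y + ?z"
        using assms(1-4) by (simp add: inn_diff_left inn_diff_right)
      have "cmod ?x \<le> ?a k * ?b k" "cmod ?y \<le> ?a k * sqrt (sqn M g)" "cmod ?z \<le> sqrt (sqn M f) * ?b k"
        using assms(1-4) by (auto intro!: Cauchy_Schwarz_inn)
      then show "cmod (inn M (F k) (G k) - inn M f g) \<le> ?a k * ?b k + ?a k * sqrt (sqn M g) + sqrt (sqn M f) * ?b k"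
        unfolding eq using norm_triangle_ineq[of "?x + ?y" ?z] norm_triangle_ineq[of ?x ?y] by linarith
    qed
    show "(\<lambda>k. ?a k * ?b k + ?a k * sqrt (sqn M g) + sqrt (sqn M f) * ?b k) \<longlonglongrightarrow> 0"
      using tendsto_add[OF tendsto_add[OF tendsto_mult[OF a b] tendsto_mult[OF a tendsto_const[of "sqrt (sqn M g)"]]]
          tendsto_mult[OF tendsto_const[of "sqrt (sqn M f)"] b]] by simp
  qed
  then show ?thesis by (simp add: LIM_zero_iff)
qed

lemma L2lim_const [simp]: "L2lim M (\<lambda>k. f) f"
  by (simp add: L2lim_def sqn_def)

text \<open>Serves multipliers that need not be bounded: convergence after multiplication by
  \<open>frac_symbol\<close> yields convergence after multiplication by \<open>comm_symbol\<close>,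
  which is at most a constant times it.\<close>

lemma L2lim_dominated_mult:
  assumes "\<And>k. F k \<in> L2 M" "f \<in> L2 M" "\<And>k. G k \<in> borel_measurable M" "g \<in> borel_measurable M"
    and "L2lim M F f"
    and "\<And>k. AE x in M. cmod (G k x - g x) \<le> C * cmod (F k x - f x)"
  shows "L2lim M G g"
  unfolding L2lim_def
proof (rule Lim_null_comparison)
  show "(\<lambda>k. C\<^sup>2 * sqn M (\<lambda>x. F k x - f x)) \<longlonglongrightarrow> 0"
    using assms(5) by (auto simp: L2lim_def intro!: tendsto_eq_intros)
  have "sqn M (\<lambda>x. G k x - g x) \<le> C\<^sup>2 * sqn M (\<lambda>x. F k x - f x)" for k
  proof -
    have c: "AE x in M. cmod (G k x - g x) \<le> cmod (of_real C * (F k x - f x))"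
      using assms(6)[of k]
    proof eventually_elim
      case (elim x)
      then show ?case using abs_ge_self[of C] mult_right_mono[OF abs_ge_self[of C] norm_ge_zero[of "F k x - f x"]]
        by (simp add: norm_mult)
    qed
    have "sqn M (\<lambda>x. G k x - g x) \<le> sqn M (\<lambda>x. of_real C * (F k x - f x))"
    proof (rule sqn_mono_AE)
      show "(\<lambda>x. G k x - g x) \<in> L2 M"
        by (rule L2_dominated[where C = C and g = "\<lambda>x. F k x - f x"]) (use assms in auto)
    qed (use assms c in auto)
    then show ?thesis by (simp add: sqn_scale)
  qed
  then show "\<forall>\<^sub>F k in sequentially. norm (sqn M (\<lambda>x. G k x - g x)) \<le> C\<^sup>2 * sqn M (\<lambda>x. F k x - f x)"
    by simp
qed

lemma L2lim_dominated_convergence: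
  assumes F: "\<And>k. F k \<in> borel_measurable M" and "f \<in> borel_measurable M" "w \<in> L2 M"
    and bound: "\<And>k. AE x in M. cmod (F k x) \<le> cmod (w x)"
    and lim: "AE x in M. (\<lambda>k. F k x) \<longlonglongrightarrow> f x"
  shows "f \<in> L2 M" "L2lim M F f"
proof -
  have fw: "AE x in M. cmod (f x) \<le> cmod (w x)"
  proof -
    have "AE x in M. \<forall>k. cmod (F k x) \<le> cmod (w x)"
      using bound by (simp add: AE_all_countable)
    with lim show ?thesis
    proof eventually_elim
      case (elim x)
      show ?case by (rule LIMSEQ_le_const2[OF tendsto_norm[OF elim(1)]]) (use elim in auto)
    qed
  qed
  show f: "f \<in> L2 M"
    by (rule L2_dominated[where C = 1 and g = w]) (use assms fw in auto)
  have "(\<lambda>k. LINT x|M. (cmod (F k x - f x))\<^sup>2) \<longlonglongrightarrow> (LINT x|M. 0)"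
  proof (rule integral_dominated_convergence)
    show "integrable M (\<lambda>x. 4 * (cmod (w x))\<^sup>2)" using assms(3) by (simp add: L2_integrable)
    show "AE x in M. (\<lambda>k. (cmod (F k x - f x))\<^sup>2) \<longlonglongrightarrow> 0"
      using lim by eventually_elim (auto intro!: tendsto_eq_intros simp: LIM_zero)
    show "AE x in M. norm ((cmod (F k x - f x))\<^sup>2) \<le> 4 * (cmod (w x))\<^sup>2" for k
      using bound[of k] fw
    proof eventually_elim
      case (elim x)
      have "cmod (F k x - f x) \<le> 2 * cmod (w x)"
        using norm_triangle_ineq4[of "F k x" "f x"] elim by linarith
      then have "(cmod (F k x - f x))\<^sup>2 \<le> (2 * cmod (w x))\<^sup>2" by (intro power_mono) auto
      then show ?case by (simp add: power_mult_distrib)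
    qed
  qed (use F assms(2) in auto)
  then show "L2lim M F f" by (simp add: L2lim_def sqn_def)
qed

abbreviation rmult :: "('a \<Rightarrow> real) \<Rightarrow> ('a \<Rightarrow> complex) \<Rightarrow> 'a \<Rightarrow> complex" (infixr "\<odot>" 70) where
  "m \<odot> g \<equiv> \<lambda>x. complex_of_real (m x) * g x"

text \<open>Writing \<open>a i\<close> as \<open>2^(-i/2) * (2^(i/2) * a i)\<close> leaves a
  geometric tail of size at most \<open>2 * (1/2)^k\<close> as the first factor, so a weighted
  square sum controls all later increments with a rate.\<close>

lemma weighted_Cauchy_Schwarz_tail:
  fixes a :: "nat \<Rightarrow> complex"
  assumes "summable (\<lambda>i. 2 ^ i * (cmod (a i))\<^sup>2)"
  shows "(cmod (\<Sum>i=k..<m. a i))\<^sup>2 \<le> 2 * (1/2) ^ k * (\<Sum>i. 2 ^ i * (cmod (a i))\<^sup>2)"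
proof -
  have "(cmod (\<Sum>i=k..<m. a i))\<^sup>2 \<le> (\<Sum>i=k..<m. cmod (a i))\<^sup>2"
    by (intro power_mono norm_sum norm_ge_zero)
  also have "\<dots> = (\<Sum>i=k..<m. sqrt ((1/2)^i) * (sqrt (2^i) * cmod (a i)))\<^sup>2"
    by (simp add: mult.assoc[symmetric] real_sqrt_mult[symmetric] power_mult_distrib[symmetric])
  also have "\<dots> \<le> (\<Sum>i=k..<m. (sqrt ((1/2)^i))\<^sup>2) * (\<Sum>i=k..<m. (sqrt (2^i) * cmod (a i))\<^sup>2)"
    by (rule Cauchy_Schwarz_ineq_sum)
  also have "\<dots> = (\<Sum>i=k..<m. (1/2)^i) * (\<Sum>i=k..<m. 2^i * (cmod (a i))\<^sup>2)"
    by (simp add: power_mult_distrib)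
  also have "\<dots> \<le> (2 * (1/2)^k) * (\<Sum>i. 2 ^ i * (cmod (a i))\<^sup>2)"
  proof (rule mult_mono)
    have "(\<Sum>i=k..<m. (1/2::real)^i) = 2 * (1/2)^k - 2 * (1/2)^m" if "k \<le> m"
      using that by (induction m rule: dec_induct) auto
    then show "(\<Sum>i=k..<m. (1/2::real)^i) \<le> 2 * (1/2)^k" by (cases "k \<le> m") auto
    show "(\<Sum>i=k..<m. 2^i * (cmod (a i))\<^sup>2) \<le> (\<Sum>i. 2 ^ i * (cmod (a i))\<^sup>2)"
      by (rule sum_le_suminf[OF assms]) auto
  qed (auto intro!: sum_nonneg)
  finally show ?thesis .
qed

text \<open>One integrable function \<open>W\<close> bounds all tails: pointwise limits exist where
  \<open>W\<close> is finite, hence almost everywhere, and the same pointwise bound, integrated,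
  gives convergence in norm.\<close>

lemma L2_complete:
  assumes P: "\<And>k. P k \<in> L2 M" and fast: "\<And>k. sqn M (\<lambda>x. P (Suc k) x - P k x) \<le> (1/4) ^ k"
  shows "\<exists>g \<in> L2 M. L2lim M P g"
proof -
  define D where "D = (\<lambda>k x. P (Suc k) x - P k x)"
  \<comment> \<open>The weights \<open>2^i\<close> grow fast enough to control the tails and slowly
    enough against the rate \<open>(1/4)^i\<close> for the integral of \<open>W\<close> to be
    finite.\<close>
  define W where "W = (\<lambda>x. \<Sum>i. 2 ^ i * (cmod (D i x))\<^sup>2)"
  define g where "g = (\<lambda>x. lim (\<lambda>k. P k x))"
  have D: "D k \<in> L2 M" for k using P by (simp add: D_def)
  have Pm [measurable]: "P k \<in> borel_measurable M" for k using P by (auto simp: L2_def)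
  have Dm [measurable]: "D k \<in> borel_measurable M" for k using D by (auto simp: L2_def)
  have int: "integrable M (\<lambda>x. 2 ^ i * (cmod (D i x))\<^sup>2)" for i
    using D by (simp add: L2_integrable)
  have le: "(LINT x|M. 2 ^ i * (cmod (D i x))\<^sup>2) \<le> (1/2) ^ i" for i
  proof -
    have "(LINT x|M. 2 ^ i * (cmod (D i x))\<^sup>2) = 2 ^ i * sqn M (D i)" by (simp add: sqn_def)
    also have "\<dots> \<le> 2 ^ i * (1/4) ^ i" using fast[of i] by (simp add: D_def)
    also have "\<dots> = (1/2) ^ i" by (simp add: power_mult_distrib[symmetric])
    finally show ?thesis .
  qed
  have sum: "summable (\<lambda>i. LINT x|M. 2 ^ i * (cmod (D i x))\<^sup>2)"
    by (rule summable_comparison_test[where g = "\<lambda>i. (1/2) ^ i"]) (use le in auto)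
  have ae: "AE x in M. summable (\<lambda>i. 2 ^ i * (cmod (D i x))\<^sup>2)"
  proof -
    have "(\<integral>\<^sup>+x. (\<Sum>i. ennreal (2 ^ i * (cmod (D i x))\<^sup>2)) \<partial>M) = (\<Sum>i. \<integral>\<^sup>+x. ennreal (2 ^ i * (cmod (D i x))\<^sup>2) \<partial>M)"
      by (rule nn_integral_suminf) simp
    also have "\<dots> = (\<Sum>i. ennreal (LINT x|M. 2 ^ i * (cmod (D i x))\<^sup>2))"
      by (intro arg_cong[where f = suminf] ext nn_integral_eq_integral int) auto
    also have "\<dots> \<noteq> \<infinity>"
      unfolding infinity_ennreal_def by (rule ennreal_suminf_neq_top[OF sum]) (rule integral_nonneg_AE, simp)
    finally have "AE x in M. (\<Sum>i. ennreal (2 ^ i * (cmod (D i x))\<^sup>2)) \<noteq> \<infinity>"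
      by (intro nn_integral_noteq_infinite) auto
    then show ?thesis
      by eventually_elim (rule summable_suminf_not_top, auto)
  qed
  have W: "integrable M W"
    unfolding W_def by (rule integrable_suminf[OF int]) (use ae sum in auto)
  have bound: "AE x in M. \<forall>k. (cmod (P k x - g x))\<^sup>2 \<le> 2 * (1/2) ^ k * W x"
    using ae
  proof eventually_elim
    case (elim x)
    have tele: "P m x - P k x = (\<Sum>i=k..<m. D i x)" if "k \<le> m" for k m
      using sum_Suc_diff'[OF that, of "\<lambda>i. P i x"] by (simp add: D_def)
    have *: "(cmod (P m x - P k x))\<^sup>2 \<le> 2 * (1/2) ^ k * W x" if "k \<le> m" for k m
      using weighted_Cauchy_Schwarz_tail[OF elim, of k m] tele[OF that] by (simp add: W_def)
    have "Cauchy (\<lambda>k. P k x)"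
    proof (rule CauchyI)
      fix e :: real assume e: "e > 0"
      have "(\<lambda>k. 2 * (1/2) ^ k * W x) \<longlonglongrightarrow> 0"
        by (auto intro!: tendsto_eq_intros LIMSEQ_power_zero)
      then have "\<forall>\<^sub>F k in sequentially. 2 * (1/2) ^ k * W x < (e/2)\<^sup>2"
        using e by (intro order_tendstoD) auto
      then obtain K where K: "2 * (1/2) ^ K * W x < (e/2)\<^sup>2" by (auto simp: eventually_sequentially)
      have near: "cmod (P m x - P K x) < e / 2" if "m \<ge> K" for m
        using le_less_trans[OF *[OF that] K] e by (intro power_less_imp_less_base[of _ 2 "e/2"]) auto
      show "\<exists>K. \<forall>m\<ge>K. \<forall>n\<ge>K. norm (P m x - P n x) < e"
      proof (intro exI[of _ K] allI impI)
        fix m n assume "m \<ge> K" "n \<ge> K"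
        then show "norm (P m x - P n x) < e"
          using near[of m] near[of n] norm_triangle_ineq4[of "P m x - P K x" "P n x - P K x"] by simp
      qed
    qed
    then have lim: "(\<lambda>k. P k x) \<longlonglongrightarrow> g x"
      unfolding g_def by (simp add: Cauchy_convergent convergent_LIMSEQ_iff[symmetric])
    show ?case
    proof
      fix k
      have "(\<lambda>m. (cmod (P m x - P k x))\<^sup>2) \<longlonglongrightarrow> (cmod (g x - P k x))\<^sup>2"
        by (intro tendsto_intros lim)
      then have "(cmod (g x - P k x))\<^sup>2 \<le> 2 * (1/2) ^ k * W x"
        by (rule LIMSEQ_le_const2) (use * in auto)
      then show "(cmod (P k x - g x))\<^sup>2 \<le> 2 * (1/2) ^ k * W x" by (simp add: norm_minus_commute)
    qed
  qed
  have gm [measurable]: "g \<in> borel_measurable M" unfolding g_def by measurable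
  have diff: "(\<lambda>x. P k x - g x) \<in> L2 M" and sq: "sqn M (\<lambda>x. P k x - g x) \<le> 2 * (1/2) ^ k * (LINT x|M. W x)" for k
  proof -
    have i: "integrable M (\<lambda>x. 2 * (1/2) ^ k * W x)" using W by simp
    have i2: "integrable M (\<lambda>x. (cmod (P k x - g x))\<^sup>2)"
    proof (rule Bochner_Integration.integrable_bound[OF i])
      show "AE x in M. norm ((cmod (P k x - g x))\<^sup>2) \<le> norm (2 * (1/2) ^ k * W x)"
        using bound
      proof eventually_elim
        case (elim x)
        then show ?case using abs_ge_self[of "2 * (1/2) ^ k * W x"] by (metis abs_of_nonneg order_trans real_norm_def zero_le_power2)
      qed
    qed simp
    then show "(\<lambda>x. P k x - g x) \<in> L2 M" by (simp add: L2_def)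
    have "sqn M (\<lambda>x. P k x - g x) \<le> (LINT x|M. 2 * (1/2) ^ k * W x)"
      unfolding sqn_def by (rule integral_mono_AE[OF i2 i]) (use bound in \<open>auto elim: eventually_mono\<close>)
    then show "sqn M (\<lambda>x. P k x - g x) \<le> 2 * (1/2) ^ k * (LINT x|M. W x)" using W by simp
  qed
  have "(\<lambda>x. P 0 x - (P 0 x - g x)) \<in> L2 M" using P diff by (rule L2_diff)
  then have "g \<in> L2 M" by simp
  moreover have "L2lim M P g"
    unfolding L2lim_def
  proof (rule Lim_null_comparison)
    show "(\<lambda>k. 2 * (1/2) ^ k * (LINT x|M. W x)) \<longlonglongrightarrow> 0"
      by (auto intro!: tendsto_eq_intros LIMSEQ_power_zero)
  qed (use sq in auto)
  ultimately show ?thesis by blast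
qed

section \<open>Fourier series on the torus\<close>

definition phase :: "int^'d \<Rightarrow> real^'d \<Rightarrow> real" where
  "phase n \<theta> = (\<Sum>j\<in>UNIV. real_of_int (n $ j) * \<theta> $ j)"

definition fourier_const :: "'d::finite itself \<Rightarrow> real" where
  "fourier_const _ = (2 * pi) powr (- real CARD('d) / 2)"

text \<open>The phase is negative because \<open>inn\<close> conjugates its first slot: with this
  sign \<open>inv_fourier g n\<close> is exactly the coefficient of \<open>g\<close> along this unit
  vector.\<close>

definition fourier_basis :: "int^'d \<Rightarrow> real^'d \<Rightarrow> complex" where
  "fourier_basis n \<theta> = complex_of_real (fourier_const TYPE('d)) * cis (- phase n \<theta>)"

lemma L2_torus_eq: "L2_torus = L2 torus"
  by (simp add: L2_torus_def L2_def)

lemma inv_fourier_eq: "inv_fourier g n = inn torus (fourier_basis n) g"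
  by (simp add: inv_fourier_def inn_def fourier_basis_def phase_def fourier_const_def cis_cnj mult.assoc)

lemma space_torus: "space (torus :: (real^'d) measure) = cbox (\<chi> j. - pi) (\<chi> j. pi)"
  by (simp add: torus_def space_restrict_space)

lemma borel_measurable_torus: "f \<in> borel_measurable borel \<Longrightarrow> f \<in> borel_measurable (torus :: (real^'d) measure)"
  unfolding torus_def by (rule measurable_restrict_space1) simp

interpretation torus: finite_measure "torus :: (real^'d) measure"
proof
  show "emeasure (torus :: (real^'d) measure) (space torus) \<noteq> \<infinity>"
    unfolding space_torus by (simp add: torus_def emeasure_restrict_space emeasure_lborel_cbox_eq)
qed

lemma vec_nth_measurable [measurable (raw)]:
  fixes f :: "'a \<Rightarrow> 'b::real_normed_vector^'d"
  assumes "f \<in> borel_measurable M"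
  shows "(\<lambda>x. f x $ i) \<in> borel_measurable M"
  by (rule borel_measurable_continuous_on[OF _ assms]) (intro continuous_intros)

lemma cis_measurable [measurable (raw)]:
  assumes "f \<in> borel_measurable M"
  shows "(\<lambda>x. cis (f x)) \<in> borel_measurable M"
  by (rule borel_measurable_continuous_on[OF _ assms]) (intro continuous_intros)

lemma phase_measurable [measurable]: "phase n \<in> borel_measurable borel"
  unfolding phase_def by measurable

lemma fourier_basis_measurable [measurable]: "fourier_basis n \<in> borel_measurable torus"
  unfolding fourier_basis_def by (rule borel_measurable_torus) measurable

lemma phase_add: "phase (m + n) \<theta> = phase m \<theta> + phase n \<theta>"
  by (simp add: phase_def distrib_right sum.distrib)

lemma phase_minus: "phase (- n) \<theta> = - phase n \<theta>"
  by (simp add: phase_def sum_negf)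

lemma phase_diff: "phase (m - n) \<theta> = phase m \<theta> - phase n \<theta>"
  using phase_add[of m "- n" \<theta>] by (simp add: phase_minus)

lemma phase_axis: "phase (axis j 1) \<theta> = \<theta> $ j"
proof -
  have "phase (axis j 1) \<theta> = (\<Sum>i\<in>UNIV. if i = j then \<theta> $ j else 0)"
    unfolding phase_def by (rule sum.cong) (auto simp: axis_def)
  then show ?thesis by simp
qed

lemma integral_torus_prod:
  fixes f :: "'d::finite \<Rightarrow> real \<Rightarrow> complex"
  assumes "\<And>j. integrable lborel (\<lambda>x. indicator {- pi..pi} x *\<^sub>R f j x)"
  shows "(LINT \<theta>|torus. (\<Prod>j\<in>UNIV. f j (\<theta> $ j))) = (\<Prod>j\<in>UNIV. (LINT x|lborel. indicator {- pi..pi} x *\<^sub>R f j x))"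
proof -
  interpret product_sigma_finite "\<lambda>_::real^'d. lborel :: real measure" by standard
  \<comment> \<open>As a product measure, \<open>lborel\<close> on \<open>real^'d\<close> is indexed
    by basis vectors rather than by \<open>'d\<close>; \<open>THE\<close> recovers the coordinate
    \<open>j\<close> from \<open>axis j 1\<close>.\<close>
  define F where "F = (\<lambda>(b::real^'d) x. indicator {- pi..pi} x *\<^sub>R f (THE j. b = axis j 1) x)"
  have F: "F (axis j 1) = (\<lambda>x. indicator {- pi..pi} x *\<^sub>R f j x)" for j
    by (auto simp: F_def axis_eq_axis)
  have bas: "(Basis :: (real^'d) set) = (\<lambda>j. axis j 1) ` UNIV"
    by (auto simp: Basis_vec_def)
  have inj: "inj_on (\<lambda>j. axis j 1 :: real^'d) UNIV"
    by (auto simp: inj_on_def axis_eq_axis)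
  have Fi: "integrable lborel (F b)" if "b \<in> Basis" for b
    using that assms F by (auto simp: bas)
  have Fm: "(\<lambda>x. F b (x \<bullet> b)) \<in> borel_measurable borel" if "b \<in> Basis" for b
    using borel_measurable_integrable[OF Fi[OF that]] by measurable
  have ind: "(indicator (cbox (\<chi> j. - pi) (\<chi> j. pi)) \<theta> :: real) = (\<Prod>j\<in>UNIV. indicator {- pi..pi} (\<theta> $ j))" for \<theta> :: "real^'d"
  proof (cases "\<theta> \<in> cbox (\<chi> j. - pi) (\<chi> j. pi)")
    case False
    then obtain j where "\<theta> $ j \<notin> {- pi..pi}" by (auto simp: mem_box_cart)
    then have "(\<Prod>j\<in>UNIV. indicator {- pi..pi} (\<theta> $ j)) = (0::real)"
      by (intro prod_zero bexI[of _ j]) (auto simp: indicator_def)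
    with False show ?thesis by simp
  qed (auto simp: mem_box_cart intro!: prod.neutral[symmetric])
  have "(LINT \<theta>|torus. (\<Prod>j\<in>UNIV. f j (\<theta> $ j))) =
      (LINT \<theta>|lborel. indicator (cbox (\<chi> j. - pi) (\<chi> j. pi)) \<theta> *\<^sub>R (\<Prod>j\<in>UNIV. f j (\<theta> $ j)))"
    unfolding torus_def by (rule integral_restrict_space) simp
  also have "\<dots> = (LINT \<theta>|lborel. (\<Prod>b\<in>Basis. F b (\<theta> \<bullet> b)))"
    unfolding ind bas prod.reindex[OF inj]
    by (simp add: F prod.distrib scaleR_conv_of_real inner_axis)
  also have "\<dots> = (LINT x|(\<Pi>\<^sub>M b\<in>Basis. lborel). (\<Prod>b\<in>Basis. F b ((\<Sum>c\<in>Basis. x c *\<^sub>R c) \<bullet> b)))"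
    unfolding lborel_eq[where 'a = "real^'d"]
    by (rule integral_distr) (use Fm in measurable)
  also have "\<dots> = (LINT x|(\<Pi>\<^sub>M b\<in>Basis. lborel). (\<Prod>b\<in>Basis. F b (x b)))"
    by (intro Bochner_Integration.integral_cong prod.cong refl) (simp add: inner_sum_left_Basis)
  also have "\<dots> = (\<Prod>b\<in>Basis. (LINT x|lborel. F b x))"
    by (rule product_integral_prod) (use Fi in auto)
  also have "\<dots> = (\<Prod>j\<in>UNIV. (LINT x|lborel. indicator {- pi..pi} x *\<^sub>R f j x))"
    unfolding bas prod.reindex[OF inj] by (simp add: F)
  finally show ?thesis .
qed

lemma integral_cis_int:
  fixes k :: int
  shows "(LINT x|lborel. indicator {- pi..pi} x *\<^sub>R cis (real_of_int k * x)) = (if k = 0 then of_real (2 * pi) else 0)"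
proof (cases "k = 0")
  case True
  have "(LINT x|lborel. indicator {- pi..pi} x *\<^sub>R (1::complex)) = of_real pi - of_real (- pi)"
    by (rule integral_FTC_atLeastAtMost)
       (auto intro!: derivative_eq_intros has_vector_derivative_of_real simp: pi_ge_zero)
  then show ?thesis using True by simp
next
  case False
  have "(LINT x|lborel. indicator {- pi..pi} x *\<^sub>R cis (real_of_int k * x)) =
    cis (real_of_int k * pi) / (\<i> * of_int k) - cis (real_of_int k * (- pi)) / (\<i> * of_int k)"
  proof (rule integral_FTC_atLeastAtMost)
    fix x :: real
    have "((\<lambda>z. exp (\<i> * of_int k * z) / (\<i> * of_int k)) has_field_derivative exp (\<i> * of_int k * of_real x)) (at (of_real x))"
      using False by (auto intro!: derivative_eq_intros)
    from has_vector_derivative_real_field[OF this, of "{-pi..pi}"]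
    show "((\<lambda>x. cis (real_of_int k * x) / (\<i> * of_int k)) has_vector_derivative cis (real_of_int k * x)) (at x within {- pi..pi})"
      by (simp add: cis_conv_exp mult.assoc)
  qed (auto intro!: continuous_intros simp: pi_ge_zero)
  also have "cis (real_of_int k * (- pi)) = cis (real_of_int k * pi)"
    by (rule complex_eqI) (auto simp: sin_int_times_real sin_times_pi_eq_0)
  finally show ?thesis using False by simp
qed

lemma integral_cis_phase:
  fixes n :: "int^'d"
  shows "(LINT \<theta>|torus. cis (phase n \<theta>)) = (if n = 0 then of_real ((2 * pi) ^ CARD('d)) else 0)"
proof -
  have cis_sum: "cis (sum f A) = (\<Prod>j\<in>A. cis (f j))" if "finite A" for f :: "'d \<Rightarrow> real" and A
    using that by (induction A) (auto simp flip: cis_mult)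
  have "(LINT \<theta>|torus. cis (phase n \<theta>)) = (LINT \<theta>|torus. (\<Prod>j\<in>UNIV. cis (real_of_int (n $ j) * \<theta> $ j)))"
    by (simp add: phase_def cis_sum)
  also have "\<dots> = (\<Prod>j\<in>UNIV. (LINT x|lborel. indicator {- pi..pi} x *\<^sub>R cis (real_of_int (n $ j) * x)))"
    by (intro integral_torus_prod borel_integrable_compact[of "{-pi..pi}", unfolded set_integrable_def]) (auto intro!: continuous_intros)
  also have "\<dots> = (\<Prod>j\<in>UNIV. if n $ j = 0 then of_real (2 * pi) else 0)"
    unfolding integral_cis_int ..
  also have "\<dots> = (if n = 0 then of_real ((2 * pi) ^ CARD('d)) else 0)"
  proof (cases "n = 0")
    case False
    then obtain j where "n $ j \<noteq> 0" by (auto simp: vec_eq_iff)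
    then have "(\<Prod>j\<in>UNIV. if n $ j = 0 then of_real (2 * pi) else 0) = (0::complex)" by (intro prod_zero) auto
    then show ?thesis using False by simp
  qed simp
  finally show ?thesis .
qed

lemma fourier_basis_L2 [simp]:
  fixes n :: "int^'d"
  shows "fourier_basis n \<in> L2 torus"
proof -
  have "(\<lambda>\<theta>. 1 :: complex) \<in> L2 (torus :: (real^'d) measure)" by (simp add: L2_def)
  then show ?thesis
    by (rule L2_dominated[where C = "\<bar>fourier_const TYPE('d)\<bar>"]) (auto simp: fourier_basis_def norm_mult)
qed

lemma fourier_const_sq: "complex_of_real (fourier_const TYPE('d::finite)) * complex_of_real (fourier_const TYPE('d)) * of_real ((2 * pi) ^ CARD('d)) = 1"
proof -
  have "fourier_const TYPE('d) * fourier_const TYPE('d) * (2 * pi) ^ CARD('d) = 1"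
    unfolding fourier_const_def powr_realpow[of "2 * pi" "CARD('d)", OF mult_pos_pos[OF zero_less_numeral pi_gt_zero], symmetric]
    by (simp only: powr_add[symmetric]) simp
  then show ?thesis by (metis of_real_1 of_real_mult)
qed

lemma fourier_const_pos: "fourier_const TYPE('d::finite) > 0"
  by (simp add: fourier_const_def)

lemma inn_fourier_basis: "inn torus (fourier_basis m) (fourier_basis n) = (if m = n then 1 else 0)"
  for m n :: "int^'d"
proof -
  have "inn torus (fourier_basis m) (fourier_basis n) =
    (LINT \<theta>|torus. (of_real (fourier_const TYPE('d)) * of_real (fourier_const TYPE('d))) * cis (phase (m - n) \<theta>))"
    unfolding inn_def by (rule Bochner_Integration.integral_cong) (auto simp: fourier_basis_def cis_cnj phase_diff cis_mult mult_ac)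
  also have "\<dots> = of_real (fourier_const TYPE('d)) * of_real (fourier_const TYPE('d)) * (LINT \<theta>|torus. cis (phase (m - n) \<theta>))"
    by simp
  finally show ?thesis
    unfolding integral_cis_phase using fourier_const_sq[where 'd = 'd] by auto
qed

section \<open>Completeness of the exponentials\<close>

definition torus_embed :: "real^'d \<Rightarrow> complex^'d" where
  "torus_embed \<theta> = (\<chi> j. cis (\<theta> $ j))"

text \<open>The annihilator of the exponentials among integrable functions. To see that it is
  trivial, the class of test functions is enlarged from polynomials to continuous functions, then to
  indicators of closed and of Borel sets.\<close>

definition fourier_null :: "(real^'d \<Rightarrow> complex) \<Rightarrow> bool" where
  "fourier_null G \<longleftrightarrow> integrable torus G \<and> (\<forall>n. (LINT \<theta>|torus. cis (phase n \<theta>) * G \<theta>) = 0)"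

lemma integrable_bounded_mult:
  fixes G m :: "'a \<Rightarrow> complex"
  assumes "integrable M G" "m \<in> borel_measurable M" "\<And>x. x \<in> space M \<Longrightarrow> cmod (m x) \<le> C"
  shows "integrable M (\<lambda>x. m x * G x)"
proof (rule Bochner_Integration.integrable_bound)
  show "integrable M (\<lambda>x. complex_of_real C * G x)" using assms(1) by simp
  show "AE x in M. cmod (m x * G x) \<le> cmod (complex_of_real C * G x)"
    using assms(3) by (intro AE_I2) (auto simp: norm_mult intro!: mult_right_mono order_trans[OF _ abs_ge_self])
qed (use assms in measurable)

lemma fourier_null_add: "fourier_null G \<Longrightarrow> fourier_null H \<Longrightarrow> fourier_null (\<lambda>\<theta>. G \<theta> + H \<theta>)"
  and fourier_null_scale: "fourier_null G \<Longrightarrow> fourier_null (\<lambda>\<theta>. c * G \<theta>)"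
proof -
  have i: "integrable torus (\<lambda>\<theta>. cis (phase n \<theta>) * G \<theta>)" if "fourier_null G" for G n
    by (rule integrable_bounded_mult[where C = 1])
       (use that in \<open>auto simp: fourier_null_def intro!: borel_measurable_torus\<close>)
  show "fourier_null (\<lambda>\<theta>. G \<theta> + H \<theta>)" if "fourier_null G" "fourier_null H"
    using that i[OF that(1)] i[OF that(2)] by (simp add: fourier_null_def distrib_left)
  show "fourier_null (\<lambda>\<theta>. c * G \<theta>)" if "fourier_null G"
    using that by (simp add: fourier_null_def mult.left_commute[of _ c])
qed

lemma fourier_null_sum: "(\<And>i. i \<in> I \<Longrightarrow> fourier_null (G i)) \<Longrightarrow> fourier_null (\<lambda>\<theta>. \<Sum>i\<in>I. G i \<theta>)"
proof (induction I rule: infinite_finite_induct)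
  case (insert x F)
  then show ?case by (simp add: fourier_null_add)
qed (auto simp: fourier_null_def)

lemma fourier_null_cis: "fourier_null G \<Longrightarrow> fourier_null (\<lambda>\<theta>. cis (phase m \<theta>) * G \<theta>)"
  unfolding fourier_null_def
proof safe
  assume G: "integrable torus G" and *: "\<forall>n. (LINT \<theta>|torus. cis (phase n \<theta>) * G \<theta>) = 0"
  show "integrable torus (\<lambda>\<theta>. cis (phase m \<theta>) * G \<theta>)"
    by (rule integrable_bounded_mult[OF G, where C = 1]) (auto intro!: borel_measurable_torus)
  fix n
  have eq: "cis (phase n \<theta>) * (cis (phase m \<theta>) * G \<theta>) = cis (phase (n + m) \<theta>) * G \<theta>" for \<theta>
    unfolding phase_add cis_mult[symmetric] by (rule mult.assoc[symmetric])
  show "(LINT \<theta>|torus. cis (phase n \<theta>) * (cis (phase m \<theta>) * G \<theta>)) = 0"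
    unfolding eq using * by blast
qed

text \<open>Stated for arbitrary \<open>G\<close> so that products can be handled by applying the
  induction hypothesis twice. Multiplication by a coordinate is a combination of multiplications by
  exponentials, which only shift the index of the coefficients.\<close>

lemma fourier_null_polynomial:
  fixes p :: "complex^'d \<Rightarrow> real"
  assumes "real_polynomial_function p" "fourier_null G"
  shows "fourier_null (\<lambda>\<theta>. of_real (p (torus_embed \<theta>)) * G \<theta>)"
  using assms
proof (induction p arbitrary: G)
  case (linear f)
  define \<alpha> \<beta> where "\<alpha> j = f (axis j 1)" and "\<beta> j = f (axis j \<i>)" for j
  have f: "f z = (\<Sum>j\<in>UNIV. \<alpha> j * Re (z $ j) + \<beta> j * Im (z $ j))" for z
  proof -
    have "z = (\<Sum>j\<in>UNIV. Re (z $ j) *\<^sub>R axis j 1 + Im (z $ j) *\<^sub>R axis j \<i>)"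
    proof (rule vec_eq_iff[THEN iffD2], rule allI)
      fix i
      have "(\<Sum>j\<in>UNIV. Re (z $ j) *\<^sub>R axis j 1 + Im (z $ j) *\<^sub>R axis j \<i>) $ i =
         (\<Sum>j\<in>UNIV. if j = i then Re (z $ i) *\<^sub>R 1 + Im (z $ i) *\<^sub>R \<i> else 0)"
        unfolding sum_component by (rule sum.cong) (auto simp: axis_def)
      also have "\<dots> = z $ i" by (simp add: complex_eq_iff)
      finally show "z $ i = (\<Sum>j\<in>UNIV. Re (z $ j) *\<^sub>R axis j 1 + Im (z $ j) *\<^sub>R axis j \<i>) $ i" ..
    qed
    then have "f z = f (\<Sum>j\<in>UNIV. Re (z $ j) *\<^sub>R axis j 1 + Im (z $ j) *\<^sub>R axis j \<i>)" by simp
    also have "\<dots> = (\<Sum>j\<in>UNIV. \<alpha> j * Re (z $ j) + \<beta> j * Im (z $ j))"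
      using linear(1) by (simp add: linear_sum linear_add linear_cmul bounded_linear.linear \<alpha>_def \<beta>_def mult.commute)
    finally show ?thesis .
  qed
  \<comment> \<open>A real linear functional of \<open>cis (\<theta> $ j)\<close> is
    \<open>\<alpha> cos + \<beta> sin\<close>, rewritten in the two exponentials of phase
    \<open>\<theta> $ j\<close> and \<open>- \<theta> $ j\<close>.\<close>
  have eq: "of_real (f (torus_embed \<theta>)) * g = (\<Sum>j\<in>UNIV. (of_real (\<alpha> j) - \<i> * of_real (\<beta> j)) / 2 * (cis (phase (axis j 1) \<theta>) * g)
       + (of_real (\<alpha> j) + \<i> * of_real (\<beta> j)) / 2 * (cis (phase (- axis j 1) \<theta>) * g))" for \<theta> g
    unfolding f of_real_sum sum_distrib_right
    by (rule sum.cong) (auto simp: torus_embed_def phase_axis phase_minus complex_eq_iff field_simps)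
  show ?case
    unfolding eq
    by (intro fourier_null_sum fourier_null_add fourier_null_scale fourier_null_cis linear)
next
  case (const c)
  then show ?case by (rule fourier_null_scale)
next
  case (add f g)
  from fourier_null_add[OF add.IH[OF add.prems]] show ?case by (simp add: distrib_right)
next
  case (mult f g)
  from mult.IH(1)[OF mult.IH(2)[OF mult.prems]] show ?case by (simp add: mult.assoc)
qed

lemma continuous_torus_embed: "continuous_on S torus_embed"
  unfolding torus_embed_def by (intro continuous_intros continuous_on_vec_lambda)

lemma torus_embed_measurable [measurable]: "torus_embed \<in> borel_measurable borel"
  by (rule borel_measurable_continuous_onI) (rule continuous_torus_embed)

lemma torus_embed_measurable' [measurable]: "torus_embed \<in> borel_measurable torus"
  by (rule borel_measurable_torus) measurable

text \<open>Stone-Weierstrass on the compact image of the cube under \<open>torus_embed\<close>. In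
  the coordinates \<open>cis (\<theta> $ j)\<close> opposite faces are identified and trigonometric
  polynomials become real polynomials. The error is at most \<open>e\<close> times the integral of
  \<open>cmod (G \<theta>)\<close>.\<close>

lemma fourier_null_continuous:
  fixes f :: "complex^'d \<Rightarrow> real"
  assumes f: "continuous_on UNIV f" and G: "fourier_null G"
  shows "(LINT \<theta>|torus. of_real (f (torus_embed \<theta>)) * G \<theta>) = 0"
proof -
  have Gi: "integrable torus G" using G by (simp add: fourier_null_def)
  define K where "K = torus_embed ` (cbox (\<chi> j. - pi) (\<chi> j. pi) :: (real^'d) set)"
  have K: "compact K"
    unfolding K_def by (intro compact_continuous_image continuous_torus_embed compact_cbox)
  have inK: "torus_embed \<theta> \<in> K" if "\<theta> \<in> space torus" for \<theta> :: "real^'d"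
    using that by (auto simp: K_def space_torus)
  have fm [measurable]: "f \<in> borel_measurable borel" using f by (rule borel_measurable_continuous_onI)
  obtain B where B: "\<And>z. z \<in> K \<Longrightarrow> \<bar>f z\<bar> \<le> B"
    using compact_imp_bounded[OF compact_continuous_image[OF continuous_on_subset[OF f subset_UNIV] K]]
    by (auto simp: bounded_iff)
  have fi: "integrable torus (\<lambda>\<theta>. of_real (f (torus_embed \<theta>)) * G \<theta>)"
    by (rule integrable_bounded_mult[OF Gi, where C = B]) (use B inK in auto)
  have "cmod (LINT \<theta>|torus. of_real (f (torus_embed \<theta>)) * G \<theta>) \<le> e * (LINT \<theta>|torus. cmod (G \<theta>))" if e: "e > 0" for e
  proof -
    obtain p where p: "real_polynomial_function p" "\<And>z. z \<in> K \<Longrightarrow> \<bar>f z - p z\<bar> < e"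
      using Stone_Weierstrass_real_polynomial_function[OF K continuous_on_subset[OF f subset_UNIV] e] by blast
    have null: "fourier_null (\<lambda>\<theta>. of_real (p (torus_embed \<theta>)) * G \<theta>)"
      by (rule fourier_null_polynomial) (use p G in auto)
    then have pi: "integrable torus (\<lambda>\<theta>. of_real (p (torus_embed \<theta>)) * G \<theta>)"
      and p0: "(LINT \<theta>|torus. of_real (p (torus_embed \<theta>)) * G \<theta>) = 0"
      unfolding fourier_null_def by (auto simp: phase_def dest!: spec[of _ 0])
    have "(LINT \<theta>|torus. of_real (f (torus_embed \<theta>)) * G \<theta>) =
      (LINT \<theta>|torus. of_real (f (torus_embed \<theta>)) * G \<theta> - of_real (p (torus_embed \<theta>)) * G \<theta>)"
      using fi pi p0 by simp
    also have "cmod \<dots> \<le> (LINT \<theta>|torus. e * cmod (G \<theta>))"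
    proof (rule order_trans[OF integral_norm_bound integral_mono])
      fix \<theta> :: "real^'d" assume "\<theta> \<in> space torus"
      then have "\<bar>f (torus_embed \<theta>) - p (torus_embed \<theta>)\<bar> \<le> e" using p(2) inK by (simp add: less_imp_le)
      moreover have "cmod (of_real (f (torus_embed \<theta>)) * G \<theta> - of_real (p (torus_embed \<theta>)) * G \<theta>) =
         \<bar>f (torus_embed \<theta>) - p (torus_embed \<theta>)\<bar> * cmod (G \<theta>)"
        by (simp add: left_diff_distrib[symmetric] norm_mult of_real_diff[symmetric] del: of_real_diff)
      ultimately show "cmod (of_real (f (torus_embed \<theta>)) * G \<theta> - of_real (p (torus_embed \<theta>)) * G \<theta>) \<le> e * cmod (G \<theta>)"
        by (simp add: mult_right_mono)
    qed (use Gi fi pi in auto)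
    finally show ?thesis by simp
  qed
  note bound = this
  have "cmod (LINT \<theta>|torus. of_real (f (torus_embed \<theta>)) * G \<theta>) \<le> 0"
  proof (rule field_le_epsilon)
    fix e :: real assume e: "e > 0"
    let ?I = "LINT \<theta>|torus. cmod (G \<theta>)"
    have I: "0 \<le> ?I" by simp
    have "e * ?I \<le> e * (?I + 1)" using e by simp
    moreover have "?I + 1 > 0" using I by linarith
    ultimately have "e / (?I + 1) * ?I \<le> e" by (simp add: pos_divide_le_eq)
    moreover have "e / (?I + 1) > 0" using I e by (simp add: add_nonneg_pos)
    ultimately show "cmod (LINT \<theta>|torus. of_real (f (torus_embed \<theta>)) * G \<theta>) \<le> 0 + e"
      using bound[of "e / (?I + 1)"] by linarith
  qed
  then show ?thesis by simp
qed

text \<open>The indicator of a closed set is the pointwise limit of the continuous bumps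
  \<open>max 0 (1 - k * infdist z C)\<close>, all bounded by 1, so dominated convergence
  applies.\<close>

lemma fourier_null_closed:
  fixes C :: "(complex^'d) set"
  assumes "closed C" and G: "fourier_null G"
  shows "(LINT \<theta>|torus. indicator C (torus_embed \<theta>) * G \<theta>) = 0"
proof (cases "C = {}")
  \<comment> \<open>By convention \<open>infdist z {} = 0\<close>, so for the empty set the bumps
    would be constantly 1; that case is settled separately.\<close>
  case False
  have Gi: "integrable torus G" using G by (simp add: fourier_null_def)
  have Gm [measurable]: "G \<in> borel_measurable torus" using Gi by auto
  have Cm [measurable]: "C \<in> sets borel" using assms(1) by auto
  define f where "f = (\<lambda>(k::nat) z. max 0 (1 - real k * infdist z C))"
  have fc: "continuous_on UNIV (f k)" for k
    unfolding f_def by (intro continuous_intros)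
  have fm [measurable]: "f k \<in> borel_measurable borel" for k using fc by (rule borel_measurable_continuous_onI)
  have lim: "(\<lambda>k. f k z) \<longlonglongrightarrow> indicator C z" for z
  proof (cases "z \<in> C")
    case True
    then show ?thesis by (simp add: f_def)
  next
    case z: False
    then have pos: "infdist z C > 0"
      using assms(1) False by (metis in_closed_iff_infdist_zero infdist_nonneg less_eq_real_def)
    obtain K :: nat where K: "1 / infdist z C < real K" using reals_Archimedean2 by blast
    have "f k z = 0" if "k \<ge> K" for k
    proof -
      have "1 / infdist z C \<le> real k" using K that by linarith
      then show ?thesis using pos by (simp add: f_def field_simps)
    qed
    then show ?thesis using z by (auto intro!: tendsto_eventually exI[of _ K] simp: eventually_sequentially)
  qed
  have "(\<lambda>k. LINT \<theta>|torus. of_real (f k (torus_embed \<theta>)) * G \<theta>) \<longlonglongrightarrow> (LINT \<theta>|torus. indicator C (torus_embed \<theta>) * G \<theta>)"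
  proof (rule integral_dominated_convergence[where w = "\<lambda>\<theta>. cmod (G \<theta>)"])
    show "AE x in torus. (\<lambda>k. of_real (f k (torus_embed x)) * G x) \<longlonglongrightarrow> indicator C (torus_embed x) * G x"
    proof (rule AE_I2)
      fix x
      show "(\<lambda>k. of_real (f k (torus_embed x)) * G x) \<longlonglongrightarrow> indicator C (torus_embed x) * G x"
        using tendsto_mult[OF tendsto_of_real[OF lim[of "torus_embed x"]] tendsto_const[of "G x"]]
        by (auto simp: indicator_def split: if_splits)
    qed
    show "AE x in torus. cmod (of_real (f k (torus_embed x)) * G x) \<le> cmod (G x)" for k
    proof (rule AE_I2)
      fix x
      have "\<bar>f k (torus_embed x)\<bar> \<le> 1" using infdist_nonneg[of "torus_embed x" C] by (simp add: f_def)
      then show "cmod (of_real (f k (torus_embed x)) * G x) \<le> cmod (G x)"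
        by (simp add: norm_mult mult_left_le_one_le)
    qed
  qed (use Gi in auto)
  then show ?thesis
    unfolding fourier_null_continuous[OF fc G] by (simp add: LIMSEQ_const_iff)
qed simp

text \<open>Dynkin's argument: the closed sets form an intersection-stable generator, and the sets
  annihilated by \<open>G\<close> are closed under complements and disjoint unions. The whole space
  is covered by the coefficient at 0.\<close>

lemma fourier_null_Borel:
  fixes S :: "(complex^'d) set"
  assumes S: "S \<in> sets borel" and G: "fourier_null G"
  shows "(LINT \<theta>|torus. indicator S (torus_embed \<theta>) * G \<theta>) = 0"
proof -
  have Gi: "integrable torus G" using G by (simp add: fourier_null_def)
  have Gm [measurable]: "G \<in> borel_measurable torus" using Gi by auto
  have ii: "integrable torus (\<lambda>\<theta>. indicator S (torus_embed \<theta>) * G \<theta>)" if "S \<in> sets borel" for S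
  proof -
    have [measurable]: "S \<in> sets borel" by fact
    show ?thesis by (rule integrable_bounded_mult[OF Gi, where C = 1]) (auto simp: indicator_def)
  qed
  have G0: "(LINT \<theta>|torus. G \<theta>) = 0"
    using G unfolding fourier_null_def by (auto simp: phase_def dest!: spec[of _ 0])
  have int: "Int_stable (Collect closed :: (complex^'d) set set)" by (auto simp: Int_stable_def)
  have sub: "Collect closed \<subseteq> Pow (UNIV :: (complex^'d) set)" by simp
  have "S \<in> sigma_sets UNIV (Collect closed)"
    using S by (simp add: borel_eq_closed)
  then show ?thesis
  proof (induct rule: sigma_sets_induct_disjoint[OF int sub, consumes 1, case_names basic empty compl union])
    case (basic A)
    then show ?case using fourier_null_closed[OF _ G] by simp
  next
    case empty
    then show ?case by simp
  next
    case (compl A)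
    have A: "A \<in> sets borel" using compl(1) by (simp add: borel_eq_closed)
    have "(LINT \<theta>|torus. indicator (UNIV - A) (torus_embed \<theta>) * G \<theta>) =
      (LINT \<theta>|torus. G \<theta> - indicator A (torus_embed \<theta>) * G \<theta>)"
      by (rule Bochner_Integration.integral_cong) (auto simp: indicator_def)
    then show ?case using compl(2) ii[OF A] Gi G0 by simp
  next
    case (union A)
    have A [measurable]: "A i \<in> sets borel" for i using union(2) by (auto simp: borel_eq_closed)
    have "(\<lambda>k. LINT \<theta>|torus. indicator (\<Union>i<k. A i) (torus_embed \<theta>) * G \<theta>) \<longlonglongrightarrow>
        (LINT \<theta>|torus. indicator (\<Union>i. A i) (torus_embed \<theta>) * G \<theta>)"
    proof (rule integral_dominated_convergence[where w = "\<lambda>\<theta>. cmod (G \<theta>)"])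
      show "AE x in torus. (\<lambda>k. indicator (\<Union>i<k. A i) (torus_embed x) * G x) \<longlonglongrightarrow> indicator (\<Union>i. A i) (torus_embed x) * G x"
        by (intro AE_I2 tendsto_mult tendsto_const LIMSEQ_indicator_UN)
      show "AE x in torus. cmod (indicator (\<Union>i<k. A i) (torus_embed x) * G x) \<le> cmod (G x)" for k
        by (rule AE_I2) (auto simp: norm_mult indicator_def)
      show "(\<lambda>\<theta>. indicator (\<Union>i. A i) (torus_embed \<theta>) * G \<theta>) \<in> borel_measurable torus"
        by (rule borel_measurable_integrable[OF ii]) measurable
      show "(\<lambda>\<theta>. indicator (\<Union>i<k. A i) (torus_embed \<theta>) * G \<theta>) \<in> borel_measurable torus" for k
        by (rule borel_measurable_integrable[OF ii]) measurable
    qed (use Gi in auto)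
    moreover have "(LINT \<theta>|torus. indicator (\<Union>i<k. A i) (torus_embed \<theta>) * G \<theta>) = 0" for k
    proof -
      have "(indicator (\<Union>i<k. A i) z :: complex) = (\<Sum>i<k. indicator (A i) z)" for z
        using union(1) by (subst indicator_UN_disjoint) (auto simp: disjoint_family_on_def)
      then have "(LINT \<theta>|torus. indicator (\<Union>i<k. A i) (torus_embed \<theta>) * G \<theta>) =
        (LINT \<theta>|torus. (\<Sum>i<k. indicator (A i) (torus_embed \<theta>) * G \<theta>))"
        by (simp add: sum_distrib_right)
      also have "\<dots> = (\<Sum>i<k. LINT \<theta>|torus. indicator (A i) (torus_embed \<theta>) * G \<theta>)"
        by (rule Bochner_Integration.integral_sum) (rule ii[OF A])
      also have "\<dots> = 0" using union(3) by simp
      finally show ?thesis .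
    qed
    ultimately show ?case by (simp add: LIMSEQ_const_iff)
  qed
qed

lemma AE_torus_component_neq: "AE \<theta> in (torus :: (real^'d) measure). \<theta> $ j \<noteq> c"
proof -
  have "negligible {x::real^'d. x $ j = c}" using negligible_standard_hyperplane[of "axis j 1 :: real^'d" c] by (simp add: inner_axis axis_in_Basis_iff)
  then have "{x::real^'d. x $ j = c} \<in> null_sets lebesgue" by (simp add: negligible_iff_null_sets)
  moreover have "{x::real^'d. x $ j = c} \<in> sets lborel" by measurable
  ultimately have "{x::real^'d. x $ j = c} \<in> null_sets lborel" by (simp add: null_sets_completion_iff)
  then have "AE x in lborel. \<not> (x::real^'d) $ j = c"
    by (rule AE_I') auto
  then show ?thesis unfolding torus_def by (subst AE_restrict_space_iff) auto
qed

text \<open>A Borel left inverse of \<open>torus_embed\<close> off the faces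
  \<open>\<theta> $ j = - pi\<close>, which are null sets. The cut of \<open>Arg\<close> is treated
  apart because continuity holds only off it; on the negative axis the value \<open>pi\<close> is
  that of \<open>Arg\<close>.\<close>

definition torus_angle :: "complex^'d \<Rightarrow> real^'d" where
  "torus_angle z = (\<chi> j. if z $ j \<in> \<real>\<^sub>\<le>\<^sub>0 then pi else Arg (z $ j))"

lemma torus_angle_measurable [measurable]: "torus_angle \<in> borel_measurable borel"
proof -
  have a: "(\<lambda>z::complex. if z \<in> \<real>\<^sub>\<le>\<^sub>0 then pi else Arg z) \<in> borel_measurable borel"
  proof (rule borel_measurable_continuous_on_if)
    show "\<real>\<^sub>\<le>\<^sub>0 \<in> sets (borel :: complex measure)" using closed_nonpos_Reals_complex by (rule borel_closed)
    show "continuous_on (- \<real>\<^sub>\<le>\<^sub>0) Arg"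
      by (intro continuous_at_imp_continuous_on ballI continuous_at_Arg) auto
  qed auto
  show ?thesis
  proof (rule borel_measurable_euclidean_space[THEN iffD2], rule ballI)
    fix b :: "real^'d" assume "b \<in> Basis"
    then obtain j where b: "b = axis j 1" by (auto simp: Basis_vec_def)
    have "(\<lambda>z::complex^'d. (\<lambda>z. if z \<in> \<real>\<^sub>\<le>\<^sub>0 then pi else Arg z) (z $ j)) \<in> borel_measurable borel"
      by (rule measurable_compose[OF _ a]) measurable
    then show "(\<lambda>x. torus_angle x \<bullet> b) \<in> borel_measurable borel"
      by (simp add: b inner_axis torus_angle_def)
  qed
qed

lemma torus_angle_embed:
  assumes "\<theta> \<in> space torus" "\<And>j. \<theta> $ j \<noteq> - pi"
  shows "torus_angle (torus_embed \<theta>) = \<theta>"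
proof -
  have "(if cis (\<theta> $ j) \<in> \<real>\<^sub>\<le>\<^sub>0 then pi else Arg (cis (\<theta> $ j))) = \<theta> $ j" for j
  proof -
    have "- pi \<le> \<theta> $ j" "\<theta> $ j \<le> pi" using assms(1) by (auto simp: space_torus mem_box_cart)
    then have j: "\<theta> $ j \<in> {- pi<..pi}" using assms(2)[of j] by auto
    show ?thesis
    proof (cases "cis (\<theta> $ j) \<in> \<real>\<^sub>\<le>\<^sub>0")
      case True
      then have "Arg (cis (\<theta> $ j)) = pi"
        by (metis Arg_eq_pi cis_neq_zero complex_nonpos_Reals_iff complex_eq_iff less_eq_real_def zero_complex.sel)
      then show ?thesis using True Arg_cis[OF j] by simp
    qed (simp add: Arg_cis[OF j])
  qed
  then show ?thesis
    by (intro vec_eq_iff[THEN iffD2] allI) (simp only: torus_angle_def torus_embed_def vec_lambda_beta)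
qed

lemma fourier_null_Borel_torus:
  assumes S: "S \<in> sets borel" and G: "fourier_null G"
  shows "(LINT \<theta>|torus. indicator S \<theta> * G \<theta>) = 0"
proof -
  have [measurable]: "G \<in> borel_measurable torus" using G by (auto simp: fourier_null_def)
  have [measurable]: "S \<in> sets borel" by fact
  have Sm [measurable]: "torus_angle -` S \<in> sets borel"
    using measurable_sets[OF torus_angle_measurable S] by simp
  have Si: "(indicator S :: _ \<Rightarrow> complex) \<in> borel_measurable torus" by (rule borel_measurable_torus) measurable
  have "(LINT \<theta>|torus. indicator S \<theta> * G \<theta>) = (LINT \<theta>|torus. indicator (torus_angle -` S) (torus_embed \<theta>) * G \<theta>)"
  proof (rule integral_cong_AE)
    have "AE \<theta> in torus. \<forall>j. \<theta> $ j \<noteq> - pi" by (simp add: AE_torus_component_neq AE_all_countable)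
    then show "AE \<theta> in torus. indicator S \<theta> * G \<theta> = indicator (torus_angle -` S) (torus_embed \<theta>) * G \<theta>"
      using AE_space
    proof eventually_elim
      case (elim \<theta>)
      have "torus_angle (torus_embed \<theta>) = \<theta>" by (rule torus_angle_embed) (use elim in auto)
      then show ?case by (simp add: indicator_def)
    qed
  qed (use Si in measurable)
  then show ?thesis using fourier_null_Borel[OF Sm G] by simp
qed

text \<open>Testing against the set where \<open>Re (G \<theta>) > 0\<close> shows that the positive
  part of the real part integrates to 0.\<close>

lemma fourier_null_imp_AE_zero:
  assumes G: "fourier_null G"
  shows "AE \<theta> in torus. G \<theta> = 0"
proof -
  have le: "AE \<theta> in torus. Re (G \<theta>) \<le> 0" if G: "fourier_null G" for G :: "real^'a \<Rightarrow> complex"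
  proof -
    have Gi: "integrable torus G" and Gm [measurable]: "G \<in> borel_measurable torus" using G by (auto simp: fourier_null_def)
    have "{\<theta> \<in> space torus. Re (G \<theta>) > 0} \<in> sets torus" by measurable
    then obtain S where S: "S \<in> sets borel" "{\<theta> \<in> space torus. Re (G \<theta>) > 0} = S \<inter> space torus"
      by (auto simp: torus_def sets_restrict_space space_restrict_space)
    have eq: "Re (indicator S \<theta> * G \<theta>) = max 0 (Re (G \<theta>))" if "\<theta> \<in> space torus" for \<theta>
    proof -
      have "\<theta> \<in> S \<longleftrightarrow> Re (G \<theta>) > 0" using S(2) that by blast
      then show ?thesis by (simp add: indicator_def)
    qed
    have "integrable torus (\<lambda>\<theta>. indicator S \<theta> * G \<theta>)"
      by (rule integrable_bounded_mult[OF Gi, where C = 1]) (use S(1) in \<open>auto simp: indicator_def intro!: borel_measurable_torus\<close>)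
    then have "(LINT \<theta>|torus. max 0 (Re (G \<theta>))) = Re (LINT \<theta>|torus. indicator S \<theta> * G \<theta>)"
      using eq by (subst Bochner_Integration.integral_Re[symmetric]) (auto intro: Bochner_Integration.integral_cong)
    then have "(LINT \<theta>|torus. max 0 (Re (G \<theta>))) = 0" using fourier_null_Borel_torus[OF S(1) G] by simp
    then have "AE \<theta> in torus. max 0 (Re (G \<theta>)) = 0"
      by (subst (asm) integral_nonneg_eq_0_iff_AE) (use Gi in auto)
    then show ?thesis by eventually_elim (simp add: max_def split: if_splits)
  qed
  show ?thesis
    \<comment> \<open>Rotation by -1, \<i> and - \<i> turns the one-sided statement into both signs
      of the real and of the imaginary part.\<close>
    using le[OF G] le[OF fourier_null_scale[OF G, of "-1"]] le[OF fourier_null_scale[OF G, of \<i>]]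
      le[OF fourier_null_scale[OF G, of "- \<i>"]]
    by eventually_elim (simp add: complex_eq_iff)
qed

section \<open>Bessel, Riesz-Fischer and Plancherel\<close>

definition trig_sum :: "(int^'d \<Rightarrow> complex) \<Rightarrow> (int^'d) set \<Rightarrow> real^'d \<Rightarrow> complex" where
  "trig_sum a S \<theta> = (\<Sum>n\<in>S. a n * fourier_basis n \<theta>)"

lemma trig_sum_L2 [simp]: "trig_sum a S \<in> L2 torus"
  unfolding trig_sum_def by (intro L2_sum L2_scale fourier_basis_L2)

lemma inn_sum_right: "f \<in> L2 M \<Longrightarrow> (\<And>i. i \<in> I \<Longrightarrow> g i \<in> L2 M) \<Longrightarrow> inn M f (\<lambda>x. \<Sum>i\<in>I. g i x) = (\<Sum>i\<in>I. inn M f (g i))"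
proof (induction I rule: infinite_finite_induct)
  case (insert x F)
  then show ?case by (simp add: inn_add_right)
qed (auto simp: inn_def)

lemma inn_trig_sum: "g \<in> L2 torus \<Longrightarrow> inn torus g (trig_sum a S) = (\<Sum>n\<in>S. a n * cnj (inv_fourier g n))"
  unfolding trig_sum_def
  by (subst inn_sum_right) (auto simp: inn_scale_right inv_fourier_eq inn_commute)

lemma inv_fourier_trig_sum:
  assumes "finite S"
  shows "inv_fourier (trig_sum a S) n = (if n \<in> S then a n else 0)"
proof -
  have "inv_fourier (trig_sum a S) n = (\<Sum>m\<in>S. a m * cnj (inv_fourier (fourier_basis n) m))"
    unfolding inv_fourier_eq[of "trig_sum a S"] by (rule inn_trig_sum) simp
  also have "\<dots> = (\<Sum>m\<in>S. if m = n then a n else 0)"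
    by (rule sum.cong) (auto simp: inv_fourier_eq inn_fourier_basis)
  finally show ?thesis using assms by simp
qed

lemma sqn_trig_sum:
  assumes "finite S"
  shows "sqn torus (trig_sum a S) = (\<Sum>n\<in>S. (cmod (a n))\<^sup>2)"
proof -
  have "complex_of_real (sqn torus (trig_sum a S)) = (\<Sum>n\<in>S. a n * cnj (inv_fourier (trig_sum a S) n))"
    unfolding inn_self[symmetric] by (rule inn_trig_sum) simp
  also have "\<dots> = (\<Sum>n\<in>S. complex_of_real ((cmod (a n))\<^sup>2))"
    by (rule sum.cong) (use assms in \<open>auto simp: inv_fourier_trig_sum complex_norm_square[symmetric]\<close>)
  finally show ?thesis by (metis of_real_eq_iff of_real_sum)
qed

text \<open>The squared norm of \<open>g\<close> minus its orthogonal projection is nonnegative. The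
  minus sign is put into the coefficients of \<open>P\<close> so that \<open>sqn_add\<close> expands
  it.\<close>

lemma Bessel:
  assumes g: "g \<in> L2 torus" and S: "finite S"
  shows "(\<Sum>n\<in>S. (cmod (inv_fourier g n))\<^sup>2) \<le> sqn torus g"
proof -
  define P where "P = trig_sum (\<lambda>n. - inv_fourier g n) S"
  have "0 \<le> sqn torus (\<lambda>x. g x + P x)" by simp
  also have "\<dots> = sqn torus g + sqn torus P + 2 * Re (inn torus g P)"
    by (rule sqn_add) (use g in \<open>auto simp: P_def\<close>)
  also have "sqn torus P = (\<Sum>n\<in>S. (cmod (inv_fourier g n))\<^sup>2)"
    using sqn_trig_sum[OF S] by (simp add: P_def)
  also have "inn torus g P = (\<Sum>n\<in>S. - complex_of_real ((cmod (inv_fourier g n))\<^sup>2))"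
    unfolding P_def inn_trig_sum[OF g] complex_norm_square by simp
  finally show ?thesis by (simp add: sum_negf)
qed

lemma inv_fourier_ell2: "g \<in> L2 torus \<Longrightarrow> inv_fourier g \<in> ell2"
  unfolding ell2_def mem_Collect_eq
  by (rule nonneg_bdd_above_summable_on)
     (auto simp: bdd_above_def intro!: exI[of _ "sqn torus g"] Bessel)

lemma inv_fourier_add: "g \<in> L2 torus \<Longrightarrow> h \<in> L2 torus \<Longrightarrow> inv_fourier (\<lambda>x. g x + h x) = (\<lambda>n. inv_fourier g n + inv_fourier h n)"
  by (rule ext) (simp add: inv_fourier_eq inn_add_right)

lemma inv_fourier_diff: "g \<in> L2 torus \<Longrightarrow> h \<in> L2 torus \<Longrightarrow> inv_fourier (\<lambda>x. g x - h x) = (\<lambda>n. inv_fourier g n - inv_fourier h n)"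
  by (rule ext) (simp add: inv_fourier_eq inn_diff_right)

lemma inv_fourier_scale: "inv_fourier (\<lambda>x. c * g x) = (\<lambda>n. c * inv_fourier g n)"
  by (rule ext) (simp add: inv_fourier_eq inn_scale_right)

lemma inv_fourier_sum: "(\<And>i. i \<in> I \<Longrightarrow> g i \<in> L2 torus) \<Longrightarrow> inv_fourier (\<lambda>x. \<Sum>i\<in>I. g i x) = (\<lambda>n. \<Sum>i\<in>I. inv_fourier (g i) n)"
  by (rule ext) (simp add: inv_fourier_eq inn_sum_right)

lemma inv_fourier_zero: "inv_fourier (\<lambda>x. 0) = (\<lambda>n. 0)"
  by (rule ext) (simp add: inv_fourier_eq inn_def)

lemma inv_fourier_cong_AE:
  "g \<in> borel_measurable torus \<Longrightarrow> h \<in> borel_measurable torus \<Longrightarrow> AE x in torus. g x = h x \<Longrightarrow> inv_fourier g = inv_fourier h"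
  unfolding inv_fourier_eq by (rule ext, rule inn_cong_AE) auto

lemma L2_torus_integrable:
  fixes g :: "real^'d \<Rightarrow> complex"
  assumes "g \<in> L2 torus"
  shows "integrable torus g"
proof -
  have "(\<lambda>\<theta>. 1) \<in> L2 (torus :: (real^'d) measure)" by (simp add: L2_def)
  from integrable_inn[OF this assms] show ?thesis by simp
qed

text \<open>On the finite measure space \<open>torus\<close> square-integrable functions are
  integrable, so the difference is \<open>fourier_null\<close> and completeness applies.\<close>

lemma inv_fourier_inj:
  fixes g h :: "real^'d \<Rightarrow> complex"
  assumes g: "g \<in> L2 torus" and h: "h \<in> L2 torus" and eq: "inv_fourier g = inv_fourier h"
  shows "AE x in torus. g x = h x"
proof -
  let ?d = "\<lambda>x. g x - h x"
  have d: "?d \<in> L2 torus" using g h by simp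
  have "inv_fourier ?d = (\<lambda>n. 0)" using inv_fourier_diff[OF g h] eq by simp
  then have "fourier_null ?d"
    using L2_torus_integrable[OF d] fourier_const_pos[where 'd = 'd]
    unfolding fourier_null_def by (auto simp: inv_fourier_def phase_def fourier_const_def fun_eq_iff)
  then have "AE x in torus. ?d x = 0" by (rule fourier_null_imp_AE_zero)
  then show ?thesis by eventually_elim simp
qed

lemma trig_sum_diff:
  assumes "finite T" "S \<subseteq> T"
  shows "trig_sum a T x - trig_sum a S x = trig_sum a (T - S) x"
  using assms by (simp add: trig_sum_def sum_diff)

lemma ell2_finite_tail:
  assumes f: "f \<in> ell2" and e: "e > 0"
  shows "\<exists>S. finite S \<and> (\<forall>F. finite F \<longrightarrow> F \<inter> S = {} \<longrightarrow> (\<Sum>n\<in>F. (cmod (f n))\<^sup>2) \<le> e)"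
proof -
  let ?T = "\<Sum>\<^sub>\<infinity>n. (cmod (f n))\<^sup>2"
  have s: "(\<lambda>n. (cmod (f n))\<^sup>2) summable_on UNIV" using f by (simp add: ell2_def)
  then have "(sum (\<lambda>n. (cmod (f n))\<^sup>2) \<longlongrightarrow> ?T) (finite_subsets_at_top UNIV)"
    using has_sum_infsum[OF s] by (simp add: has_sum_def)
  then have "\<forall>\<^sub>F S in finite_subsets_at_top UNIV. ?T - e < (\<Sum>n\<in>S. (cmod (f n))\<^sup>2)"
    using e by (intro order_tendstoD) auto
  then obtain S where S: "finite S" "?T - e < (\<Sum>n\<in>S. (cmod (f n))\<^sup>2)"
    by (auto simp: eventually_finite_subsets_at_top)
  have "(\<Sum>n\<in>F. (cmod (f n))\<^sup>2) \<le> e" if F: "finite F" "F \<inter> S = {}" for F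
  proof -
    have "(\<Sum>n\<in>F \<union> S. (cmod (f n))\<^sup>2) \<le> ?T"
      by (rule finite_sum_le_infsum[OF s]) (use F S in auto)
    then show ?thesis using F S by (simp add: sum.union_disjoint)
  qed
  with S show ?thesis by blast
qed

text \<open>Finite sets carrying all but \<open>(1/4)^k\<close> of the mass make the trigonometric
  sums converge at the rate required by \<open>L2_complete\<close>; coefficients pass to the limit
  by continuity of the inner product.\<close>

lemma Riesz_Fischer:
  assumes f: "f \<in> ell2"
  obtains g S where "g \<in> L2 torus" "inv_fourier g = f" "\<And>k. finite (S k)" "L2lim torus (\<lambda>k. trig_sum f (S k)) g"
proof -
  have "\<forall>k. \<exists>S. finite S \<and> (\<forall>F. finite F \<longrightarrow> F \<inter> S = {} \<longrightarrow> (\<Sum>n\<in>F. (cmod (f n))\<^sup>2) \<le> (1/4)^k)"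
    using ell2_finite_tail[OF f] by simp
  then obtain S0 where S0: "\<And>k. finite (S0 k)"
    "\<And>k F. finite F \<Longrightarrow> F \<inter> S0 k = {} \<Longrightarrow> (\<Sum>n\<in>F. (cmod (f n))\<^sup>2) \<le> (1/4)^k"
    by metis
  \<comment> \<open>Taking unions makes the sets increase, so that consecutive sums differ by a sum
    over a set disjoint from \<open>S0 k\<close>.\<close>
  define S where "S k = (\<Union>i\<le>k. S0 i)" for k
  have S: "finite (S k)" "S k \<subseteq> S (Suc k)" "S0 k \<subseteq> S k" for k
    using S0(1) by (auto simp: S_def intro: le_SucI)
  have tail: "(\<Sum>n\<in>F. (cmod (f n))\<^sup>2) \<le> (1/4)^k" if "finite F" "F \<inter> S k = {}" for F k
    using S0(2)[OF that(1), of k] that S(3)[of k] by blast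
  have "\<exists>g\<in>L2 torus. L2lim torus (\<lambda>k. trig_sum f (S k)) g"
  proof (rule L2_complete)
    fix k
    have "sqn torus (\<lambda>x. trig_sum f (S (Suc k)) x - trig_sum f (S k) x) = (\<Sum>n\<in>S (Suc k) - S k. (cmod (f n))\<^sup>2)"
      unfolding trig_sum_diff[OF S(1) S(2)] using sqn_trig_sum[of "S (Suc k) - S k" f] S(1) by simp
    also have "\<dots> \<le> (1/4)^k" using tail[of "S (Suc k) - S k" k] S(1) by auto
    finally show "sqn torus (\<lambda>x. trig_sum f (S (Suc k)) x - trig_sum f (S k) x) \<le> (1/4)^k" .
  qed simp
  then obtain g where g: "g \<in> L2 torus" "L2lim torus (\<lambda>k. trig_sum f (S k)) g" by blast
  have "inv_fourier g n = f n" for n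
  proof -
    have "(\<lambda>k. inv_fourier (trig_sum f (S k)) n) \<longlonglongrightarrow> inv_fourier g n"
      unfolding inv_fourier_eq by (rule L2lim_inn) (use g in auto)
    moreover have "(\<lambda>k. inv_fourier (trig_sum f (S k)) n) \<longlonglongrightarrow> f n"
    proof (cases "\<exists>K. n \<in> S K")
      case True
      then obtain K where K: "n \<in> S K" by blast
      have "n \<in> S k" if "k \<ge> K" for k using K that by (auto simp: S_def intro: order_trans)
      then show ?thesis
        by (intro tendsto_eventually) (auto simp: eventually_sequentially inv_fourier_trig_sum S(1) intro!: exI[of _ K])
    next
      case False
      \<comment> \<open>An index that no \<open>S k\<close> ever reaches belongs to every tail, so
        \<open>f n\<close> must vanish and agrees with the constant coefficient 0.\<close>
      have le: "(cmod (f n))\<^sup>2 \<le> (1/4)^k" for k using tail[of "{n}" k] False by simp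
      have "(\<lambda>k. (1/4::real)^k) \<longlonglongrightarrow> 0" by (rule LIMSEQ_power_zero) simp
      then have "(cmod (f n))\<^sup>2 \<le> 0" by (rule LIMSEQ_le_const) (use le in auto)
      then show ?thesis using False by (simp add: inv_fourier_trig_sum S(1))
    qed
    ultimately show ?thesis by (rule LIMSEQ_unique)
  qed
  then show ?thesis using that g S(1) by blast
qed

text \<open>Riesz-Fischer gives a limit with the coefficients of \<open>g\<close>; by completeness
  this limit is \<open>g\<close> almost everywhere.\<close>

lemma trig_sum_approx:
  assumes g: "g \<in> L2 torus"
  obtains S where "\<And>k. finite (S k)" "L2lim torus (\<lambda>k. trig_sum (inv_fourier g) (S k)) g"
proof -
  obtain g' S where g': "g' \<in> L2 torus" "inv_fourier g' = inv_fourier g" and S: "\<And>k. finite (S k)"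
    and lim: "L2lim torus (\<lambda>k. trig_sum (inv_fourier g) (S k)) g'"
    by (rule Riesz_Fischer[OF inv_fourier_ell2[OF g]]) blast
  have ae: "AE x in torus. g' x = g x" by (rule inv_fourier_inj) (use g g' in auto)
  have "sqn torus (\<lambda>x. trig_sum (inv_fourier g) (S k) x - g x) = sqn torus (\<lambda>x. trig_sum (inv_fourier g) (S k) x - g' x)" for k
  proof (rule sqn_cong_AE)
    show "AE x in torus. trig_sum (inv_fourier g) (S k) x - g x = trig_sum (inv_fourier g) (S k) x - g' x"
      using ae by eventually_elim simp
  qed (use g g' in \<open>auto intro!: L2_measurable\<close>)
  with lim have "L2lim torus (\<lambda>k. trig_sum (inv_fourier g) (S k)) g" by (simp add: L2lim_def)
  from that[OF S this] show ?thesis .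
qed

text \<open>One inequality is Bessel; the other follows because the norms of the approximating
  trigonometric sums are partial sums of the series and converge to the norm of
  \<open>g\<close>.\<close>

lemma Plancherel:
  assumes g: "g \<in> L2 torus"
  shows "(\<Sum>\<^sub>\<infinity>n. (cmod (inv_fourier g n))\<^sup>2) = sqn torus g"
proof (rule antisym)
  let ?f = "inv_fourier g"
  have s: "(\<lambda>n. (cmod (?f n))\<^sup>2) summable_on UNIV" using inv_fourier_ell2[OF g] by (simp add: ell2_def)
  show "(\<Sum>\<^sub>\<infinity>n. (cmod (?f n))\<^sup>2) \<le> sqn torus g"
    by (rule infsum_le_finite_sums[OF s]) (use Bessel[OF g] in auto)
  obtain S where S: "\<And>k. finite (S k)" and lim: "L2lim torus (\<lambda>k. trig_sum ?f (S k)) g"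
    using trig_sum_approx[OF g] by blast
  have "(\<lambda>k. inn torus (trig_sum ?f (S k)) (trig_sum ?f (S k))) \<longlonglongrightarrow> inn torus g g"
    by (rule L2lim_inn) (use g lim in auto)
  then have "(\<lambda>k. sqn torus (trig_sum ?f (S k))) \<longlonglongrightarrow> sqn torus g"
    unfolding inn_self by (rule tendsto_of_real_iff[THEN iffD1])
  then show "sqn torus g \<le> (\<Sum>\<^sub>\<infinity>n. (cmod (?f n))\<^sup>2)"
  proof (rule LIMSEQ_le_const2)
    show "\<exists>N. \<forall>k\<ge>N. sqn torus (trig_sum ?f (S k)) \<le> (\<Sum>\<^sub>\<infinity>n. (cmod (?f n))\<^sup>2)"
      using S by (auto simp: sqn_trig_sum intro!: finite_sum_le_infsum[OF s])
  qed
qed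

lemma l2norm_inv_fourier: "g \<in> L2 torus \<Longrightarrow> l2norm (inv_fourier g) = sqrt (sqn torus g)"
  by (simp add: l2norm_def Plancherel)

text \<open>Polarization: Plancherel for \<open>g + h\<close> gives the real parts, and replacing
  \<open>h\<close> by \<open>\<i> * h\<close> gives the imaginary parts.\<close>

lemma ip_inv_fourier:
  assumes g: "g \<in> L2 torus" and h: "h \<in> L2 torus"
  shows "ip (inv_fourier g) (inv_fourier h) = inn torus g h"
proof -
  have re: "Re (ip (inv_fourier g) (inv_fourier h)) = Re (inn torus g h)" if g: "g \<in> L2 torus" and h: "h \<in> L2 torus" for g h :: "real^'a \<Rightarrow> complex"
  proof -
    let ?f = "inv_fourier g" and ?k = "inv_fourier h"
    have sf: "(\<lambda>n. (cmod (?f n))\<^sup>2) summable_on UNIV" and sk: "(\<lambda>n. (cmod (?k n))\<^sup>2) summable_on UNIV"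
      using inv_fourier_ell2[OF g] inv_fourier_ell2[OF h] by (auto simp: ell2_def)
    have ab: "(\<lambda>n. cmod (cnj (?f n) * ?k n)) summable_on UNIV"
    proof (rule Infinite_Sum.abs_summable_on_comparison_test'[where g = "\<lambda>n. (cmod (?f n))\<^sup>2 + (cmod (?k n))\<^sup>2"])
      show "(\<lambda>n. (cmod (?f n))\<^sup>2 + (cmod (?k n))\<^sup>2) summable_on UNIV" using sf sk by (rule summable_on_add)
      fix n
      have "2 * cmod (?f n) * cmod (?k n) \<le> (cmod (?f n))\<^sup>2 + (cmod (?k n))\<^sup>2" by (rule sum_squares_bound)
      moreover have "0 \<le> cmod (?f n) * cmod (?k n)" by simp
      ultimately show "cmod (cnj (?f n) * ?k n) \<le> (cmod (?f n))\<^sup>2 + (cmod (?k n))\<^sup>2"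
        unfolding norm_mult complex_mod_cnj by linarith
    qed
    have sr: "(\<lambda>n. cnj (?f n) * ?k n) summable_on UNIV" using ab by (rule abs_summable_summable)
    have sR: "(\<lambda>n. Re (cnj (?f n) * ?k n)) summable_on UNIV" using sr by (rule summable_on_Re)
    have "sqn torus (\<lambda>x. g x + h x) = (\<Sum>\<^sub>\<infinity>n. (cmod (?f n + ?k n))\<^sup>2)"
      using Plancherel[OF L2_add[OF g h]] unfolding inv_fourier_add[OF g h] by simp
    also have "\<dots> = (\<Sum>\<^sub>\<infinity>n. ((cmod (?f n))\<^sup>2 + (cmod (?k n))\<^sup>2) + 2 * Re (cnj (?f n) * ?k n))"
      by (rule infsum_cong) (simp only: cmod_power2, simp add: power2_eq_square algebra_simps)
    also have "\<dots> = (\<Sum>\<^sub>\<infinity>n. (cmod (?f n))\<^sup>2) + (\<Sum>\<^sub>\<infinity>n. (cmod (?k n))\<^sup>2) + 2 * (\<Sum>\<^sub>\<infinity>n. Re (cnj (?f n) * ?k n))"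
      by (simp only: infsum_add[OF summable_on_add[OF sf sk] summable_on_cmult_right[OF sR]] infsum_add[OF sf sk] infsum_cmult_right')
    also have "(\<Sum>\<^sub>\<infinity>n. Re (cnj (?f n) * ?k n)) = Re (ip ?f ?k)"
      unfolding ip_def by (rule infsum_Re[OF sr])
    finally show ?thesis using sqn_add[OF g h] by (simp add: Plancherel g h)
  qed
  have "Re (\<i> * ip (inv_fourier g) (inv_fourier h)) = Re (\<i> * inn torus g h)"
  proof -
    have "ip (inv_fourier g) (inv_fourier (\<lambda>x. \<i> * h x)) = \<i> * ip (inv_fourier g) (inv_fourier h)"
      unfolding inv_fourier_scale ip_def infsum_cmult_right'[symmetric] by (rule infsum_cong) simp
    then show ?thesis using re[OF g L2_scale[OF h, of \<i>]] by (simp add: inn_scale_right)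
  qed
  with re[OF g h] show ?thesis by (simp add: complex_eq_iff)
qed

text \<open>A chosen representative, determined only almost everywhere; existence is
  Riesz-Fischer.\<close>

definition fourier :: "(int^'d \<Rightarrow> complex) \<Rightarrow> real^'d \<Rightarrow> complex" where
  "fourier f = (SOME g. g \<in> L2 torus \<and> inv_fourier g = f)"

lemma fourier_L2: "f \<in> ell2 \<Longrightarrow> fourier f \<in> L2 torus"
  and inv_fourier_fourier: "f \<in> ell2 \<Longrightarrow> inv_fourier (fourier f) = f"
proof -
  have "fourier f \<in> L2 torus \<and> inv_fourier (fourier f) = f" if "f \<in> ell2"
  proof -
    have "\<exists>g. g \<in> L2 torus \<and> inv_fourier g = f" by (rule Riesz_Fischer[OF that]) blast
    from someI_ex[OF this] show ?thesis unfolding fourier_def .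
  qed
  then show "f \<in> ell2 \<Longrightarrow> fourier f \<in> L2 torus" "f \<in> ell2 \<Longrightarrow> inv_fourier (fourier f) = f" by auto
qed

lemma fourier_inv_fourier: "g \<in> L2 torus \<Longrightarrow> AE x in torus. fourier (inv_fourier g) x = g x"
  by (rule inv_fourier_inj) (auto simp: fourier_L2 inv_fourier_ell2 inv_fourier_fourier)

lemma l2_lim_inv_fourier:
  assumes "\<And>k. G k \<in> L2 torus" "g \<in> L2 torus"
  shows "l2_lim (\<lambda>k. inv_fourier (G k)) (inv_fourier g) \<longleftrightarrow> L2lim torus G g"
proof -
  have "l2norm (\<lambda>n. inv_fourier (G k) n - inv_fourier g n) = sqrt (sqn torus (\<lambda>x. G k x - g x))" for k
    using l2norm_inv_fourier[of "\<lambda>x. G k x - g x"] assms by (simp add: inv_fourier_diff)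
  then have "l2_lim (\<lambda>k. inv_fourier (G k)) (inv_fourier g) \<longleftrightarrow> (\<lambda>k. sqrt (sqn torus (\<lambda>x. G k x - g x))) \<longlonglongrightarrow> sqrt 0"
    by (simp add: l2_lim_def)
  also have "\<dots> \<longleftrightarrow> L2lim torus G g"
    unfolding L2lim_def
  proof
    assume "(\<lambda>k. sqrt (sqn torus (\<lambda>x. G k x - g x))) \<longlonglongrightarrow> sqrt 0"
    from tendsto_power[OF this, of 2] show "(\<lambda>k. sqn torus (\<lambda>x. G k x - g x)) \<longlonglongrightarrow> 0" by simp
  qed (rule tendsto_real_sqrt)
  finally show ?thesis .
qed

section \<open>Hilbert space identities for \<open>ell2\<close>, transported from the torus\<close>

lemma ell2_cases:
  fixes f :: "int^'d \<Rightarrow> complex"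
  assumes "f \<in> ell2"
  obtains g where "g \<in> L2 torus" "f = inv_fourier g"
  using assms fourier_L2 inv_fourier_fourier by metis

lemma ell2_add [simp, intro]:
  fixes f g :: "int^'d \<Rightarrow> complex"
  assumes "f \<in> ell2" "g \<in> ell2"
  shows "(\<lambda>n. f n + g n) \<in> ell2"
  using assms by (elim ell2_cases) (auto simp flip: inv_fourier_add intro: inv_fourier_ell2)

lemma ell2_diff [simp, intro]:
  fixes f g :: "int^'d \<Rightarrow> complex"
  assumes "f \<in> ell2" "g \<in> ell2"
  shows "(\<lambda>n. f n - g n) \<in> ell2"
  using assms by (elim ell2_cases) (auto simp flip: inv_fourier_diff intro: inv_fourier_ell2)

lemma ell2_scale [simp, intro]:
  fixes f :: "int^'d \<Rightarrow> complex"
  assumes "f \<in> ell2"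
  shows "(\<lambda>n. c * f n) \<in> ell2"
  using assms by (elim ell2_cases) (auto simp flip: inv_fourier_scale intro: inv_fourier_ell2)

lemma ell2_zero [simp]: "(\<lambda>n :: int^'d. 0) \<in> ell2"
  by (simp add: ell2_def)

lemma ip_add_right:
  fixes f g h :: "int^'d \<Rightarrow> complex"
  assumes "f \<in> ell2" "g \<in> ell2" "h \<in> ell2"
  shows "ip f (\<lambda>n. g n + h n) = ip f g + ip f h"
  using assms by (elim ell2_cases) (simp add: inv_fourier_add[symmetric] ip_inv_fourier inn_add_right)

lemma ip_diff_right:
  fixes f g h :: "int^'d \<Rightarrow> complex"
  assumes "f \<in> ell2" "g \<in> ell2" "h \<in> ell2"
  shows "ip f (\<lambda>n. g n - h n) = ip f g - ip f h"
  using assms by (elim ell2_cases) (simp add: inv_fourier_diff[symmetric] ip_inv_fourier inn_diff_right)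

lemma ip_scale_right: "ip f (\<lambda>n. c * g n) = c * ip f g"
  unfolding ip_def infsum_cmult_right'[symmetric] by (rule infsum_cong) simp

lemma ip_commute:
  fixes f g :: "int^'d \<Rightarrow> complex"
  shows "f \<in> ell2 \<Longrightarrow> g \<in> ell2 \<Longrightarrow> cnj (ip f g) = ip g f"
  by (elim ell2_cases) (simp add: ip_inv_fourier inn_commute)

lemma ip_add_left:
  fixes f g h :: "int^'d \<Rightarrow> complex"
  assumes "f \<in> ell2" "g \<in> ell2" "h \<in> ell2"
  shows "ip (\<lambda>n. g n + h n) f = ip g f + ip h f"
  using assms by (elim ell2_cases) (simp add: inv_fourier_add[symmetric] ip_inv_fourier inn_add_left)

lemma ip_scale_left: "ip (\<lambda>n. c * g n) f = cnj c * ip g f"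
  unfolding ip_def infsum_cmult_right'[symmetric] by (rule infsum_cong) simp

lemma ip_self:
  fixes f :: "int^'d \<Rightarrow> complex"
  shows "f \<in> ell2 \<Longrightarrow> ip f f = complex_of_real ((l2norm f)\<^sup>2)"
  by (elim ell2_cases) (simp add: ip_inv_fourier inn_self l2norm_inv_fourier)

lemma l2norm_eq_0:
  fixes f :: "int^'d \<Rightarrow> complex"
  assumes "f \<in> ell2" "l2norm f = 0"
  shows "f = (\<lambda>n. 0)"
proof -
  obtain g where g: "g \<in> L2 torus" "f = inv_fourier g" using assms(1) by (rule ell2_cases)
  then have "AE x in torus. g x = 0" using assms(2) by (simp add: l2norm_inv_fourier sqn_eq_0_iff)
  then show ?thesis
    using g inv_fourier_cong_AE[of g "\<lambda>x. 0"] L2_measurable[OF g(1)] by (simp add: inv_fourier_zero)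
qed

lemma ell2_eqI:
  fixes f g :: "int^'d \<Rightarrow> complex"
  assumes "f \<in> ell2" "g \<in> ell2" "\<And>h. h \<in> ell2 \<Longrightarrow> ip h f = ip h g"
  shows "f = g"
proof -
  let ?d = "\<lambda>n. f n - g n"
  have d: "?d \<in> ell2" using assms by simp
  have "ip ?d ?d = 0" using assms d by (simp add: ip_diff_right)
  then have "l2norm ?d = 0" using ip_self[OF d] by simp
  from l2norm_eq_0[OF d this] show ?thesis by (simp add: fun_eq_iff)
qed

lemma l2norm_add_sq:
  fixes f g :: "int^'d \<Rightarrow> complex"
  assumes "f \<in> ell2" "g \<in> ell2"
  shows "(l2norm (\<lambda>n. f n + g n))\<^sup>2 = (l2norm f)\<^sup>2 + (l2norm g)\<^sup>2 + 2 * Re (ip f g)"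
proof -
  obtain a b where ab: "a \<in> L2 torus" "f = inv_fourier a" "b \<in> L2 torus" "g = inv_fourier b"
    using assms by (metis ell2_cases)
  have sq: "(l2norm (inv_fourier h))\<^sup>2 = sqn torus h" if "h \<in> L2 torus" for h :: "real^'d \<Rightarrow> complex"
    using that by (simp add: l2norm_inv_fourier)
  show ?thesis
    using ab sq[of a] sq[of b] sq[of "\<lambda>x. a x + b x"] sqn_add[of a torus b] inv_fourier_add[of a b] ip_inv_fourier[of a b]
    by simp
qed

lemma l2norm_nonneg [simp]: "0 \<le> l2norm f"
  by (simp add: l2norm_def infsum_nonneg)

lemma l2norm_scale: "l2norm (\<lambda>n. c * f n) = cmod c * l2norm f"
  unfolding l2norm_def by (simp add: norm_mult power_mult_distrib infsum_cmult_right' real_sqrt_mult)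

section \<open>Projection-valued measures\<close>

locale pvm =
  fixes E :: "real set \<Rightarrow> (int^'d \<Rightarrow> complex) \<Rightarrow> (int^'d \<Rightarrow> complex)"
  assumes pvm: "projection_valued_measure E"
begin

lemma proj_ell2 [simp]: "S \<in> sets borel \<Longrightarrow> f \<in> ell2 \<Longrightarrow> E S f \<in> ell2"
  and proj_idem: "S \<in> sets borel \<Longrightarrow> f \<in> ell2 \<Longrightarrow> E S (E S f) = E S f"
  and proj_sym: "S \<in> sets borel \<Longrightarrow> f \<in> ell2 \<Longrightarrow> g \<in> ell2 \<Longrightarrow> ip f (E S g) = ip (E S f) g"
  and proj_UNIV: "f \<in> ell2 \<Longrightarrow> E UNIV f = f"
  and proj_Int: "S \<in> sets borel \<Longrightarrow> T \<in> sets borel \<Longrightarrow> f \<in> ell2 \<Longrightarrow> E S (E T f) = E (S \<inter> T) f"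
  and proj_sums: "range A \<subseteq> sets borel \<Longrightarrow> disjoint_family A \<Longrightarrow> f \<in> ell2 \<Longrightarrow>
      (\<lambda>k. ip f (E (A k) f)) sums ip f (E (\<Union>k. A k) f)"
  using pvm unfolding projection_valued_measure_def orth_projection_def by (auto simp: subset_eq)

text \<open>Symmetry moves the projection onto the test vector, where additivity is that of the
  inner product; \<open>ell2_eqI\<close> then identifies the vectors.\<close>

lemma proj_add:
  assumes "S \<in> sets borel" "f \<in> ell2" "g \<in> ell2"
  shows "E S (\<lambda>n. f n + g n) = (\<lambda>n. E S f n + E S g n)"
  by (rule ell2_eqI) (use assms in \<open>simp_all add: proj_sym ip_add_right\<close>)

lemma proj_scale:
  assumes "S \<in> sets borel" "f \<in> ell2"
  shows "E S (\<lambda>n. c * f n) = (\<lambda>n. c * E S f n)"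
  by (rule ell2_eqI) (use assms in \<open>simp_all add: proj_sym ip_scale_right\<close>)

lemma ip_proj: "S \<in> sets borel \<Longrightarrow> f \<in> ell2 \<Longrightarrow> ip f (E S f) = complex_of_real ((l2norm (E S f))\<^sup>2)"
  by (metis ip_self proj_ell2 proj_idem proj_sym)

lemma sums_l2norm_proj:
  "range A \<subseteq> sets borel \<Longrightarrow> disjoint_family A \<Longrightarrow> f \<in> ell2 \<Longrightarrow>
    (\<lambda>k. (l2norm (E (A k) f))\<^sup>2) sums (l2norm (E (\<Union>k. A k) f))\<^sup>2"
  using sums_Re[OF proj_sums, of A f] by (simp add: ip_proj subset_eq)

text \<open>The constant family of empty sets is disjoint, so countable additivity makes a constant
  series converge; its terms must be 0.\<close>

lemma proj_empty: "f \<in> ell2 \<Longrightarrow> E {} f = (\<lambda>n. 0)"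
proof -
  assume f: "f \<in> ell2"
  have "(\<lambda>k::nat. (l2norm (E {} f))\<^sup>2) sums (l2norm (E {} f))\<^sup>2"
    using sums_l2norm_proj[of "\<lambda>_. {}" f] f by (simp add: disjoint_family_on_def)
  then have "(\<lambda>k::nat. (l2norm (E {} f))\<^sup>2) \<longlonglongrightarrow> 0" by (intro summable_LIMSEQ_zero sums_summable)
  then have "(l2norm (E {} f))\<^sup>2 = 0" by (simp add: LIMSEQ_const_iff)
  then show ?thesis using l2norm_eq_0[of "E {} f"] f by simp
qed

lemma scalar_measure_props:
  assumes f: "f \<in> ell2"
  shows sets_scalar_measure: "sets (scalar_measure E f) = sets borel"
    and space_scalar_measure: "space (scalar_measure E f) = UNIV"
    and emeasure_scalar_measure: "S \<in> sets borel \<Longrightarrow> emeasure (scalar_measure E f) S = ennreal ((l2norm (E S f))\<^sup>2)"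
proof -
  show sets: "sets (scalar_measure E f) = sets borel"
    unfolding scalar_measure_def using sets.sigma_sets_eq[of "borel :: real measure"] by (simp add: sets_measure_of)
  show "space (scalar_measure E f) = UNIV"
    unfolding scalar_measure_def by (simp add: space_measure_of)
  assume S: "S \<in> sets borel"
  have "emeasure (scalar_measure E f) S = ennreal (Re (ip f (E S f)))"
  proof (rule emeasure_measure_of[OF scalar_measure_def])
    show "countably_additive (sets (scalar_measure E f)) (\<lambda>S. ennreal (Re (ip f (E S f))))"
      unfolding countably_additive_def sets
    proof (intro allI impI)
      fix A :: "nat \<Rightarrow> real set" assume A: "range A \<subseteq> sets borel" "disjoint_family A" "(\<Union>i. A i) \<in> sets borel"
      have *: "Re (ip f (E (A i) f)) = (l2norm (E (A i) f))\<^sup>2" "Re (ip f (E (\<Union>i. A i) f)) = (l2norm (E (\<Union>i. A i) f))\<^sup>2" for i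
        using A f by (simp_all add: ip_proj subset_eq)
      show "(\<Sum>i. ennreal (Re (ip f (E (A i) f)))) = ennreal (Re (ip f (E (\<Union>i. A i) f)))"
        unfolding * by (rule suminf_ennreal_eq) (use sums_l2norm_proj[OF A(1,2) f] in auto)
    qed
    show "positive (sets (scalar_measure E f)) (\<lambda>S. ennreal (Re (ip f (E S f))))"
      by (simp add: positive_def proj_empty f ip_def)
  qed (use S sets in \<open>auto simp: sets.space_closed\<close>)
  then show "emeasure (scalar_measure E f) S = ennreal ((l2norm (E S f))\<^sup>2)"
    using ip_proj[OF S f] by simp
qed

lemma finite_scalar_measure: "f \<in> ell2 \<Longrightarrow> finite_measure (scalar_measure E f)"
  by (rule finite_measureI) (simp add: space_scalar_measure emeasure_scalar_measure)

lemma measure_scalar_measure: "f \<in> ell2 \<Longrightarrow> S \<in> sets borel \<Longrightarrow> measure (scalar_measure E f) S = (l2norm (E S f))\<^sup>2"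
  by (simp add: measure_def emeasure_scalar_measure)

lemma borel_measurable_scalar_measure: "f \<in> ell2 \<Longrightarrow> borel_measurable (scalar_measure E f) = borel_measurable borel"
  by (rule measurable_cong_sets) (simp_all add: sets_scalar_measure)

text \<open>Projecting the vector restricts its spectral measure, because
  \<open>E A (E J f) = E (J \<inter> A) f\<close>. Domain and form questions about
  \<open>E J f\<close> thereby become integrals over \<open>J\<close>.\<close>

lemma scalar_measure_proj:
  assumes f: "f \<in> ell2" and J: "J \<in> sets borel"
  shows "scalar_measure E (E J f) = density (scalar_measure E f) (\<lambda>x. ennreal (indicator J x))"
proof (rule measure_eqI)
  fix A assume "A \<in> sets (scalar_measure E (E J f))"
  then have A: "A \<in> sets borel" using f J by (simp add: sets_scalar_measure)
  have "emeasure (density (scalar_measure E f) (\<lambda>x. ennreal (indicator J x))) A =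
      (\<integral>\<^sup>+x. ennreal (indicator J x) * indicator A x \<partial>scalar_measure E f)"
    by (rule emeasure_density) (use f J A in \<open>auto simp: sets_scalar_measure borel_measurable_scalar_measure\<close>)
  also have "\<dots> = (\<integral>\<^sup>+x. indicator (J \<inter> A) x \<partial>scalar_measure E f)"
    by (intro nn_integral_cong) (auto simp: indicator_def)
  also have "\<dots> = emeasure (scalar_measure E f) (J \<inter> A)"
    using f J A by (simp add: sets_scalar_measure)
  finally show "emeasure (scalar_measure E (E J f)) A = emeasure (density (scalar_measure E f) (\<lambda>x. ennreal (indicator J x))) A"
    using f J A by (simp add: emeasure_scalar_measure proj_Int Int_commute)
qed (use f J in \<open>simp add: sets_scalar_measure\<close>)

text \<open>Countable additivity is given only for inner products. Additivity of the vectors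
  themselves follows by expanding the squared norm of the difference, which vanishes because the two
  pieces are orthogonal.\<close>

lemma proj_Un:
  assumes f: "f \<in> ell2" and A: "A \<in> sets borel" and B: "B \<in> sets borel" and disj: "A \<inter> B = {}"
  shows "E (A \<union> B) f = (\<lambda>n. E A f n + E B f n)"
proof -
  interpret finite_measure "scalar_measure E f" by (rule finite_scalar_measure[OF f])
  have pyth: "(l2norm (E (A \<union> B) f))\<^sup>2 = (l2norm (E A f))\<^sup>2 + (l2norm (E B f))\<^sup>2"
    using finite_measure_Union[of A B] A B disj f by (simp add: sets_scalar_measure measure_scalar_measure)
  let ?g = "E (A \<union> B) f" and ?s = "\<lambda>n. E A f n + E B f n"
  have e: "?g \<in> ell2" "?s \<in> ell2" using f A B by simp_all
  have orth: "ip (E A f) (E B f) = 0"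
  proof -
    have "ip (E A f) (E B f) = ip f (E A (E B f))" using f A B by (simp add: proj_sym)
    also have "E A (E B f) = (\<lambda>n. 0)" using f A B disj by (simp add: proj_Int proj_empty)
    finally show ?thesis by (simp add: ip_def)
  qed
  have ga: "ip ?g (E A f) = (l2norm (E A f))\<^sup>2"
  proof -
    have "ip ?g (E A f) = ip f (E (A \<union> B) (E A f))" using f A B by (simp add: proj_sym)
    also have "E (A \<union> B) (E A f) = E A f" using f A B by (simp add: proj_Int Int_absorb1)
    finally show ?thesis using f A by (simp add: ip_proj)
  qed
  have gb: "ip ?g (E B f) = (l2norm (E B f))\<^sup>2"
  proof -
    have "ip ?g (E B f) = ip f (E (A \<union> B) (E B f))" using f A B by (simp add: proj_sym)
    also have "E (A \<union> B) (E B f) = E B f" using f A B by (simp add: proj_Int Int_absorb1)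
    finally show ?thesis using f B by (simp add: ip_proj)
  qed
  let ?d = "\<lambda>n. ?g n + (-1) * ?s n"
  have "(l2norm ?d)\<^sup>2 = (l2norm ?g)\<^sup>2 + (l2norm ?s)\<^sup>2 - 2 * Re (ip ?g ?s)"
    using l2norm_add_sq[of ?g "\<lambda>n. (-1) * ?s n"] e ell2_scale[OF e(2), of "-1"]
    by (simp only: l2norm_scale ip_scale_right) simp
  also have "\<dots> = 0"
    using f A B by (simp add: l2norm_add_sq pyth orth ip_add_right ga gb)
  finally have "l2norm ?d = 0" by simp
  moreover have "?d \<in> ell2" using f A B by (intro ell2_add ell2_scale) auto
  ultimately have "?d = (\<lambda>n. 0)" by (rule l2norm_eq_0[rotated])
  then have "?d n = 0" for n by (rule fun_cong)
  then have "?g n - ?s n = 0" for n by (simp only: mult_minus1 diff_conv_add_uminus)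
  then show ?thesis by (simp add: fun_eq_iff)
qed

lemma proj_UN:
  fixes J :: "nat \<Rightarrow> real set"
  assumes f: "f \<in> ell2" and J: "\<And>i. J i \<in> sets borel" and disj: "disjoint_family J"
  shows "E (\<Union>i<N. J i) f = (\<lambda>n. \<Sum>i<N. E (J i) f n)"
proof (induction N)
  case 0
  then show ?case using proj_empty[OF f] by simp
next
  case (Suc N)
  have "(\<Union>i<Suc N. J i) = (\<Union>i<N. J i) \<union> J N" by (auto simp: less_Suc_eq)
  moreover have "J i \<inter> J N = {}" if "i < N" for i
    using disjoint_family_onD[OF disj, of i N] that by simp
  then have "(\<Union>i<N. J i) \<inter> J N = {}" by blast
  moreover have "(\<Union>i<N. J i) \<in> sets borel" using J by auto
  ultimately show ?case using proj_Un[OF f _ J, of "\<Union>i<N. J i" N] Suc by simp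
qed

lemma proj_Compl:
  assumes "f \<in> ell2" "J \<in> sets borel"
  shows "(\<lambda>n. E J f n + E (- J) f n) = f"
  using proj_Un[of f J "- J"] assms proj_UNIV by (simp add: Compl_partition)

lemma l2norm_proj_Compl:
  assumes "f \<in> ell2" "J \<in> sets borel"
  shows "(l2norm (E J f))\<^sup>2 + (l2norm (E (- J) f))\<^sup>2 = (l2norm f)\<^sup>2"
proof -
  interpret finite_measure "scalar_measure E f" by (rule finite_scalar_measure) fact
  show ?thesis
    using finite_measure_Union[of J "-J"] assms
    by (simp add: sets_scalar_measure measure_scalar_measure Compl_partition proj_UNIV)
qed

lemma l2norm_proj_le: "f \<in> ell2 \<Longrightarrow> J \<in> sets borel \<Longrightarrow> (l2norm (E J f))\<^sup>2 \<le> (l2norm f)\<^sup>2"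
  using l2norm_proj_Compl[of f J] zero_le_power2[of "l2norm (E (- J) f)"] by linarith

end

text \<open>The summands need not be orthogonal; the factor \<open>N\<close> is the price of
  Cauchy-Schwarz, affordable later because each summand will be of order \<open>1 / N^2\<close>
  relative to its piece.\<close>

lemma l2norm_sum_le:
  fixes f :: "nat \<Rightarrow> int^'d \<Rightarrow> complex"
  assumes "\<And>i. f i \<in> ell2"
  shows "(l2norm (\<lambda>n. \<Sum>i<N. f i n))\<^sup>2 \<le> real N * (\<Sum>i<N. (l2norm (f i))\<^sup>2)"
proof -
  have f: "f i = inv_fourier (fourier (f i))" for i using assms by (simp add: inv_fourier_fourier)
  have g: "fourier (f i) \<in> L2 torus" for i using assms by (rule fourier_L2)
  have "(\<lambda>n. \<Sum>i<N. f i n) = inv_fourier (\<lambda>x. \<Sum>i<N. fourier (f i) x)"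
    using inv_fourier_sum[of "{..<N}" "\<lambda>i. fourier (f i)"] g f by simp
  then have "(l2norm (\<lambda>n. \<Sum>i<N. f i n))\<^sup>2 = sqn torus (\<lambda>x. \<Sum>i<N. fourier (f i) x)"
    using l2norm_inv_fourier[of "\<lambda>x. \<Sum>i<N. fourier (f i) x"] g by (simp add: L2_sum)
  also have "\<dots> \<le> real N * (\<Sum>i<N. sqn torus (fourier (f i)))"
    using sqn_sum_le[of "{..<N}" "\<lambda>i. fourier (f i)" torus] g by simp
  also have "(\<Sum>i<N. sqn torus (fourier (f i))) = (\<Sum>i<N. (l2norm (f i))\<^sup>2)"
    by (rule sum.cong) (simp_all add: f[symmetric] l2norm_inv_fourier[OF g, unfolded f[symmetric]])
  finally show ?thesis .
qed

section \<open>Fourier multipliers\<close>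

definition mult_op :: "(real^'d \<Rightarrow> complex) \<Rightarrow> (int^'d \<Rightarrow> complex) \<Rightarrow> (int^'d \<Rightarrow> complex)" where
  "mult_op m f = inv_fourier (\<lambda>\<theta>. m \<theta> * fourier f \<theta>)"

lemma mult_op_inv_fourier:
  assumes "g \<in> L2 torus" "m \<in> borel_measurable torus"
  shows "mult_op m (inv_fourier g) = inv_fourier (\<lambda>\<theta>. m \<theta> * g \<theta>)"
  unfolding mult_op_def
proof (rule inv_fourier_cong_AE)
  show "AE x in torus. m x * fourier (inv_fourier g) x = m x * g x"
    using fourier_inv_fourier[OF assms(1)] by eventually_elim simp
qed (use assms L2_measurable[OF assms(1)] L2_measurable[OF fourier_L2[OF inv_fourier_ell2[OF assms(1)]]] in measurable)

text \<open>The graph hides an unspecified representative; by injectivity of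
  \<open>inv_fourier\<close> up to null sets it may be replaced by any given one.\<close>

lemma fourier_mult_iff:
  assumes g: "g \<in> L2 torus" and \<phi> [measurable]: "\<phi> \<in> borel_measurable torus"
  shows "(inv_fourier g, u) \<in> fourier_mult \<phi> \<longleftrightarrow>
    (\<phi> \<odot> g) \<in> L2 torus \<and> u = inv_fourier (\<phi> \<odot> g)"
proof
  assume "(inv_fourier g, u) \<in> fourier_mult \<phi>"
  then obtain h where h: "inv_fourier g = inv_fourier h" "u = inv_fourier (\<phi> \<odot> h)"
    "h \<in> L2 torus" "(\<phi> \<odot> h) \<in> L2 torus"
    unfolding fourier_mult_def L2_torus_eq by blast
  have [measurable]: "g \<in> borel_measurable torus" "h \<in> borel_measurable torus"
    using g h(3) by (auto intro: L2_measurable)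
  have ae: "AE x in torus. h x = g x" by (rule inv_fourier_inj[OF h(3) g h(1)[symmetric]])
  have ae': "AE x in torus. complex_of_real (\<phi> x) * h x = complex_of_real (\<phi> x) * g x"
    using ae by eventually_elim simp
  have "(\<phi> \<odot> g) \<in> L2 torus"
    by (rule L2_cong_AE[OF h(4) _ ae']) measurable
  moreover have "u = inv_fourier (\<phi> \<odot> g)"
    unfolding h(2) by (rule inv_fourier_cong_AE[OF _ _ ae']) measurable
  ultimately show "(\<phi> \<odot> g) \<in> L2 torus \<and> u = inv_fourier (\<phi> \<odot> g)" ..
qed (use g in \<open>auto simp: fourier_mult_def L2_torus_eq\<close>)

lemma fourier_mult_subset: "fourier_mult \<phi> \<subseteq> ell2 \<times> ell2"
  unfolding fourier_mult_def L2_torus_eq by (auto intro: inv_fourier_ell2)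

lemma Domain_fourier_mult_iff:
  assumes "g \<in> L2 torus" "\<phi> \<in> borel_measurable torus"
  shows "inv_fourier g \<in> Domain (fourier_mult \<phi>) \<longleftrightarrow> (\<phi> \<odot> g) \<in> L2 torus"
  unfolding Domain_iff fourier_mult_iff[OF assms] by blast

lemma Domain_fourier_mult_cases:
  assumes "f \<in> Domain (fourier_mult \<phi>)"
  obtains g where "g \<in> L2 torus" "(\<phi> \<odot> g) \<in> L2 torus" "f = inv_fourier g"
  using assms unfolding fourier_mult_def L2_torus_eq by blast

lemma app_fourier_mult:
  assumes "g \<in> L2 torus" "\<phi> \<in> borel_measurable torus" "(\<phi> \<odot> g) \<in> L2 torus"
  shows "app (fourier_mult \<phi>) (inv_fourier g) = inv_fourier (\<phi> \<odot> g)"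
  unfolding app_def fourier_mult_iff[OF assms(1,2)] using assms(3) by simp

lemma linear_operatorD:
  assumes "linear_operator T"
  shows "single_valued T"
    and "(f, u) \<in> T \<Longrightarrow> (g, v) \<in> T \<Longrightarrow> ((\<lambda>n. f n + g n), (\<lambda>n. u n + v n)) \<in> T"
    and "(f, u) \<in> T \<Longrightarrow> ((\<lambda>n. z * f n), (\<lambda>n. z * u n)) \<in> T"
proof -
  show "single_valued T" using assms by (simp only: linear_operator_def)
  note l = assms[unfolded linear_operator_def, THEN conjunct2, THEN conjunct2, THEN conjunct2]
  note a = l[THEN conjunct1] and b = l[THEN conjunct2]
  show "(f, u) \<in> T \<Longrightarrow> (g, v) \<in> T \<Longrightarrow> ((\<lambda>n. f n + g n), (\<lambda>n. u n + v n)) \<in> T"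
    using bspec[OF a] by fastforce
  show "(f, u) \<in> T \<Longrightarrow> ((\<lambda>n. z * f n), (\<lambda>n. z * u n)) \<in> T"
    using bspec[OF b] by fastforce
qed

lemma linear_operator_fourier_mult:
  assumes \<phi>: "\<phi> \<in> borel_measurable torus"
  shows "linear_operator (fourier_mult \<phi>)"
proof -
  have 1: "single_valued (fourier_mult \<phi>)"
  proof (rule single_valuedI)
    fix f u v assume u: "(f, u) \<in> fourier_mult \<phi>" and v: "(f, v) \<in> fourier_mult \<phi>"
    then have "f \<in> ell2" using fourier_mult_subset by blast
    then obtain g where g: "g \<in> L2 torus" "f = inv_fourier g" by (rule ell2_cases)
    show "u = v" using u v unfolding g(2) fourier_mult_iff[OF g(1) \<phi>] by simp
  qed
  have 2: "((\<lambda>n. 0), (\<lambda>n. 0)) \<in> fourier_mult \<phi>"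
    using fourier_mult_iff[OF L2_zero \<phi>, of "\<lambda>n. 0"] by (simp add: inv_fourier_zero)
  have 3: "((\<lambda>n. f n + g n), (\<lambda>n. u n + v n)) \<in> fourier_mult \<phi>"
    if "(f, u) \<in> fourier_mult \<phi>" "(g, v) \<in> fourier_mult \<phi>" for f g u v
  proof -
    from that obtain a b where a: "a \<in> L2 torus" "(\<phi> \<odot> a) \<in> L2 torus"
      "f = inv_fourier a" "u = inv_fourier (\<phi> \<odot> a)"
      and b: "b \<in> L2 torus" "(\<phi> \<odot> b) \<in> L2 torus"
      "g = inv_fourier b" "v = inv_fourier (\<phi> \<odot> b)"
      unfolding fourier_mult_def L2_torus_eq by blast
    show ?thesis
      using fourier_mult_iff[OF L2_add[OF a(1) b(1)] \<phi>] L2_add[OF a(2) b(2)] inv_fourier_add[OF a(1) b(1)] inv_fourier_add[OF a(2) b(2)]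
      by (simp add: a b distrib_left)
  qed
  have 4: "((\<lambda>n. z * f n), (\<lambda>n. z * u n)) \<in> fourier_mult \<phi>" if "(f, u) \<in> fourier_mult \<phi>" for f u z
  proof -
    from that obtain a where a: "a \<in> L2 torus" "(\<phi> \<odot> a) \<in> L2 torus"
      "f = inv_fourier a" "u = inv_fourier (\<phi> \<odot> a)"
      unfolding fourier_mult_def L2_torus_eq by blast
    show ?thesis
      using fourier_mult_iff[OF L2_scale[OF a(1), of z] \<phi>] L2_scale[OF a(2), of z]
        inv_fourier_scale[of z a] inv_fourier_scale[of z "\<lambda>\<theta>. complex_of_real (\<phi> \<theta>) * a \<theta>"]
      by (simp add: a mult.left_commute[of _ z])
  qed
  from 1 2 3 4 show ?thesis using fourier_mult_subset unfolding linear_operator_def by blast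
qed

definition mult_proj :: "(real^'d \<Rightarrow> real) \<Rightarrow> real set \<Rightarrow> (int^'d \<Rightarrow> complex) \<Rightarrow> (int^'d \<Rightarrow> complex)" where
  "mult_proj \<phi> S = mult_op (\<lambda>\<theta>. indicator S (\<phi> \<theta>))"

text \<open>The law of \<phi> under the density \<open>|g|^2\<close>; it is the scalar spectral
  measure of \<open>inv_fourier g\<close> for \<open>mult_proj\<close>.\<close>

definition push_measure :: "(real^'d \<Rightarrow> real) \<Rightarrow> (real^'d \<Rightarrow> complex) \<Rightarrow> real measure" where
  "push_measure \<phi> g = distr (density torus (\<lambda>\<theta>. ennreal ((cmod (g \<theta>))\<^sup>2))) borel \<phi>"

context
  fixes \<phi> :: "real^'d \<Rightarrow> real"
  assumes \<phi> [measurable]: "\<phi> \<in> borel_measurable torus"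
begin

lemma indicator_symbol_measurable [measurable]:
  "S \<in> sets borel \<Longrightarrow> (\<lambda>\<theta>. indicator S (\<phi> \<theta>) :: complex) \<in> borel_measurable torus"
  by (rule measurable_compose[OF \<phi> borel_measurable_indicator])

lemma indicator_symbol_L2: "g \<in> L2 torus \<Longrightarrow> S \<in> sets borel \<Longrightarrow> (\<lambda>\<theta>. indicator S (\<phi> \<theta>) * g \<theta>) \<in> L2 torus"
  by (rule L2_bounded_mult[where C = 1]) (auto simp: indicator_def)

lemma mult_proj_inv_fourier:
  "g \<in> L2 torus \<Longrightarrow> S \<in> sets borel \<Longrightarrow> mult_proj \<phi> S (inv_fourier g) = inv_fourier (\<lambda>\<theta>. indicator S (\<phi> \<theta>) * g \<theta>)"
  unfolding mult_proj_def by (rule mult_op_inv_fourier) auto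

lemma integral_push_measure:
  fixes h :: "real \<Rightarrow> real"
  assumes g: "g \<in> L2 torus" and h [measurable]: "h \<in> borel_measurable borel"
  shows "integrable (push_measure \<phi> g) h \<longleftrightarrow> integrable torus (\<lambda>\<theta>. (cmod (g \<theta>))\<^sup>2 * h (\<phi> \<theta>))"
    and "(LINT x|push_measure \<phi> g. h x) = (LINT \<theta>|torus. (cmod (g \<theta>))\<^sup>2 * h (\<phi> \<theta>))"
proof -
  have [measurable]: "g \<in> borel_measurable torus" using g by (rule L2_measurable)
  show "integrable (push_measure \<phi> g) h \<longleftrightarrow> integrable torus (\<lambda>\<theta>. (cmod (g \<theta>))\<^sup>2 * h (\<phi> \<theta>))"
    unfolding push_measure_def by (subst integrable_distr_eq) (auto simp: integrable_density)
  show "(LINT x|push_measure \<phi> g. h x) = (LINT \<theta>|torus. (cmod (g \<theta>))\<^sup>2 * h (\<phi> \<theta>))"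
    unfolding push_measure_def by (subst integral_distr) (auto simp: integral_density)
qed

lemma finite_push_measure:
  assumes g: "g \<in> L2 torus"
  shows "finite_measure (push_measure \<phi> g)"
proof (rule finite_measureI)
  have [measurable]: "g \<in> borel_measurable torus" using g by (rule L2_measurable)
  have "emeasure (push_measure \<phi> g) (space (push_measure \<phi> g)) = (\<integral>\<^sup>+\<theta>. ennreal ((cmod (g \<theta>))\<^sup>2) \<partial>torus)"
    unfolding push_measure_def by (subst emeasure_distr) (auto simp: emeasure_density intro!: nn_integral_cong)
  also have "\<dots> = ennreal (LINT \<theta>|torus. (cmod (g \<theta>))\<^sup>2)"
    by (rule nn_integral_eq_integral) (use g in \<open>auto simp: L2_integrable\<close>)
  finally show "emeasure (push_measure \<phi> g) (space (push_measure \<phi> g)) \<noteq> \<infinity>" by simp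
qed

lemma ip_mult_proj:
  assumes g: "g \<in> L2 torus" and S: "S \<in> sets borel"
  shows "ip (inv_fourier g) (mult_proj \<phi> S (inv_fourier g)) = complex_of_real (measure (push_measure \<phi> g) S)"
proof -
  interpret finite_measure "push_measure \<phi> g" using g by (rule finite_push_measure)
  have S' [measurable]: "S \<in> sets borel" by fact
  have "ip (inv_fourier g) (mult_proj \<phi> S (inv_fourier g)) = (LINT \<theta>|torus. complex_of_real ((cmod (g \<theta>))\<^sup>2 * indicator S (\<phi> \<theta>)))"
    unfolding mult_proj_inv_fourier[OF g S] ip_inv_fourier[OF g indicator_symbol_L2[OF g S]] inn_def
    by (rule Bochner_Integration.integral_cong) (auto simp: complex_norm_square[symmetric] indicator_def mult.commute)
  also have "\<dots> = complex_of_real (LINT x|push_measure \<phi> g. indicator S x)"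
    by (simp only: integral_complex_of_real integral_push_measure(2)[OF g borel_measurable_indicator[OF S]])
  also have "(LINT x|push_measure \<phi> g. indicator S x) = measure (push_measure \<phi> g) S"
    by (simp add: push_measure_def)
  finally show ?thesis .
qed

lemma projection_valued_measure_mult_proj: "projection_valued_measure (mult_proj \<phi>)"
  unfolding projection_valued_measure_def
proof (intro conjI ballI allI impI)
  fix S :: "real set" assume S: "S \<in> sets borel"
  show "orth_projection (mult_proj \<phi> S)"
    unfolding orth_projection_def
  proof (intro conjI ballI)
    fix f :: "int^'d \<Rightarrow> complex" assume "f \<in> ell2"
    then obtain g where g: "g \<in> L2 torus" "f = inv_fourier g" by (rule ell2_cases)
    note gS = indicator_symbol_L2[OF g(1) S]
    show "mult_proj \<phi> S f \<in> ell2"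
      unfolding g mult_proj_inv_fourier[OF g(1) S] by (rule inv_fourier_ell2[OF gS])
    show "mult_proj \<phi> S (mult_proj \<phi> S f) = mult_proj \<phi> S f"
      unfolding g mult_proj_inv_fourier[OF g(1) S] mult_proj_inv_fourier[OF gS S]
      by (rule arg_cong[where f = inv_fourier]) (auto simp: indicator_def)
    fix h :: "int^'d \<Rightarrow> complex" assume "h \<in> ell2"
    then obtain k where k: "k \<in> L2 torus" "h = inv_fourier k" by (rule ell2_cases)
    note kS = indicator_symbol_L2[OF k(1) S]
    show "ip f (mult_proj \<phi> S h) = ip (mult_proj \<phi> S f) h"
      unfolding g k mult_proj_inv_fourier[OF g(1) S] mult_proj_inv_fourier[OF k(1) S] ip_inv_fourier[OF g(1) kS]
        ip_inv_fourier[OF gS k(1)] inn_def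
      by (rule Bochner_Integration.integral_cong) (auto simp: indicator_def)
  qed
next
  fix f :: "int^'d \<Rightarrow> complex" assume "f \<in> ell2"
  then obtain g where g: "g \<in> L2 torus" "f = inv_fourier g" by (rule ell2_cases)
  show "mult_proj \<phi> UNIV f = f" unfolding g by (subst mult_proj_inv_fourier) (use g in auto)
  fix S T :: "real set" assume S: "S \<in> sets borel" and T: "T \<in> sets borel"
  note gT = indicator_symbol_L2[OF g(1) T]
  have ST: "S \<inter> T \<in> sets borel" using S T by auto
  show "mult_proj \<phi> (S \<inter> T) f = mult_proj \<phi> S (mult_proj \<phi> T f)"
    unfolding g mult_proj_inv_fourier[OF g(1) T] mult_proj_inv_fourier[OF gT S] mult_proj_inv_fourier[OF g(1) ST]
    by (rule arg_cong[where f = inv_fourier]) (auto simp: indicator_def)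
next
  fix S :: "nat \<Rightarrow> real set" and f :: "int^'d \<Rightarrow> complex"
  assume S: "range S \<subseteq> sets borel" "disjoint_family S" and "f \<in> ell2"
  then obtain g where g: "g \<in> L2 torus" "f = inv_fourier g" using ell2_cases by blast
  interpret finite_measure "push_measure \<phi> g" using g(1) by (rule finite_push_measure)
  have "(\<lambda>k. measure (push_measure \<phi> g) (S k)) sums measure (push_measure \<phi> g) (\<Union>k. S k)"
    by (rule finite_measure_UNION) (use S in \<open>auto simp: push_measure_def\<close>)
  then have *: "(\<lambda>k. complex_of_real (measure (push_measure \<phi> g) (S k))) sums complex_of_real (measure (push_measure \<phi> g) (\<Union>k. S k))"
    by (rule sums_of_real)
  have SU: "S k \<in> sets borel" "(\<Union>k. S k) \<in> sets borel" for k using S(1) by auto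
  show "(\<lambda>k. ip f (mult_proj \<phi> (S k) f)) sums ip f (mult_proj \<phi> (\<Union>k. S k) f)"
    unfolding g ip_mult_proj[OF g(1) SU(1)] ip_mult_proj[OF g(1) SU(2)] by (rule *)
qed

lemma scalar_measure_mult_proj:
  assumes g: "g \<in> L2 torus"
  shows "scalar_measure (mult_proj \<phi>) (inv_fourier g) = push_measure \<phi> g"
proof -
  interpret finite_measure "push_measure \<phi> g" using g by (rule finite_push_measure)
  have s: "sets (push_measure \<phi> g) = sets borel" "space (push_measure \<phi> g) = UNIV" by (simp_all add: push_measure_def)
  have "scalar_measure (mult_proj \<phi>) (inv_fourier g) = measure_of UNIV (sets borel) (emeasure (push_measure \<phi> g))"
    unfolding scalar_measure_def
    by (rule measure_of_eq) (auto simp: ip_mult_proj[OF g] emeasure_eq_measure sets.sigma_sets_eq[of borel, simplified])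
  also have "\<dots> = push_measure \<phi> g" using measure_of_of_measure[of "push_measure \<phi> g"] by (simp add: s)
  finally show ?thesis .
qed

text \<open>Existence of a spectral measure: this makes the choice in \<open>spectral_proj\<close>
  meaningful, before uniqueness identifies it.\<close>

lemma is_spectral_measure_mult_proj: "is_spectral_measure (fourier_mult \<phi>) (mult_proj \<phi>)"
  unfolding is_spectral_measure_def
proof (intro conjI)
  have dom: "inv_fourier g \<in> Domain (fourier_mult \<phi>) \<longleftrightarrow> integrable (scalar_measure (mult_proj \<phi>) (inv_fourier g)) (\<lambda>x. x\<^sup>2)"
    if g: "g \<in> L2 torus" for g
  proof -
    have [measurable]: "g \<in> borel_measurable torus" using g by (rule L2_measurable)
    show ?thesis
      unfolding scalar_measure_mult_proj[OF g] Domain_fourier_mult_iff[OF g \<phi>]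
      by (subst integral_push_measure(1)[OF g]) (auto simp: L2_def norm_mult power_mult_distrib mult.commute)
  qed
  show "Domain (fourier_mult \<phi>) = {f \<in> ell2. integrable (scalar_measure (mult_proj \<phi>) f) (\<lambda>x. x\<^sup>2)}"
  proof (intro set_eqI iffI)
    fix f assume f: "f \<in> Domain (fourier_mult \<phi>)"
    then obtain g where "g \<in> L2 torus" "f = inv_fourier g" by (rule Domain_fourier_mult_cases)
    then show "f \<in> {f \<in> ell2. integrable (scalar_measure (mult_proj \<phi>) f) (\<lambda>x. x\<^sup>2)}"
      using dom f by (auto intro: inv_fourier_ell2)
  next
    fix f :: "int^'d \<Rightarrow> complex" assume f: "f \<in> {f \<in> ell2. integrable (scalar_measure (mult_proj \<phi>) f) (\<lambda>x. x\<^sup>2)}"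
    then obtain g where "g \<in> L2 torus" "f = inv_fourier g" using ell2_cases by blast
    then show "f \<in> Domain (fourier_mult \<phi>)" using dom f by auto
  qed
  show "\<forall>(f, u) \<in> fourier_mult \<phi>. ip f u = complex_of_real (LINT x|scalar_measure (mult_proj \<phi>) f. x)"
  proof safe
    fix f u assume "(f, u) \<in> fourier_mult \<phi>"
    then obtain g where g: "g \<in> L2 torus" "f = inv_fourier g" "u = inv_fourier (\<phi> \<odot> g)"
      "(\<phi> \<odot> g) \<in> L2 torus"
      unfolding fourier_mult_def L2_torus_eq by blast
    have "ip f u = (LINT \<theta>|torus. complex_of_real ((cmod (g \<theta>))\<^sup>2 * \<phi> \<theta>))"
      unfolding g ip_inv_fourier[OF g(1,4)] inn_def
      by (rule Bochner_Integration.integral_cong) (auto simp: complex_norm_square[symmetric] mult_ac)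
    also have "\<dots> = complex_of_real (LINT x|scalar_measure (mult_proj \<phi>) f. x)"
    proof -
      have id: "(\<lambda>x::real. x) \<in> borel_measurable borel" by simp
      show ?thesis
        unfolding g(2) scalar_measure_mult_proj[OF g(1)]
        by (simp only: integral_complex_of_real integral_push_measure(2)[OF g(1) id])
    qed
    finally show "ip f u = complex_of_real (LINT x|scalar_measure (mult_proj \<phi>) f. x)" .
  qed
qed (use linear_operator_fourier_mult[OF \<phi>] projection_valued_measure_mult_proj in auto)

end

section \<open>Uniqueness of the spectral measure\<close>

text \<open>\<open>E\<close> stands for an arbitrary spectral measure of multiplication by \<phi>.
  Only the domain and the diagonal of the form are prescribed; that \<open>E\<close> reduces the
  operator has to be derived from them.\<close>

locale multiplier_pvm = pvm E for E :: "real set \<Rightarrow> (int^'d \<Rightarrow> complex) \<Rightarrow> (int^'d \<Rightarrow> complex)" +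
  fixes \<phi> :: "real^'d \<Rightarrow> real"
  assumes \<phi>: "\<phi> \<in> borel_measurable torus"
    and dom: "Domain (fourier_mult \<phi>) = {f \<in> ell2. integrable (scalar_measure E f) (\<lambda>x. x\<^sup>2)}"
    and quad: "\<And>f u. (f, u) \<in> fourier_mult \<phi> \<Longrightarrow> ip f u = complex_of_real (LINT x|scalar_measure E f. x)"
begin

abbreviation "D \<equiv> Domain (fourier_mult \<phi>)"
abbreviation "T \<equiv> app (fourier_mult \<phi>)"

lemma dom_ell2: "f \<in> D \<Longrightarrow> f \<in> ell2"
  using dom by auto

lemma app_mem: "f \<in> D \<Longrightarrow> (f, T f) \<in> fourier_mult \<phi>"
  by (elim Domain_fourier_mult_cases) (simp add: app_fourier_mult fourier_mult_iff \<phi>)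

lemma app_ell2 [simp]: "f \<in> D \<Longrightarrow> T f \<in> ell2"
  using app_mem fourier_mult_subset by blast

lemma dom_add: "f \<in> D \<Longrightarrow> g \<in> D \<Longrightarrow> (\<lambda>n. f n + g n) \<in> D"
  and app_add: "f \<in> D \<Longrightarrow> g \<in> D \<Longrightarrow> T (\<lambda>n. f n + g n) = (\<lambda>n. T f n + T g n)"
  and dom_scale: "f \<in> D \<Longrightarrow> (\<lambda>n. c * f n) \<in> D"
  and app_scale: "f \<in> D \<Longrightarrow> T (\<lambda>n. c * f n) = (\<lambda>n. c * T f n)"
proof -
  have lin: "linear_operator (fourier_mult \<phi>)" by (rule linear_operator_fourier_mult[OF \<phi>])
  have app: "T f = u" if "(f, u) \<in> fourier_mult \<phi>" for f u
    unfolding app_def by (rule the_equality) (auto intro: that single_valuedD[OF linear_operatorD(1)[OF lin] _ that])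
  have a: "((\<lambda>n. f n + g n), (\<lambda>n. T f n + T g n)) \<in> fourier_mult \<phi>" if "f \<in> D" "g \<in> D" for f g
    by (rule linear_operatorD(2)[OF lin app_mem[OF that(1)] app_mem[OF that(2)]])
  have s: "((\<lambda>n. c * f n), (\<lambda>n. c * T f n)) \<in> fourier_mult \<phi>" if "f \<in> D" for f
    by (rule linear_operatorD(3)[OF lin app_mem[OF that]])
  show "f \<in> D \<Longrightarrow> g \<in> D \<Longrightarrow> (\<lambda>n. f n + g n) \<in> D" "f \<in> D \<Longrightarrow> g \<in> D \<Longrightarrow> T (\<lambda>n. f n + g n) = (\<lambda>n. T f n + T g n)"
    "f \<in> D \<Longrightarrow> (\<lambda>n. c * f n) \<in> D" "f \<in> D \<Longrightarrow> T (\<lambda>n. c * f n) = (\<lambda>n. c * T f n)"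
    by (auto intro!: a s app intro: DomainI[OF a] DomainI[OF s])
qed

lemma app_sym:
  assumes "f \<in> D" "g \<in> D"
  shows "ip (T f) g = ip f (T g)"
proof -
  obtain a where a: "a \<in> L2 torus" "(\<phi> \<odot> a) \<in> L2 torus" "f = inv_fourier a"
    using assms(1) by (rule Domain_fourier_mult_cases)
  obtain b where b: "b \<in> L2 torus" "(\<phi> \<odot> b) \<in> L2 torus" "g = inv_fourier b"
    using assms(2) by (rule Domain_fourier_mult_cases)
  show ?thesis
    unfolding a(3) b(3) app_fourier_mult[OF a(1) \<phi> a(2)] app_fourier_mult[OF b(1) \<phi> b(2)]
      ip_inv_fourier[OF a(2) b(1)] ip_inv_fourier[OF a(1) b(2)] inn_def
    by (rule Bochner_Integration.integral_cong) auto
qed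

lemma integrable_scalar_measure_proj:
  fixes h :: "real \<Rightarrow> real"
  assumes f: "f \<in> ell2" and J: "J \<in> sets borel" and h: "h \<in> borel_measurable borel"
  shows "integrable (scalar_measure E (E J f)) h \<longleftrightarrow> integrable (scalar_measure E f) (\<lambda>x. indicator J x * h x)"
    and "(LINT x|scalar_measure E (E J f). h x) = (LINT x|scalar_measure E f. indicator J x * h x)"
proof -
  note m = borel_measurable_scalar_measure[OF f]
  have J': "(indicator J :: real \<Rightarrow> real) \<in> borel_measurable (scalar_measure E f)"
    using J unfolding m by (rule borel_measurable_indicator)
  have h': "h \<in> borel_measurable (scalar_measure E f)" using h unfolding m .
  show "integrable (scalar_measure E (E J f)) h \<longleftrightarrow> integrable (scalar_measure E f) (\<lambda>x. indicator J x * h x)"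
    unfolding scalar_measure_proj[OF f J] using J' h' by (subst integrable_density) auto
  show "(LINT x|scalar_measure E (E J f). h x) = (LINT x|scalar_measure E f. indicator J x * h x)"
    unfolding scalar_measure_proj[OF f J] using J' h' by (subst integral_density) auto
qed

lemma integrable_indicator_mult:
  fixes h :: "real \<Rightarrow> real"
  assumes f: "f \<in> ell2" and J: "J \<in> sets borel" and h: "integrable (scalar_measure E f) h"
  shows "integrable (scalar_measure E f) (\<lambda>x. indicator J x * h x)"
  using integrable_mult_indicator[of J "scalar_measure E f" h] assms by (simp add: sets_scalar_measure)

lemma dom_proj:
  assumes "f \<in> D" "J \<in> sets borel"
  shows "E J f \<in> D"
  using assms dom integrable_indicator_mult[of f J "\<lambda>x. x\<^sup>2"] integrable_scalar_measure_proj(1)[of f J "\<lambda>x. x\<^sup>2"]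
  by auto

lemma integrable_id:
  assumes "f \<in> D"
  shows "integrable (scalar_measure E f) (\<lambda>x. x)"
proof -
  have f: "f \<in> ell2" "integrable (scalar_measure E f) (\<lambda>x. x\<^sup>2)" using assms dom by auto
  interpret finite_measure "scalar_measure E f" by (rule finite_scalar_measure[OF f(1)])
  have b: "\<bar>x\<bar> \<le> 1 + x\<^sup>2" for x :: real
    using sum_squares_bound[of 1 "\<bar>x\<bar>"] by simp
  show ?thesis
  proof (rule Bochner_Integration.integrable_bound[where f = "\<lambda>x. 1 + x\<^sup>2"])
    show "integrable (scalar_measure E f) (\<lambda>x. 1 + x\<^sup>2)" using f(2) by simp
    show "(\<lambda>x. x) \<in> borel_measurable (scalar_measure E f)"
      unfolding borel_measurable_scalar_measure[OF f(1)] by simp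
  qed (use b in auto)
qed

text \<open>The integral of \<open>x\<close> against the scalar measure splits over \<open>J\<close>
  and its complement, and each part is the form of the projected vector. This says that the form has
  no cross terms.\<close>

lemma quad_split:
  assumes f: "f \<in> D" and J: "J \<in> sets borel"
  shows "ip f (T f) = ip (E J f) (T (E J f)) + ip (E (- J) f) (T (E (- J) f))"
proof -
  have f': "f \<in> ell2" using f by (rule dom_ell2)
  have J': "- J \<in> sets borel" using J by auto
  have id: "(\<lambda>x::real. x) \<in> borel_measurable borel" by simp
  have "(LINT x|scalar_measure E f. x) = (LINT x|scalar_measure E f. indicator J x * x + indicator (- J) x * x)"
    by (rule Bochner_Integration.integral_cong) (auto simp: indicator_def)
  also have "\<dots> = (LINT x|scalar_measure E f. indicator J x * x) + (LINT x|scalar_measure E f. indicator (- J) x * x)"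
    by (rule Bochner_Integration.integral_add) (intro integrable_indicator_mult[OF f'] J J' integrable_id[OF f])+
  finally show ?thesis
    using quad[OF app_mem[OF f]] quad[OF app_mem[OF dom_proj[OF f J]]] quad[OF app_mem[OF dom_proj[OF f J']]]
    by (simp add: integrable_scalar_measure_proj(2)[OF f' J id] integrable_scalar_measure_proj(2)[OF f' J' id])
qed

text \<open>A bounded \<open>J\<close> makes \<open>x^2\<close> integrable on it, and the integrand
  \<open>x\<close> stays within \<delta> of \<open>c\<close>. The estimate is on the diagonal only;
  \<open>form_estimate\<close> polarizes it.\<close>

lemma bounded_part:
  assumes f: "f \<in> ell2" and J: "J \<in> sets borel" "J \<subseteq> {c - \<delta>..c + \<delta>}"
  shows "E J f \<in> D"
    and "\<bar>Re (ip (E J f) (T (E J f))) - c * (l2norm (E J f))\<^sup>2\<bar> \<le> \<delta> * (l2norm (E J f))\<^sup>2"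
proof -
  interpret finite_measure "scalar_measure E f" by (rule finite_scalar_measure[OF f])
  note m = borel_measurable_scalar_measure[OF f]
  have id: "(\<lambda>x::real. x) \<in> borel_measurable borel" by simp
  have sq: "(\<lambda>x::real. x\<^sup>2) \<in> borel_measurable borel" by simp
  have "integrable (scalar_measure E f) (\<lambda>x. indicator J x * x\<^sup>2)"
  proof (rule integrable_const_bound[where B = "(\<bar>c\<bar> + \<bar>\<delta>\<bar>)\<^sup>2"])
    show "AE x in scalar_measure E f. norm (indicator J x * x\<^sup>2) \<le> (\<bar>c\<bar> + \<bar>\<delta>\<bar>)\<^sup>2"
    proof (rule AE_I2)
      fix x
      have "\<bar>x\<bar> \<le> \<bar>c\<bar> + \<bar>\<delta>\<bar>" if "x \<in> J" using that J(2) by (auto simp: subset_eq abs_if)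
      then have "x\<^sup>2 \<le> (\<bar>c\<bar> + \<bar>\<delta>\<bar>)\<^sup>2" if "x \<in> J" using that power_mono[of "\<bar>x\<bar>" _ 2] by simp
      then show "norm (indicator J x * x\<^sup>2) \<le> (\<bar>c\<bar> + \<bar>\<delta>\<bar>)\<^sup>2" by (simp add: indicator_def)
    qed
    have "(\<lambda>x. indicator J x * x\<^sup>2 :: real) \<in> borel_measurable borel" using J(1) by measurable
    then show "(\<lambda>x. indicator J x * x\<^sup>2 :: real) \<in> borel_measurable (scalar_measure E f)" unfolding m .
  qed
  then show ED: "E J f \<in> D"
    using dom f J(1) integrable_scalar_measure_proj(1)[OF f J(1) sq] by auto
  have i: "integrable (scalar_measure E f) (\<lambda>x. indicator J x * x)"
    using integrable_id[OF ED] unfolding integrable_scalar_measure_proj(1)[OF f J(1) id] .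
  have ind: "integrable (scalar_measure E f) (indicator J :: real \<Rightarrow> real)"
    using integrable_indicator_mult[OF f J(1), of "\<lambda>_. 1"] by simp
  have ind_eq: "(LINT x|scalar_measure E f. indicator J x) = (l2norm (E J f))\<^sup>2"
    using f J by (simp add: space_scalar_measure measure_scalar_measure)
  have "Re (ip (E J f) (T (E J f))) - c * (l2norm (E J f))\<^sup>2 =
     (LINT x|scalar_measure E f. indicator J x * x) - c * (LINT x|scalar_measure E f. indicator J x)"
    unfolding ind_eq using quad[OF app_mem[OF ED]] by (simp add: integrable_scalar_measure_proj(2)[OF f J(1) id])
  also have "\<dots> = (LINT x|scalar_measure E f. indicator J x * x - c * indicator J x)"
    using i ind by simp
  also have "\<bar>\<dots>\<bar> \<le> (LINT x|scalar_measure E f. \<delta> * indicator J x)"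
  proof (rule order_trans[OF integral_abs_bound integral_mono])
    fix x
    have "\<bar>x - c\<bar> \<le> \<delta>" if "x \<in> J" using that J(2) by (auto simp: subset_eq abs_if)
    then show "\<bar>indicator J x * x - c * indicator J x\<bar> \<le> \<delta> * indicator J x"
      by (simp add: indicator_def)
  qed (use i ind in auto)
  also have "\<dots> = \<delta> * (l2norm (E J f))\<^sup>2" using ind_eq by simp
  finally show "\<bar>Re (ip (E J f) (T (E J f))) - c * (l2norm (E J f))\<^sup>2\<bar> \<le> \<delta> * (l2norm (E J f))\<^sup>2" .
qed

text \<open>Applying \<open>quad_split\<close> to \<open>f + E (- J) h\<close> cancels the diagonal
  terms, so the two conjugate cross terms add up to 0 and the real part of each vanishes.\<close>

lemma decouple:
  assumes J: "J \<in> sets borel" and f: "f \<in> D" "E J f = f" and h: "h \<in> D"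
  shows "ip (E (- J) h) (T f) = 0"
proof -
  have J': "- J \<in> sets borel" using J by auto
  let ?h = "E (- J) h"
  have hD: "?h \<in> D" by (rule dom_proj[OF h J'])
  have re: "Re (ip ?h (T f)) = 0" if f: "f \<in> D" "E J f = f" for f
  proof -
    let ?w = "\<lambda>n. f n + ?h n"
    have e: "f \<in> ell2" "?h \<in> ell2" "h \<in> ell2" using dom_ell2[OF f(1)] dom_ell2[OF h] dom_ell2[OF hD] by auto
    have wD: "?w \<in> D" by (rule dom_add[OF f(1) hD])
    have "E (- J) f = (\<lambda>n. 0)"
      using proj_Int[OF J' J e(1)] f(2) proj_empty[OF e(1)] by simp
    then have w': "E (- J) ?w = ?h" using e J' by (simp add: proj_add proj_idem)
    have "E J ?h = (\<lambda>n. 0)"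
      using proj_Int[OF J J' e(3)] proj_empty[OF e(3)] by simp
    then have w: "E J ?w = f" using e J f(2) by (simp add: proj_add)
    have "ip ?w (T ?w) = ip f (T f) + ip ?h (T ?h)"
      using quad_split[OF wD J] w w' by simp
    moreover have "ip ?w (T ?w) = ip f (T f) + ip f (T ?h) + (ip ?h (T f) + ip ?h (T ?h))"
      using e f hD by (simp add: app_add ip_add_right ip_add_left)
    ultimately have "ip f (T ?h) + ip ?h (T f) = 0" by simp
    moreover have "ip f (T ?h) = cnj (ip ?h (T f))"
      using app_sym[OF f(1) hD] ip_commute[of ?h "T f"] e f by simp
    ultimately have "cnj (ip ?h (T f)) + ip ?h (T f) = 0" by simp
    then show ?thesis by (simp add: complex_eq_iff)
  qed
  have e: "f \<in> ell2" using f(1) by (rule dom_ell2)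
  \<comment> \<open>The same with \<open>\<i> * f\<close> in place of \<open>f\<close> yields the
    imaginary part.\<close>
  have "Re (ip ?h (T (\<lambda>n. \<i> * f n))) = 0"
    by (rule re) (use f J e in \<open>auto simp: dom_scale proj_scale\<close>)
  then have "Re (\<i> * ip ?h (T f)) = 0" using f by (simp add: app_scale ip_scale_right)
  with re[OF f] show ?thesis by (simp add: complex_eq_iff)
qed

text \<open>By \<open>decouple\<close> only the part of \<open>k\<close> in the range of
  \<open>E J\<close> matters. There \<open>T - c\<close> is small on the diagonal, and the
  polarization and parallelogram identities carry the smallness to pairs.\<close>

lemma form_estimate:
  assumes J: "J \<in> sets borel" "J \<subseteq> {c - \<delta>..c + \<delta>}" and f: "f \<in> ell2" "E J f = f"
    and k: "k \<in> D" and l: "l > 0" and \<delta>: "\<delta> \<ge> 0"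
  shows "Re (ip k (T f) - of_real c * ip k f) \<le> \<delta> / 2 * (l * (l2norm k)\<^sup>2 + (l2norm f)\<^sup>2 / l)"
proof -
  have J': "- J \<in> sets borel" using J by auto
  have fD: "f \<in> D" using bounded_part(1)[OF f(1) J] f(2) by simp
  have ke: "k \<in> ell2" using k by (rule dom_ell2)
  define p where "p = E J k"
  have p: "p \<in> D" "p \<in> ell2" "E J p = p"
    using k ke J by (auto simp: p_def dom_proj proj_idem)
  have k_eq: "k = (\<lambda>n. p n + E (- J) k n)" using proj_Compl[OF ke J(1)] by (simp add: p_def)
  have "ip k (T f) = ip p (T f) + ip (E (- J) k) (T f)"
    using ip_add_left[of "T f" p "E (- J) k"] k_eq p fD ke J' by simp
  then have 1: "ip k (T f) = ip p (T f)" using decouple[OF J(1) fD f(2) k] by simp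
  have 2: "ip k f = ip p f"
    using proj_sym[OF J(1) ke f(1)] f(2) by (simp add: p_def)
  have pk: "(l2norm p)\<^sup>2 \<le> (l2norm k)\<^sup>2" unfolding p_def by (rule l2norm_proj_le[OF ke J(1)])
  define B where "B a b = Re (ip a (T b)) - c * Re (ip a b)" for a b
  \<comment> \<open>Opposite rescalings by \<open>sqrt l\<close> leave the bilinear value unchanged
    and introduce the free weight \<open>l\<close> into the norms.\<close>
  define a where "a = (\<lambda>n. complex_of_real (sqrt l) * p n)"
  define b where "b = (\<lambda>n. complex_of_real (1 / sqrt l) * f n)"
  have ab: "a \<in> D" "b \<in> D" "a \<in> ell2" "b \<in> ell2" "E J a = a" "E J b = b"
    unfolding a_def b_def proj_scale[OF J(1) p(2)] proj_scale[OF J(1) f(1)] p(3) f(2)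
    by (intro dom_scale ell2_scale p fD f refl)+
  define s where "s = (\<lambda>n. a n + b n)"
  define t where "t = (\<lambda>n. a n + (-1) * b n)"
  have nb: "(\<lambda>n. (-1) * b n) \<in> D" "(\<lambda>n. (-1) * b n) \<in> ell2" "E J (\<lambda>n. (-1) * b n) = (\<lambda>n. (-1) * b n)"
    using ab J by (simp_all only: dom_scale ell2_scale proj_scale)
  have st: "s \<in> D" "t \<in> D" "s \<in> ell2" "t \<in> ell2" "E J s = s" "E J t = t"
    using ab nb J unfolding s_def t_def by (simp_all only: dom_add ell2_add proj_add)
  have bound: "\<bar>B x x\<bar> \<le> \<delta> * (l2norm x)\<^sup>2" if "x \<in> ell2" "E J x = x" for x
    using bounded_part(2)[OF that(1) J] that by (simp add: B_def ip_self)
  have Bs: "B s s = B a a + B b b + 2 * B a b"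
  proof -
    have "Re (ip b (T a)) = Re (ip a (T b))" "Re (ip b a) = Re (ip a b)"
      using app_sym[OF ab(1,2)] ip_commute[of "T a" b] ip_commute[of a b] ab
      by (metis app_ell2 complex_cnj(1) cnj.sel(1))+
    then show ?thesis using ab by (simp add: B_def s_def app_add ip_add_left ip_add_right algebra_simps)
  qed
  have Bt: "B t t = B a a + B b b - 2 * B a b"
  proof -
    have r: "Re (ip b (T a)) = Re (ip a (T b))" "Re (ip b a) = Re (ip a b)"
      using app_sym[OF ab(1,2)] ip_commute[of "T a" b] ip_commute[of a b] ab
      by (metis app_ell2 complex_cnj(1) cnj.sel(1))+
    have Tt: "T t = (\<lambda>n. T a n + (-1) * T b n)"
      unfolding t_def app_add[OF ab(1) nb(1)] app_scale[OF ab(2)] ..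
    have nT: "(\<lambda>n. (-1) * T b n) \<in> ell2" using ab by (intro ell2_scale app_ell2)
    have T1: "ip t (T t) = ip a (T a) - ip a (T b) - ip b (T a) + ip b (T b)"
      unfolding Tt using ab nb nT unfolding t_def
      by (simp only: ip_add_left ip_add_right ip_scale_left ip_scale_right app_ell2 ell2_add) simp
    have T2: "ip t t = ip a a - ip a b - ip b a + ip b b"
      using ab nb unfolding t_def
      by (simp only: ip_add_left ip_add_right ip_scale_left ip_scale_right ell2_add) simp
    show ?thesis unfolding B_def T1 T2 using r by (simp add: algebra_simps)
  qed
  have par: "(l2norm s)\<^sup>2 + (l2norm t)\<^sup>2 = 2 * (l2norm a)\<^sup>2 + 2 * (l2norm b)\<^sup>2"
    unfolding s_def t_def using ab nb
    by (simp only: l2norm_add_sq ip_scale_right l2norm_scale) simp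
  have "4 * B a b = B s s - B t t" using Bs Bt by simp
  also have "\<dots> \<le> \<delta> * (l2norm s)\<^sup>2 + \<delta> * (l2norm t)\<^sup>2"
    using bound[OF st(3,5)] bound[OF st(4,6)] by linarith
  also have "\<dots> = 2 * \<delta> * ((l2norm a)\<^sup>2 + (l2norm b)\<^sup>2)"
    unfolding distrib_left[symmetric] par by (simp add: algebra_simps)
  also have "\<dots> = 2 * \<delta> * (l * (l2norm p)\<^sup>2 + (l2norm f)\<^sup>2 / l)"
    unfolding a_def b_def l2norm_scale using l by (simp add: norm_divide power_mult_distrib power_divide)
  also have "\<dots> \<le> 2 * \<delta> * (l * (l2norm k)\<^sup>2 + (l2norm f)\<^sup>2 / l)"
    using \<delta> l pk by (intro mult_left_mono add_right_mono) auto
  finally have "B a b \<le> \<delta> / 2 * (l * (l2norm k)\<^sup>2 + (l2norm f)\<^sup>2 / l)" by simp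
  moreover have "B a b = B p f"
  proof -
    have "T b = (\<lambda>n. complex_of_real (1 / sqrt l) * T f n)" unfolding b_def by (rule app_scale[OF fD])
    then have "ip a (T b) = ip p (T f)" using l
      by (simp only: a_def ip_scale_left ip_scale_right) simp
    moreover have "ip a b = ip p f" using l by (simp only: a_def b_def ip_scale_left ip_scale_right) simp
    ultimately show ?thesis by (simp add: B_def)
  qed
  ultimately show ?thesis by (simp add: B_def 1 2)
qed

end

section \<open>Agreement with \<open>mult_proj\<close> on compact intervals\<close>

context multiplier_pvm
begin

sublocale M: pvm "mult_proj \<phi>"
  by (rule pvm.intro) (rule projection_valued_measure_mult_proj[OF \<phi>])

lemma mass_estimate:
  assumes J: "J \<in> sets borel" "J \<subseteq> {c - \<delta>..c + \<delta>}" and f: "f \<in> ell2" "E J f = f"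
    and \<delta>: "\<delta> > 0" and \<eta>: "\<eta> > 0" and K: "K \<in> sets borel" "\<And>x. x \<in> K \<Longrightarrow> \<eta> \<le> \<bar>x - c\<bar>"
  shows "(l2norm (mult_proj \<phi> K f))\<^sup>2 \<le> (\<delta> / \<eta>)\<^sup>2 * (l2norm f)\<^sup>2"
proof -
  note [measurable] = \<phi> K(1)
  obtain g where g: "g \<in> L2 torus" "f = inv_fourier g" using f(1) by (rule ell2_cases)
  have [measurable]: "g \<in> borel_measurable torus" using g(1) by (rule L2_measurable)
  have [measurable]: "(\<lambda>\<theta>. indicator K (\<phi> \<theta>) :: complex) \<in> borel_measurable torus"
    by (rule indicator_symbol_measurable[OF \<phi> K(1)])
  have fD: "f \<in> D" using bounded_part(1)[OF f(1) J] f(2) by simp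
  then have \<phi>g: "(\<phi> \<odot> g) \<in> L2 torus"
    unfolding g(2) Domain_fourier_mult_iff[OF g(1) \<phi>] .
  \<comment> \<open>The test vector \<open>k = m g\<close> is the inverse of \<phi> - c applied to
    the part of \<open>f\<close> in \<open>K\<close>, so pairing it with \<open>(T - c) f\<close>
    returns the mass \<open>e\<close> to be estimated.\<close>
  define m where "m = (\<lambda>\<theta>. indicator K (\<phi> \<theta>) / complex_of_real (\<phi> \<theta> - c))"
  have mm [measurable]: "m \<in> borel_measurable torus" unfolding m_def by measurable
  have mb: "cmod (m \<theta>) \<le> 1 / \<eta>" for \<theta>
  proof (cases "\<phi> \<theta> \<in> K")
    case True
    then have "1 / \<bar>\<phi> \<theta> - c\<bar> \<le> 1 / \<eta>" using frac_le[of 1 1 \<eta> "\<bar>\<phi> \<theta> - c\<bar>"] K(2)[OF True] \<eta> by simp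
    then show ?thesis using True by (simp add: m_def norm_divide del: of_real_diff)
  qed (use \<eta> in \<open>simp add: m_def\<close>)
  have m1: "cnj (m \<theta>) * (complex_of_real (\<phi> \<theta>) - complex_of_real c) = indicator K (\<phi> \<theta>)" for \<theta>
    using K(2)[of "\<phi> \<theta>"] \<eta> by (auto simp: m_def indicator_def of_real_diff[symmetric] simp del: of_real_diff)
  have m2: "cmod (complex_of_real (\<phi> \<theta>) * m \<theta>) \<le> 1 + \<bar>c\<bar> / \<eta>" for \<theta>
  proof -
    have "complex_of_real (\<phi> \<theta>) * m \<theta> = indicator K (\<phi> \<theta>) + complex_of_real c * m \<theta>"
      using K(2)[of "\<phi> \<theta>"] \<eta> by (auto simp: m_def indicator_def field_simps)
    also have "cmod \<dots> \<le> 1 + \<bar>c\<bar> * (1 / \<eta>)"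
      by (rule order_trans[OF norm_triangle_ineq add_mono])
         (use mult_left_mono[OF mb[of \<theta>] abs_ge_zero[of c]] in \<open>auto simp: indicator_def norm_mult\<close>)
    finally show ?thesis by simp
  qed
  have mg: "(\<lambda>\<theta>. m \<theta> * g \<theta>) \<in> L2 torus" by (rule L2_bounded_mult[OF g(1) mm mb])
  have \<phi>mg: "(\<lambda>\<theta>. complex_of_real (\<phi> \<theta>) * (m \<theta> * g \<theta>)) \<in> L2 torus"
    unfolding mult.assoc[symmetric] by (rule L2_bounded_mult[OF g(1) _ m2]) measurable
  define k where "k = inv_fourier (\<lambda>\<theta>. m \<theta> * g \<theta>)"
  have kD: "k \<in> D" unfolding k_def Domain_fourier_mult_iff[OF mg \<phi>] by (rule \<phi>mg)
  let ?Kg = "\<lambda>\<theta>. indicator K (\<phi> \<theta>) * g \<theta>"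
  have Kg: "?Kg \<in> L2 torus" by (rule indicator_symbol_L2[OF \<phi> g(1) K(1)])
  define e where "e = (l2norm (mult_proj \<phi> K f))\<^sup>2"
  have e: "e = sqn torus ?Kg"
    unfolding e_def g(2) mult_proj_inv_fourier[OF \<phi> g(1) K(1)] l2norm_inv_fourier[OF Kg] by simp
  have "ip k (T f) - of_real c * ip k f = inn torus (\<lambda>\<theta>. m \<theta> * g \<theta>) (\<lambda>\<theta>. complex_of_real (\<phi> \<theta>) * g \<theta> - of_real c * g \<theta>)"
    unfolding k_def g(2) app_fourier_mult[OF g(1) \<phi> \<phi>g] ip_inv_fourier[OF mg \<phi>g] ip_inv_fourier[OF mg g(1)]
    using g(1) mg \<phi>g by (subst inn_diff_right) (auto simp: inn_scale_right)
  also have "\<dots> = inn torus ?Kg ?Kg"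
    unfolding inn_def
  proof (rule Bochner_Integration.integral_cong)
    fix \<theta>
    have "cnj (m \<theta> * g \<theta>) * (complex_of_real (\<phi> \<theta>) * g \<theta> - of_real c * g \<theta>) =
      (cnj (m \<theta>) * (complex_of_real (\<phi> \<theta>) - complex_of_real c)) * (cnj (g \<theta>) * g \<theta>)"
      by (simp add: algebra_simps)
    then show "cnj (m \<theta> * g \<theta>) * (complex_of_real (\<phi> \<theta>) * g \<theta> - of_real c * g \<theta>) = cnj (?Kg \<theta>) * ?Kg \<theta>"
      unfolding m1 by (auto simp: indicator_def)
  qed simp
  finally have "e = Re (ip k (T f) - of_real c * ip k f)" unfolding inn_self e by simp
  \<comment> \<open>With the weight \<open>l = \<eta>^2 / \<delta>\<close> and the bound
    \<open>e / \<eta>^2\<close> for the squared norm of \<open>k\<close>, the first term becomes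
    \<open>e / 2\<close> and can be absorbed on the left.\<close>
  also have "\<dots> \<le> \<delta> / 2 * ((\<eta>\<^sup>2 / \<delta>) * (l2norm k)\<^sup>2 + (l2norm f)\<^sup>2 / (\<eta>\<^sup>2 / \<delta>))"
    by (rule form_estimate[OF J f kD]) (use \<eta> \<delta> in auto)
  also have "\<dots> \<le> \<delta> / 2 * ((\<eta>\<^sup>2 / \<delta>) * (e / \<eta>\<^sup>2) + (l2norm f)\<^sup>2 / (\<eta>\<^sup>2 / \<delta>))"
  proof (intro mult_left_mono add_right_mono)
    have "(l2norm k)\<^sup>2 = sqn torus (\<lambda>\<theta>. m \<theta> * g \<theta>)" unfolding k_def l2norm_inv_fourier[OF mg] by simp
    also have "\<dots> \<le> sqn torus (\<lambda>\<theta>. complex_of_real (1 / \<eta>) * ?Kg \<theta>)"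
    proof (rule sqn_mono_AE[OF L2_scale[OF Kg] mg], rule AE_I2)
      fix \<theta>
      show "cmod (m \<theta> * g \<theta>) \<le> cmod (complex_of_real (1 / \<eta>) * ?Kg \<theta>)"
      proof (cases "\<phi> \<theta> \<in> K")
        case True
        then show ?thesis using mult_right_mono[OF mb[of \<theta>] norm_ge_zero[of "g \<theta>"]] \<eta> by (simp add: norm_mult norm_divide)
      qed (simp add: m_def)
    qed
    also have "\<dots> = e / \<eta>\<^sup>2"
      unfolding sqn_scale e using \<eta> by (simp add: norm_divide power_divide)
    finally show "(l2norm k)\<^sup>2 \<le> e / \<eta>\<^sup>2" .
  qed (use \<eta> \<delta> in auto)
  also have "\<dots> = e / 2 + (\<delta> / \<eta>)\<^sup>2 * (l2norm f)\<^sup>2 / 2"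
    using \<eta> \<delta> by (simp add: power2_eq_square field_simps)
  finally show ?thesis unfolding e_def by simp
qed

text \<open>Cut the interval into \<open>N\<close> pieces of length \<delta> of order
  \<open>1 / N\<close>. Each piece loses a factor \<open>(\<delta> / \<eta>)^2\<close> by
  \<open>mass_estimate\<close>, recombining costs a factor \<open>N\<close>, and the total is of
  order \<open>1 / N\<close>.\<close>

lemma mult_proj_disjoint_interval:
  assumes f: "f \<in> ell2" "E {p..q} f = f" and pq: "p \<le> q" and \<eta>: "\<eta> > 0"
    and K: "K \<in> sets borel" "\<And>x y. x \<in> K \<Longrightarrow> y \<in> {p..q} \<Longrightarrow> \<eta> \<le> \<bar>x - y\<bar>"
  shows "mult_proj \<phi> K f = (\<lambda>n. 0)"
proof -
  have bound: "(l2norm (mult_proj \<phi> K f))\<^sup>2 \<le> ((q - p + 1) / \<eta>)\<^sup>2 * (l2norm f)\<^sup>2 * inverse (real N)" if N: "N > 0" for N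
  proof -
    \<comment> \<open>The added 1 keeps \<delta> positive when \<open>p = q\<close> and places
      \<open>q\<close> strictly inside the \<open>N\<close> half-open pieces.\<close>
    define \<delta> where "\<delta> = (q - p + 1) / real N"
    have \<delta>: "\<delta> > 0" "real N * \<delta> = q - p + 1" using N pq by (auto simp: \<delta>_def)
    define J where "J i = {p + real i * \<delta>..<p + real (Suc i) * \<delta>} \<inter> {p..q}" for i
    have JM: "J i \<in> sets borel" for i by (auto simp: J_def)
    have Jd: "disjoint_family J"
    proof -
      have "J i \<inter> J j = {}" if "i < j" for i j
      proof -
        have "real (Suc i) * \<delta> \<le> real j * \<delta>" using that \<delta> by (intro mult_right_mono) auto
        then show ?thesis by (auto simp: J_def)
      qed
      then show ?thesis by (metis disjoint_family_on_def inf_commute nat_neq_iff)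
    qed
    have cover: "(\<Union>i<N. J i) = {p..q}"
    proof (intro equalityI subsetI)
      fix x assume x: "x \<in> {p..q}"
      define i where "i = nat \<lfloor>(x - p) / \<delta>\<rfloor>"
      have nn: "0 \<le> (x - p) / \<delta>" using x \<delta> by simp
      have i: "real i \<le> (x - p) / \<delta>" "(x - p) / \<delta> < real (Suc i)"
        unfolding i_def using nn by linarith+
      have "(x - p) / \<delta> < real N" using x \<delta> by (simp add: pos_divide_less_eq)
      then have "i < N" using i(1) by linarith
      moreover have "x \<in> J i" using i \<delta>(1) x
        by (simp add: J_def pos_le_divide_eq pos_divide_less_eq)
      ultimately show "x \<in> (\<Union>i<N. J i)" by blast
    qed (auto simp: J_def)
    have part: "(l2norm (mult_proj \<phi> K (E (J i) f)))\<^sup>2 \<le> (\<delta> / \<eta>)\<^sup>2 * (l2norm (E (J i) f))\<^sup>2" for i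
    proof (rule mass_estimate)
      \<comment> \<open>The centre is capped at \<open>q\<close> to stay in \<open>{p..q}\<close>,
        where the distance hypothesis on \<open>K\<close> applies; pieces starting beyond
        \<open>q\<close> are empty.\<close>
      show "J i \<subseteq> {min q (p + real i * \<delta>) - \<delta>..min q (p + real i * \<delta>) + \<delta>}"
        using \<delta>(1) by (auto simp: J_def algebra_simps)
      show "\<eta> \<le> \<bar>x - min q (p + real i * \<delta>)\<bar>" if "x \<in> K" for x
        by (rule K(2)[OF that]) (use pq \<delta> in auto)
    qed (use f JM K \<delta> \<eta> in \<open>auto simp: proj_idem\<close>)
    have sum1: "f = (\<lambda>n. \<Sum>i<N. E (J i) f n)"
      using proj_UN[OF f(1) JM Jd, of N] f(2) unfolding cover by simp
    have add: "mult_proj \<phi> K (\<lambda>n. \<Sum>i<M. E (J i) f n) = (\<lambda>n. \<Sum>i<M. mult_proj \<phi> K (E (J i) f) n)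
        \<and> (\<lambda>n. \<Sum>i<M. E (J i) f n) \<in> ell2" for M
    proof (induction M)
      case 0
      show ?case using M.proj_scale[OF K(1) f(1), of 0] by simp
    next
      case (Suc M)
      then show ?case using M.proj_add[OF K(1), of "\<lambda>n. \<Sum>i<M. E (J i) f n" "E (J M) f"] f JM by simp
    qed
    have "mult_proj \<phi> K f = (\<lambda>n. \<Sum>i<N. mult_proj \<phi> K (E (J i) f) n)"
      using add[of N] sum1 by simp
    then have "(l2norm (mult_proj \<phi> K f))\<^sup>2 \<le> real N * (\<Sum>i<N. (l2norm (mult_proj \<phi> K (E (J i) f)))\<^sup>2)"
      using l2norm_sum_le[of "\<lambda>i. mult_proj \<phi> K (E (J i) f)" N] f JM K by simp
    also have "\<dots> \<le> real N * (\<Sum>i<N. (\<delta> / \<eta>)\<^sup>2 * (l2norm (E (J i) f))\<^sup>2)"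
      by (intro mult_left_mono sum_mono part) simp
    also have "\<dots> = real N * (\<delta> / \<eta>)\<^sup>2 * (\<Sum>i<N. (l2norm (E (J i) f))\<^sup>2)"
      by (simp add: sum_distrib_left mult.assoc)
    also have "(\<Sum>i<N. (l2norm (E (J i) f))\<^sup>2) = (l2norm f)\<^sup>2"
    proof -
      interpret finite_measure "scalar_measure E f" by (rule finite_scalar_measure[OF f(1)])
      have "measure (scalar_measure E f) (\<Union>i<N. J i) = (\<Sum>i<N. measure (scalar_measure E f) (J i))"
        by (rule finite_measure_finite_Union)
           (use JM Jd f(1) in \<open>auto simp: sets_scalar_measure disjoint_family_on_def\<close>)
      then show ?thesis unfolding cover using f JM by (simp add: measure_scalar_measure)
    qed
    also have "real N * (\<delta> / \<eta>)\<^sup>2 * (l2norm f)\<^sup>2 = ((q - p + 1) / \<eta>)\<^sup>2 * (l2norm f)\<^sup>2 * inverse (real N)"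
    proof -
      have "real N * (s / real N / \<eta>)\<^sup>2 * F = (s / \<eta>)\<^sup>2 * F * inverse (real N)" for s F :: real
        using N \<eta> by (simp add: power2_eq_square field_simps)
      then show ?thesis unfolding \<delta>_def .
    qed
    finally show ?thesis .
  qed
  have "(\<lambda>N. ((q - p + 1) / \<eta>)\<^sup>2 * (l2norm f)\<^sup>2 * inverse (real N)) \<longlonglongrightarrow> ((q - p + 1) / \<eta>)\<^sup>2 * (l2norm f)\<^sup>2 * 0"
    by (intro tendsto_mult tendsto_const lim_inverse_n)
  then have "(l2norm (mult_proj \<phi> K f))\<^sup>2 \<le> ((q - p + 1) / \<eta>)\<^sup>2 * (l2norm f)\<^sup>2 * 0"
    by (rule LIMSEQ_le_const) (use bound in \<open>auto intro!: exI[of _ 1]\<close>)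
  then have "l2norm (mult_proj \<phi> K f) = 0" by simp
  then show ?thesis using l2norm_eq_0[of "mult_proj \<phi> K f"] f K by simp
qed

text \<open>The sets \<open>K m\<close> exhaust the complement of \<open>{p..q}\<close> and each
  keeps a positive distance from it, so \<open>g\<close> vanishes almost everywhere on the set where
  \<phi> lies outside \<open>{p..q}\<close>.\<close>

lemma mult_proj_interval_fixed:
  assumes f: "f \<in> ell2" "E {p..q} f = f" and pq: "p \<le> q"
  shows "mult_proj \<phi> {p..q} f = f"
proof -
  obtain g where g: "g \<in> L2 torus" "f = inv_fourier g" using f(1) by (rule ell2_cases)
  have gm: "g \<in> borel_measurable torus" using g(1) by (rule L2_measurable)
  define K where "K m = {..< p - inverse (real (Suc m))} \<union> {q + inverse (real (Suc m))<..}" for m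
  have KM: "K m \<in> sets borel" for m unfolding K_def by auto
  have "AE x in torus. indicator (K m) (\<phi> x) * g x = 0" for m
  proof -
    have "mult_proj \<phi> (K m) f = (\<lambda>n. 0)"
    proof (rule mult_proj_disjoint_interval[OF f pq])
      show "inverse (real (Suc m)) \<le> \<bar>x - y\<bar>" if "x \<in> K m" "y \<in> {p..q}" for x y
        using that unfolding K_def by auto
    qed (use KM in auto)
    then have eq: "inv_fourier (\<lambda>\<theta>. indicator (K m) (\<phi> \<theta>) * g \<theta>) = inv_fourier (\<lambda>_. 0)"
      unfolding g(2) mult_proj_inv_fourier[OF \<phi> g(1) KM] inv_fourier_zero .
    show ?thesis by (rule inv_fourier_inj[OF indicator_symbol_L2[OF \<phi> g(1) KM] L2_zero eq])
  qed
  then have "AE x in torus. \<forall>m. indicator (K m) (\<phi> x) * g x = 0" unfolding AE_all_countable by blast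
  then have ae: "AE x in torus. indicator {p..q} (\<phi> x) * g x = g x"
  proof eventually_elim
    case (elim x)
    show ?case
    proof (cases "\<phi> x \<in> {p..q}")
      case False
      then have "0 < (if \<phi> x < p then p - \<phi> x else \<phi> x - q)" by auto
      then obtain m where "inverse (real (Suc m)) < (if \<phi> x < p then p - \<phi> x else \<phi> x - q)"
        using reals_Archimedean by blast
      then have "\<phi> x \<in> K m" using False by (auto simp: K_def split: if_splits)
      then show ?thesis using elim[rule_format, of m] by simp
    qed simp
  qed
  have "mult_proj \<phi> {p..q} f = inv_fourier (\<lambda>\<theta>. indicator {p..q} (\<phi> \<theta>) * g \<theta>)"
    unfolding g(2) by (rule mult_proj_inv_fourier[OF \<phi> g(1)]) simp
  also have "\<dots> = f"
    unfolding g(2) using L2_measurable[OF indicator_symbol_L2[OF \<phi> g(1)], of "{p..q}"] gm ae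
    by (intro inv_fourier_cong_AE) auto
  finally show ?thesis .
qed

text \<open>The complement of \<open>{a..b}\<close> is a countable union of compact intervals, each
  at positive distance from \<open>{a..b}\<close>. Finite unions are handled by
  \<open>mult_proj_disjoint_interval\<close>, and continuity from below of the scalar measure gives
  the limit.\<close>

lemma mult_proj_interval_Compl:
  assumes f: "f \<in> ell2" "E (- {a..b}) f = f" and ab: "a \<le> b"
  shows "mult_proj \<phi> {a..b} f = (\<lambda>n. 0)"
proof -
  have "open (- {a..b})" by auto
  then obtain \<D> where D: "countable \<D>" "\<D> \<subseteq> Pow (- {a..b})" "\<And>X. X \<in> \<D> \<Longrightarrow> \<exists>p q. X = cbox p q" "\<Union>\<D> = - {a..b}"
    using open_countable_Union_open_cbox by metis
  have ne: "\<D> \<noteq> {}"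
  proof
    assume "\<D> = {}"
    moreover have "b + 1 \<in> \<Union>\<D>" unfolding D(4) by simp
    ultimately show False by simp
  qed
  define C where "C = from_nat_into \<D>"
  have CD: "C i \<in> \<D>" for i unfolding C_def using ne by (rule from_nat_into)
  have CU: "(\<Union>i. C i) = - {a..b}" using D(1,4) ne range_from_nat_into[of \<D>] by (simp add: C_def)
  have CM: "C i \<in> sets borel" for i using D(3)[OF CD[of i]] by auto
  define W where "W N = (\<Union>i<N. C i)" for N
  have WM: "W N \<in> sets borel" for N unfolding W_def using CM by auto
  \<comment> \<open>Formulated for Borel subsets of \<open>C i\<close>, since the union is made
    disjoint by removing \<open>W N\<close> from \<open>C N\<close>.\<close>
  have zero_C: "mult_proj \<phi> {a..b} (E S h) = (\<lambda>n. 0)" if S: "S \<in> sets borel" "S \<subseteq> C i" and h: "h \<in> ell2" for S i h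
  proof -
    obtain p q where pq: "C i = {p..q}" using D(3)[OF CD[of i]] by auto
    have sub: "{p..q} \<subseteq> - {a..b}" using D(2) CD[of i] pq by auto
    show ?thesis
    proof (cases "p \<le> q")
      case False
      then have "S = {}" using S pq by auto
      then show ?thesis using M.proj_scale[of "{a..b}" h 0] h by (simp add: proj_empty)
    next
      case True
      have sep: "q < a \<or> b < p"
      proof (rule ccontr)
        assume "\<not> (q < a \<or> b < p)"
        then have "max a p \<in> {p..q} \<inter> {a..b}" using True ab by auto
        then show False using sub by blast
      qed
      define \<eta> where "\<eta> = (if q < a then a - q else p - b)"
      have "E {p..q} (E S h) = E S h" using S pq h by (simp add: proj_Int Int_absorb1)
      then show ?thesis
        by (rule mult_proj_disjoint_interval[where \<eta> = \<eta>, rotated])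
           (use S h sep True in \<open>auto simp: \<eta>_def split: if_splits\<close>)
    qed
  qed
  have zero_W: "mult_proj \<phi> {a..b} (E (W N) f) = (\<lambda>n. 0)" for N
  proof (induction N)
    case 0
    then show ?case using M.proj_scale[of "{a..b}" f 0] f by (simp add: W_def proj_empty)
  next
    case (Suc N)
    have eq: "W (Suc N) = W N \<union> (C N - W N)" by (auto simp: W_def less_Suc_eq)
    have "E (W (Suc N)) f = (\<lambda>n. E (W N) f n + E (C N - W N) f n)"
      unfolding eq by (rule proj_Un) (use f WM CM in auto)
    then show ?case
      using Suc zero_C[of "C N - W N" N f] f WM CM by (simp add: M.proj_add sets.Diff)
  qed
  interpret finite_measure "scalar_measure E f" by (rule finite_scalar_measure[OF f(1)])
  have "(\<lambda>N. measure (scalar_measure E f) (W N)) \<longlonglongrightarrow> measure (scalar_measure E f) (\<Union>N. W N)"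
  proof (rule finite_Lim_measure_incseq)
    show "incseq W" unfolding W_def by (intro monoI UN_mono) auto
  qed (use WM f in \<open>auto simp: sets_scalar_measure\<close>)
  moreover have "(\<Union>N. W N) = - {a..b}" unfolding CU[symmetric] W_def by auto
  ultimately have lim: "(\<lambda>N. (l2norm (E (W N) f))\<^sup>2) \<longlonglongrightarrow> (l2norm f)\<^sup>2"
    using f WM by (simp add: measure_scalar_measure)
  have le: "(l2norm (mult_proj \<phi> {a..b} f))\<^sup>2 \<le> (l2norm f)\<^sup>2 - (l2norm (E (W N) f))\<^sup>2" for N
  proof -
    have W': "- W N \<in> sets borel" using WM[of N] by (rule borel_comp)
    have "mult_proj \<phi> {a..b} f = (\<lambda>n. mult_proj \<phi> {a..b} (E (W N) f) n + mult_proj \<phi> {a..b} (E (- W N) f) n)"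
      using M.proj_add[of "{a..b}" "E (W N) f" "E (- W N) f"] proj_Compl[OF f(1) WM[of N]] f WM W' by simp
    then have "mult_proj \<phi> {a..b} f = mult_proj \<phi> {a..b} (E (- W N) f)" using zero_W by simp
    then have "(l2norm (mult_proj \<phi> {a..b} f))\<^sup>2 \<le> (l2norm (E (- W N) f))\<^sup>2"
      using M.l2norm_proj_le[of "E (- W N) f" "{a..b}"] f W' by simp
    then show ?thesis using l2norm_proj_Compl[OF f(1) WM[of N]] by linarith
  qed
  have "(\<lambda>N. (l2norm f)\<^sup>2 - (l2norm (E (W N) f))\<^sup>2) \<longlonglongrightarrow> (l2norm f)\<^sup>2 - (l2norm f)\<^sup>2"
    by (intro tendsto_diff tendsto_const lim)
  then have "(l2norm (mult_proj \<phi> {a..b} f))\<^sup>2 \<le> (l2norm f)\<^sup>2 - (l2norm f)\<^sup>2"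
    by (rule LIMSEQ_le_const) (use le in auto)
  then show ?thesis using l2norm_eq_0[of "mult_proj \<phi> {a..b} f"] f by simp
qed

lemma proj_interval_unique:
  assumes f: "f \<in> ell2" and ab: "a \<le> b"
  shows "E {a..b} f = mult_proj \<phi> {a..b} f"
proof -
  let ?I = "{a..b}"
  have I: "?I \<in> sets borel" "- ?I \<in> sets borel" by auto
  have 1: "mult_proj \<phi> ?I (E ?I f) = E ?I f"
    by (rule mult_proj_interval_fixed) (use f I ab in \<open>auto simp: proj_idem\<close>)
  have 2: "mult_proj \<phi> ?I (E (- ?I) f) = (\<lambda>n. 0)"
    by (rule mult_proj_interval_Compl) (use f I ab in \<open>auto simp: proj_idem\<close>)
  have "mult_proj \<phi> ?I f = (\<lambda>n. mult_proj \<phi> ?I (E ?I f) n + mult_proj \<phi> ?I (E (- ?I) f) n)"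
    using M.proj_add[of ?I "E ?I f" "E (- ?I) f"] proj_Compl[OF f I(1)] f I by simp
  then show ?thesis using 1 2 by simp
qed

end

lemma spectral_proj_fourier_mult:
  assumes \<phi>: "\<phi> \<in> borel_measurable torus" and f: "f \<in> ell2" and ab: "a \<le> b"
  shows "spectral_proj (fourier_mult \<phi>) {a..b} f = mult_proj \<phi> {a..b} f"
proof -
  have s: "is_spectral_measure (fourier_mult \<phi>) (spectral_proj (fourier_mult \<phi>))"
    unfolding spectral_proj_def by (rule someI[of _ "mult_proj \<phi>"]) (rule is_spectral_measure_mult_proj[OF \<phi>])
  interpret multiplier_pvm "spectral_proj (fourier_mult \<phi>)" \<phi>
    using s \<phi> unfolding is_spectral_measure_def by unfold_locales auto
  show ?thesis by (rule proj_interval_unique[OF f ab])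
qed

section \<open>The conjugate operator on the lattice\<close>

definition fin_supp :: "(int^'d \<Rightarrow> complex) \<Rightarrow> bool" where
  "fin_supp f \<longleftrightarrow> finite {n. f n \<noteq> 0}"

text \<open>The lattice form of multiplication by \<open>cos_sym j\<close>, that is by
  \<open>(1 + cos \<theta>_j) / 2\<close>.\<close>

definition cos_op :: "'d \<Rightarrow> (int^'d \<Rightarrow> complex) \<Rightarrow> (int^'d \<Rightarrow> complex)" where
  "cos_op j f n = f n / 2 + f (n + axis j 1) / 4 + f (n - axis j 1) / 4"

definition iconj :: "real^'d \<Rightarrow> (int^'d \<Rightarrow> complex) \<Rightarrow> (int^'d \<Rightarrow> complex)" where
  "iconj r f n = \<i> * conj_op_pre r f n"

text \<open>The term 3/2 arises because the first summand evaluates \<open>Q_l + 1/2\<close> at the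
  shifted point \<open>n + axis l 1\<close>; in the second summand it is evaluated at
  \<open>n\<close>.\<close>

lemma iconj_eq:
  "iconj r f n = (\<Sum>l\<in>UNIV. of_real (sign (r $ l)) / 2 *
     ((of_int (n $ l) + 3 / 2) * f (n + axis l 1) - (of_int (n $ l) + 1 / 2) * f (n - axis l 1)))"
  unfolding iconj_def conj_op_pre_def sum_distrib_left
  by (rule sum.cong) (auto simp: shift_def shift_adj_def position_half_def axis_def field_simps)

lemma cos_op_add: "cos_op j (\<lambda>n. f n + g n) = (\<lambda>n. cos_op j f n + cos_op j g n)"
  by (rule ext) (simp add: cos_op_def field_simps)

lemma cos_op_scale: "cos_op j (\<lambda>n. c * f n) = (\<lambda>n. c * cos_op j f n)"
  by (rule ext) (simp add: cos_op_def field_simps)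

text \<open>The discrete image of \<open>sin \<theta> d/d\<theta>\<close> acting on
  \<open>t = (1 + cos \<theta>) / 2\<close>, as \<open>sin^2 = 4 t (1 - t)\<close>. The summands
  with \<open>l \<noteq> j\<close> commute with \<open>cos_op j\<close>.\<close>

lemma cos_op_commutator:
  fixes f :: "int^'d \<Rightarrow> complex"
  shows "cos_op j (iconj r f) n = iconj r (cos_op j f) n - 2 * of_real (sign (r $ j)) * (cos_op j f n - cos_op j (cos_op j f) n)"
proof -
  let ?K = "\<lambda>l f n. of_real (sign (r $ l)) / 2 *
     ((of_int (n $ l) + 3 / 2) * f (n + axis l 1) - (of_int (n $ l) + 1 / 2) * f (n - axis l 1) :: complex)"
  have "cos_op j (iconj r f) n - iconj r (cos_op j f) n = (\<Sum>l\<in>UNIV. cos_op j (?K l f) n - ?K l (cos_op j f) n)"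
    by (simp add: cos_op_def iconj_eq sum.distrib sum_subtractf sum_divide_distrib)
  also have "\<dots> = (\<Sum>l\<in>UNIV. if l = j then - 2 * of_real (sign (r $ j)) * (cos_op j f n - cos_op j (cos_op j f) n) else 0)"
  proof (rule sum.cong, simp)
    fix l :: 'd
    show "cos_op j (?K l f) n - ?K l (cos_op j f) n =
      (if l = j then - 2 * of_real (sign (r $ j)) * (cos_op j f n - cos_op j (cos_op j f) n) else 0)"
    proof (cases "l = j")
      case True
      have sh: "n + axis j 1 - axis j 1 = n" "n - axis j 1 + axis j 1 = n" for n :: "int^'d" by simp_all
      have ax: "(axis j 1 :: int^'d) $ j = 1" by (simp add: axis_def)
      show ?thesis unfolding True by (simp add: cos_op_def sh ax) (simp add: field_simps)
    next
      case False
      have ax: "(axis j 1 :: int^'d) $ l = 0" using False by (simp add: axis_def)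
      show ?thesis using False by (simp add: cos_op_def ax) (simp add: field_simps)
    qed
  qed
  finally show ?thesis by (simp add: algebra_simps)
qed

text \<open>Leibniz rule by induction; this works because the commutator of \<open>cos_op j\<close>
  is itself a polynomial in \<open>cos_op j\<close>. The factors \<open>(-1)\<close> let
  \<open>cos_op_add\<close> and \<open>cos_op_scale\<close> rewrite the difference.\<close>

lemma cos_op_power_commutator:
  "(cos_op j ^^ k) (iconj r f) = (\<lambda>n. iconj r ((cos_op j ^^ k) f) n
     + (- 2 * of_real (sign (r $ j)) * of_nat k) * ((cos_op j ^^ k) f n + (-1) * (cos_op j ^^ Suc k) f n))"
proof (induction k)
  case (Suc k)
  let ?c = "- 2 * of_real (sign (r $ j)) :: complex" and ?g = "(cos_op j ^^ k) f"
  have "(cos_op j ^^ Suc k) (iconj r f) = cos_op j ((cos_op j ^^ k) (iconj r f))" by simp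
  also have "\<dots> = (\<lambda>n. cos_op j (iconj r ?g) n
     + (?c * of_nat k) * (cos_op j ?g n + (-1) * cos_op j (cos_op j ?g) n))"
    unfolding Suc.IH cos_op_add cos_op_scale by simp
  also have "\<dots> = (\<lambda>n. iconj r (cos_op j ?g) n + (?c * of_nat (Suc k)) * (cos_op j ?g n + (-1) * cos_op j (cos_op j ?g) n))"
    unfolding cos_op_commutator by (rule ext) (simp add: algebra_simps)
  finally show ?case by simp
qed simp

lemma fin_supp_shift: "fin_supp f \<Longrightarrow> fin_supp (\<lambda>n. f (n + a))"
proof -
  assume "fin_supp f"
  then have "finite ((\<lambda>n. n - a) ` {n. f n \<noteq> 0})" by (simp add: fin_supp_def)
  then show ?thesis unfolding fin_supp_def by (rule finite_subset[rotated]) (auto simp: image_iff intro!: exI[of _ "_ + a"])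
qed

lemma fin_supp_shift_minus: "fin_supp f \<Longrightarrow> fin_supp (\<lambda>n. f (n - a))"
  using fin_supp_shift[of f "- a"] by simp

lemma fin_supp_mult: "fin_supp f \<Longrightarrow> fin_supp (\<lambda>n. c n * f n)"
  unfolding fin_supp_def by (erule finite_subset[rotated]) auto

lemma fin_supp_mult_right: "fin_supp f \<Longrightarrow> fin_supp (\<lambda>n. f n * c n)"
  unfolding fin_supp_def by (erule finite_subset[rotated]) auto

lemma fin_supp_add: "fin_supp f \<Longrightarrow> fin_supp g \<Longrightarrow> fin_supp (\<lambda>n. f n + g n)"
  unfolding fin_supp_def by (rule finite_subset[of _ "{n. f n \<noteq> 0} \<union> {n. g n \<noteq> 0}"]) auto

lemma fin_supp_diff: "fin_supp f \<Longrightarrow> fin_supp g \<Longrightarrow> fin_supp (\<lambda>n. f n - g n)"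
  unfolding fin_supp_def by (rule finite_subset[of _ "{n. f n \<noteq> 0} \<union> {n. g n \<noteq> 0}"]) auto

lemma fin_supp_sum: "(\<And>i. i \<in> I \<Longrightarrow> fin_supp (f i)) \<Longrightarrow> fin_supp (\<lambda>n. \<Sum>i\<in>I. f i n)"
proof (induction I rule: infinite_finite_induct)
  case (insert x F)
  then show ?case by (simp add: fin_supp_add)
qed (auto simp: fin_supp_def)

lemma fin_supp_iconj: "fin_supp f \<Longrightarrow> fin_supp (iconj r f)"
  unfolding iconj_eq[abs_def]
  by (intro fin_supp_sum fin_supp_mult fin_supp_diff fin_supp_shift fin_supp_shift_minus)

lemma fin_supp_cos_op: "fin_supp f \<Longrightarrow> fin_supp (cos_op j f)"
  unfolding cos_op_def[abs_def] divide_inverse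
  by (intro fin_supp_mult_right fin_supp_add fin_supp_shift fin_supp_shift_minus)

lemma fin_supp_cos_op_power: "fin_supp f \<Longrightarrow> fin_supp ((cos_op j ^^ k) f)"
  by (induction k) (auto intro: fin_supp_cos_op)

lemma fin_supp_summable: "fin_supp f \<Longrightarrow> f summable_on UNIV"
  unfolding fin_supp_def by (rule finite_nonzero_values_imp_summable_on) simp

lemma fin_supp_ell2: "fin_supp f \<Longrightarrow> f \<in> ell2"
  unfolding fin_supp_def ell2_def by (auto intro!: finite_nonzero_values_imp_summable_on)

lemma ip_sum_right:
  assumes "\<And>l. l \<in> I \<Longrightarrow> fin_supp (f l)"
  shows "ip u (\<lambda>n. \<Sum>l\<in>I. f l n) = (\<Sum>l\<in>I. ip u (f l))"
  using assms
proof (induction I rule: infinite_finite_induct)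
  case (insert x F)
  have "ip u (\<lambda>n. f x n + (\<Sum>l\<in>F. f l n)) = ip u (f x) + ip u (\<lambda>n. \<Sum>l\<in>F. f l n)"
    unfolding ip_def distrib_left
    by (rule infsum_add) (use insert in \<open>auto intro!: fin_supp_summable fin_supp_mult fin_supp_sum\<close>)
  then show ?case using insert by simp
qed (auto simp: ip_def)

lemma ip_sum_left:
  fixes u :: "int^'d \<Rightarrow> complex"
  assumes "\<And>l. l \<in> I \<Longrightarrow> fin_supp (f l)"
  shows "ip (\<lambda>n. \<Sum>l\<in>I. f l n) u = (\<Sum>l\<in>I. ip (f l) u)"
proof -
  have cc: "cnj (ip f g) = ip g f" for f g :: "int^'d \<Rightarrow> complex"
    unfolding ip_def infsum_cnj[symmetric] by (rule infsum_cong) (simp add: mult.commute)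
  have "ip (\<lambda>n. \<Sum>l\<in>I. f l n) u = cnj (ip u (\<lambda>n. \<Sum>l\<in>I. f l n))" by (rule cc[symmetric])
  also have "ip u (\<lambda>n. \<Sum>l\<in>I. f l n) = (\<Sum>l\<in>I. ip u (f l))" by (rule ip_sum_right[OF assms])
  also have "cnj \<dots> = (\<Sum>l\<in>I. ip (f l) u)" by (simp add: cc)
  finally show ?thesis .
qed

lemma infsum_shift: "(\<Sum>\<^sub>\<infinity>n. F (n + a)) = (\<Sum>\<^sub>\<infinity>n. F n)" for F :: "int^'d \<Rightarrow> complex"
proof (rule infsum_reindex_bij_betw)
  show "bij_betw (\<lambda>n. n + a) UNIV UNIV"
    by (rule bij_betw_byWitness[where f' = "\<lambda>n. n - a"]) auto
qed

text \<open>Translating the summation index exchanges the forward and backward shifts and turns the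
  coefficient \<open>n_l + 3/2\<close> into \<open>n_l + 1/2\<close> and conversely, so the two
  halves change places with a sign.\<close>

lemma iconj_antisym:
  fixes u w :: "int^'d \<Rightarrow> complex"
  assumes u: "fin_supp u" and w: "fin_supp w"
  shows "ip u (iconj r w) = - ip (iconj r u) w"
proof -
  define K where "K l f n = of_real (sign (r $ l)) / 2 *
     ((of_int (n $ l) + 3 / 2) * f (n + axis l 1) - (of_int (n $ l) + 1 / 2) * f (n - axis l 1))"
    for l and f :: "int^'d \<Rightarrow> complex" and n :: "int^'d"
  have fK: "fin_supp (K l f)" if "fin_supp f" for l f
    unfolding K_def[abs_def] using that by (intro fin_supp_mult fin_supp_diff fin_supp_shift fin_supp_shift_minus)
  have diff: "(\<Sum>\<^sub>\<infinity>n. A n - B n) = (\<Sum>\<^sub>\<infinity>n. A n) - (\<Sum>\<^sub>\<infinity>n. B n)"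
    if "A summable_on UNIV" "B summable_on UNIV" for A B :: "int^'d \<Rightarrow> complex"
    using infsum_add[OF that(1), of "\<lambda>n. - B n"] that(2) by (simp add: summable_on_uminus infsum_uminus)
  have one: "ip u (K l w) = - ip (K l u) w" for l
  proof -
    let ?s = "of_real (sign (r $ l)) / 2 :: complex"
    let ?e = "axis l 1 :: int^'d"
    define A1 A2 B1 B2 where "A1 n = cnj (u n) * ((of_int (n $ l) + 3 / 2) * w (n + ?e))"
      and "A2 n = cnj (u n) * ((of_int (n $ l) + 1 / 2) * w (n - ?e))"
      and "B1 n = cnj (u (n + ?e)) * ((of_int (n $ l) + 3 / 2) * w n)"
      and "B2 n = cnj (u (n - ?e)) * ((of_int (n $ l) + 1 / 2) * w n)" for n
    have s: "A1 summable_on UNIV" "A2 summable_on UNIV" "B1 summable_on UNIV" "B2 summable_on UNIV"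
      unfolding A1_def[abs_def] A2_def[abs_def] B1_def[abs_def] B2_def[abs_def]
      using w by (auto intro!: fin_supp_summable fin_supp_mult fin_supp_shift fin_supp_shift_minus)
    have ax: "?e $ l = 1" by (simp add: axis_def)
    have e1: "(\<Sum>\<^sub>\<infinity>n. A1 n) = (\<Sum>\<^sub>\<infinity>n. B2 n)"
    proof -
      have "A1 = (\<lambda>n. B2 (n + ?e))" by (rule ext) (simp add: A1_def B2_def ax algebra_simps)
      then show ?thesis using infsum_shift[of B2 ?e] by (simp only:)
    qed
    have e2: "(\<Sum>\<^sub>\<infinity>n. A2 n) = (\<Sum>\<^sub>\<infinity>n. B1 n)"
    proof -
      have "B1 = (\<lambda>n. A2 (n + ?e))" by (rule ext) (simp add: A2_def B1_def ax algebra_simps)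
      then show ?thesis using infsum_shift[of A2 ?e] by (simp only:)
    qed
    have "ip u (K l w) = (\<Sum>\<^sub>\<infinity>n. ?s * (A1 n - A2 n))"
      unfolding ip_def by (rule infsum_cong) (simp add: K_def A1_def A2_def algebra_simps)
    also have "\<dots> = ?s * ((\<Sum>\<^sub>\<infinity>n. A1 n) - (\<Sum>\<^sub>\<infinity>n. A2 n))"
      unfolding infsum_cmult_right' by (simp only: diff s)
    also have "\<dots> = - (?s * ((\<Sum>\<^sub>\<infinity>n. B1 n) - (\<Sum>\<^sub>\<infinity>n. B2 n)))"
      unfolding e1 e2 by (simp only: mult_minus_right[symmetric] minus_diff_eq)
    also have "?s * ((\<Sum>\<^sub>\<infinity>n. B1 n) - (\<Sum>\<^sub>\<infinity>n. B2 n)) = (\<Sum>\<^sub>\<infinity>n. ?s * (B1 n - B2 n))"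
      unfolding infsum_cmult_right' by (simp only: diff s)
    also have "\<dots> = ip (K l u) w"
      unfolding ip_def by (rule infsum_cong) (simp add: K_def B1_def B2_def algebra_simps)
    finally show ?thesis .
  qed
  have iK: "iconj r f = (\<lambda>n. \<Sum>l\<in>UNIV. K l f n)" for f
    by (rule ext) (simp add: iconj_eq K_def)
  show ?thesis
    unfolding iK using ip_sum_right[of UNIV "\<lambda>l. K l w" u] ip_sum_left[of UNIV "\<lambda>l. K l u" w] fK u w one
    by (simp add: sum_negf)
qed

section \<open>The closure of the conjugate operator\<close>

lemma conj_op_cases:
  assumes "(u, a) \<in> conj_op r"
  obtains F where "\<And>k. fin_supp (F k)" "l2_lim F u" "l2_lim (\<lambda>k. conj_op_pre r (F k)) a" "u \<in> ell2" "a \<in> ell2"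
proof -
  from assms obtain F G where FG: "\<And>k. (F k, G k) \<in> {(f, conj_op_pre r f) | f. finite {n. f n \<noteq> 0}}"
    "l2_lim F u" "l2_lim G a" "u \<in> ell2" "a \<in> ell2"
    unfolding conj_op_def op_closure_def by blast
  then have "fin_supp (F k)" "G k = conj_op_pre r (F k)" for k using FG(1)[of k] by (auto simp: fin_supp_def)
  then have "G = (\<lambda>k. conj_op_pre r (F k))" by auto
  then show ?thesis using that[of F] FG \<open>\<And>k. fin_supp (F k)\<close> by simp
qed

lemma fin_supp_conj_op_pre: "fin_supp f \<Longrightarrow> fin_supp (conj_op_pre r f)"
proof -
  have "conj_op_pre r f = (\<lambda>n. - \<i> * iconj r f n)" by (rule ext) (simp add: iconj_def)
  then show "fin_supp f \<Longrightarrow> fin_supp (conj_op_pre r f)" by (simp only:) (intro fin_supp_mult fin_supp_iconj)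
qed

lemma L2lim_fourier:
  fixes F :: "nat \<Rightarrow> int^'d \<Rightarrow> complex"
  assumes "\<And>k. F k \<in> ell2" "f \<in> ell2" "l2_lim F f"
  shows "L2lim torus (\<lambda>k. fourier (F k)) (fourier f)"
  using l2_lim_inv_fourier[of "\<lambda>k. fourier (F k)" "fourier f"] assms by (simp add: fourier_L2 inv_fourier_fourier)

lemma ip_l2_lim:
  fixes F G :: "nat \<Rightarrow> int^'d \<Rightarrow> complex"
  assumes "\<And>k. F k \<in> ell2" "\<And>k. G k \<in> ell2" "f \<in> ell2" "g \<in> ell2" "l2_lim F f" "l2_lim G g"
  shows "(\<lambda>k. ip (F k) (G k)) \<longlonglongrightarrow> ip f g"
proof -
  have ip: "ip a b = inn torus (fourier a) (fourier b)" if "a \<in> ell2" "b \<in> ell2" for a b :: "int^'d \<Rightarrow> complex"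
    using ip_inv_fourier[OF fourier_L2[OF that(1)] fourier_L2[OF that(2)]] that by (simp add: inv_fourier_fourier)
  have "(\<lambda>k. inn torus (fourier (F k)) (fourier (G k))) \<longlonglongrightarrow> inn torus (fourier f) (fourier g)"
    by (rule L2lim_inn) (use assms in \<open>auto simp: fourier_L2 L2lim_fourier\<close>)
  then show ?thesis using assms by (simp add: ip)
qed

lemma l2_lim_const [simp]: "l2_lim (\<lambda>_. f) f"
  by (simp add: l2_lim_def l2norm_def)

lemma l2_lim_scale: "l2_lim F f \<Longrightarrow> l2_lim (\<lambda>k n. c * F k n) (\<lambda>n. c * f n)"
proof -
  assume "l2_lim F f"
  then have "(\<lambda>k. cmod c * l2norm (\<lambda>n. F k n - f n)) \<longlonglongrightarrow> cmod c * 0"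
    unfolding l2_lim_def by (intro tendsto_mult tendsto_const)
  then show ?thesis unfolding l2_lim_def right_diff_distrib[symmetric] l2norm_scale by simp
qed

lemma fin_supp_conj_op:
  assumes "fin_supp f"
  shows "(f, conj_op_pre r f) \<in> conj_op r"
proof -
  have "(f, conj_op_pre r f) \<in> {(f, conj_op_pre r f) | f. finite {n. f n \<noteq> 0}}"
    using assms unfolding fin_supp_def by blast
  then have "\<exists>F G. (\<forall>k::nat. (F k, G k) \<in> {(f, conj_op_pre r f) | f. finite {n. f n \<noteq> 0}}) \<and>
      l2_lim F f \<and> l2_lim G (conj_op_pre r f)"
    by (intro exI[of _ "\<lambda>_. f"] exI[of _ "\<lambda>_. conj_op_pre r f"] conjI allI l2_lim_const)
  then show ?thesis
    unfolding conj_op_def op_closure_def using fin_supp_ell2[OF assms] fin_supp_ell2[OF fin_supp_conj_op_pre[OF assms]] by blast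
qed

text \<open>Closability: pairing with a finitely supported \<open>w\<close> moves the operator onto
  \<open>w\<close>, so \<open>u\<close> determines all pairings of \<open>a\<close>, and point
  masses recover \<open>a\<close>. Without this \<open>app (conj_op r)\<close> would have no defined
  value.\<close>

lemma conj_op_single_valued:
  fixes r :: "real^'d"
  assumes a: "(u, a) \<in> conj_op r" and b: "(u, b) \<in> conj_op r"
  shows "a = b"
proof -
  have key: "ip w (\<lambda>n. \<i> * a n) = - ip (iconj r w) u" if "(u, a) \<in> conj_op r" and w: "fin_supp w" for w a :: "int^'d \<Rightarrow> complex"
  proof -
    from that(1) obtain F where F: "\<And>k. fin_supp (F k)" "l2_lim F u" "l2_lim (\<lambda>k. conj_op_pre r (F k)) a" "u \<in> ell2" "a \<in> ell2"
      by (rule conj_op_cases) blast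
    have "(\<lambda>k. ip w (iconj r (F k))) \<longlonglongrightarrow> ip w (\<lambda>n. \<i> * a n)"
      by (rule ip_l2_lim)
         (use F w l2_lim_scale[OF F(3), of \<i>] in \<open>auto simp: fin_supp_ell2 fin_supp_iconj iconj_def[abs_def] fin_supp_conj_op_pre fin_supp_mult\<close>)
    moreover have "(\<lambda>k. - ip (iconj r w) (F k)) \<longlonglongrightarrow> - ip (iconj r w) u"
      by (intro tendsto_minus ip_l2_lim) (use F w in \<open>auto simp: fin_supp_ell2 fin_supp_iconj\<close>)
    ultimately show ?thesis
      using iconj_antisym[OF w F(1)] by (simp add: LIMSEQ_unique)
  qed
  show ?thesis
  proof
    fix m :: "int^'d"
    define w where "w = (\<lambda>n. if n = m then 1 else 0 :: complex)"
    have w: "fin_supp w" by (simp add: fin_supp_def w_def)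
    have d: "ip w f = f m" for f :: "int^'d \<Rightarrow> complex"
    proof -
      have "ip w f = (\<Sum>\<^sub>\<infinity>n\<in>{m}. cnj (w n) * f n)"
        unfolding ip_def by (rule infsum_cong_neutral) (auto simp: w_def)
      then show ?thesis by (simp add: w_def)
    qed
    have "\<i> * a m = \<i> * b m" using key[OF a w] key[OF b w] unfolding d by simp
    then show "a m = b m" by simp
  qed
qed

lemma app_conj_op: "(u, a) \<in> conj_op r \<Longrightarrow> app (conj_op r) u = a"
  unfolding app_def by (rule the_equality) (auto intro: conj_op_single_valued)

definition cos_sym :: "'d \<Rightarrow> real^'d \<Rightarrow> real" where
  "cos_sym j \<theta> = (1 + cos (\<theta> $ j)) / 2"

lemma cos_sym_bounds: "0 \<le> cos_sym j \<theta>" "cos_sym j \<theta> \<le> 1"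
proof -
  have *: "0 \<le> (1 + x) / 2" "(1 + x) / 2 \<le> 1" if "- 1 \<le> x" "x \<le> 1" for x :: real using that by auto
  show "0 \<le> cos_sym j \<theta>" "cos_sym j \<theta> \<le> 1"
    unfolding cos_sym_def by (rule *[OF cos_ge_minus_one cos_le_one])+
qed

lemma cos_sym_measurable [measurable]: "cos_sym j \<in> borel_measurable torus"
  unfolding cos_sym_def by (rule borel_measurable_torus) measurable

lemma inv_fourier_shift:
  "inv_fourier g (n + m) = inv_fourier (\<lambda>\<theta>. cis (phase m \<theta>) * g \<theta>) n"
  unfolding inv_fourier_eq inn_def
  by (rule Bochner_Integration.integral_cong) (auto simp: fourier_basis_def phase_add cis_cnj cis_mult[symmetric] mult_ac)

lemma cos_op_inv_fourier:
  assumes g: "g \<in> L2 torus"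
  shows "cos_op j (inv_fourier g) = inv_fourier (cos_sym j \<odot> g)"
proof
  fix n
  have L: "(\<lambda>\<theta>. cis (phase m \<theta>) * g \<theta>) \<in> L2 torus" for m
    by (rule L2_bounded_mult[OF g, where C = 1]) (auto intro!: borel_measurable_torus)
  have "cos_op j (inv_fourier g) n = 1/2 * inv_fourier g n + (1/4 * inv_fourier (\<lambda>\<theta>. cis (phase (axis j 1) \<theta>) * g \<theta>) n
      + 1/4 * inv_fourier (\<lambda>\<theta>. cis (phase (- axis j 1) \<theta>) * g \<theta>) n)"
    unfolding inv_fourier_shift[symmetric] by (simp add: cos_op_def)
  also have "\<dots> = inv_fourier (\<lambda>\<theta>. 1/2 * g \<theta> + (1/4 * (cis (phase (axis j 1) \<theta>) * g \<theta>) + 1/4 * (cis (phase (- axis j 1) \<theta>) * g \<theta>))) n"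
    using g L by (simp only: inv_fourier_add inv_fourier_scale L2_add L2_scale)
  also have "(\<lambda>\<theta>. 1/2 * g \<theta> + (1/4 * (cis (phase (axis j 1) \<theta>) * g \<theta>) + 1/4 * (cis (phase (- axis j 1) \<theta>) * g \<theta>))) =
      (cos_sym j \<odot> g)"
  proof
    fix \<theta>
    have "1/2 + (1/4 * cis (\<theta> $ j) + 1/4 * cis (- (\<theta> $ j))) = complex_of_real (cos_sym j \<theta>)"
      by (simp add: complex_eq_iff cos_sym_def)
    from arg_cong[OF this, of "\<lambda>z. z * g \<theta>"]
    show "1/2 * g \<theta> + (1/4 * (cis (phase (axis j 1) \<theta>) * g \<theta>) + 1/4 * (cis (phase (- axis j 1) \<theta>) * g \<theta>)) =
      complex_of_real (cos_sym j \<theta>) * g \<theta>"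
      unfolding phase_axis phase_minus by (simp only: distrib_right mult.assoc)
  qed
  finally show "cos_op j (inv_fourier g) n = inv_fourier (cos_sym j \<odot> g) n" .
qed

lemma L2_unit_mult:
  assumes "g \<in> L2 torus" "m \<in> borel_measurable torus" "\<And>\<theta>. \<bar>m \<theta>\<bar> \<le> 1"
  shows "(m \<odot> g) \<in> L2 torus"
  by (rule L2_bounded_mult[where C = 1]) (use assms in auto)

lemma cos_sym_power_bounds: "\<bar>cos_sym j \<theta> ^ k\<bar> \<le> 1"
  using cos_sym_bounds[of j \<theta>] by (simp add: power_le_one)

lemma cos_op_power_inv_fourier:
  assumes g: "g \<in> L2 torus"
  shows "(cos_op j ^^ k) (inv_fourier g) = inv_fourier (\<lambda>\<theta>. complex_of_real (cos_sym j \<theta> ^ k) * g \<theta>)"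
proof (induction k)
  case (Suc k)
  have "(\<lambda>\<theta>. complex_of_real (cos_sym j \<theta> ^ k) * g \<theta>) \<in> L2 torus"
    by (rule L2_unit_mult[OF g]) (auto simp: cos_sym_power_bounds)
  then show ?case using Suc by (simp add: cos_op_inv_fourier mult.assoc)
qed simp

lemma L2lim_unit_mult:
  assumes "\<And>k. F k \<in> L2 torus" "f \<in> L2 torus" "L2lim torus F f" "m \<in> borel_measurable torus" "\<And>\<theta>. \<bar>m \<theta>\<bar> \<le> 1"
  shows "L2lim torus (\<lambda>k \<theta>. complex_of_real (m \<theta>) * F k \<theta>) (m \<odot> f)"
proof (rule L2lim_dominated_mult[OF assms(1,2) _ _ assms(3), where C = 1])
  show "(m \<odot> F k) \<in> borel_measurable torus" for k
    by (rule L2_measurable[OF L2_unit_mult[OF assms(1,4,5)]])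
  show "(m \<odot> f) \<in> borel_measurable torus"
    by (rule L2_measurable[OF L2_unit_mult[OF assms(2,4,5)]])
  show "AE x in torus. cmod (complex_of_real (m x) * F k x - complex_of_real (m x) * f x) \<le> 1 * cmod (F k x - f x)" for k
    using assms(5) by (intro AE_I2) (auto simp: norm_mult mult_left_le_one_le simp flip: right_diff_distrib)
qed

text \<open>For finitely supported functions this is lattice algebra. Since the powers of
  \<open>cos_sym j\<close> are bounded, each term is continuous in \<open>u\<close>,
  \<open>v\<close>, \<open>a\<close> and \<open>b\<close>, so the identity passes to the
  closure.\<close>

lemma form_identity_power:
  fixes r :: "real^'d" and u v a b :: "int^'d \<Rightarrow> complex"
  assumes u: "(u, a) \<in> conj_op r" and v: "(v, b) \<in> conj_op r"
  shows "inn torus (fourier u) (\<lambda>\<theta>. complex_of_real (cos_sym j \<theta> ^ k) * fourier (\<lambda>n. \<i> * b n) \<theta>)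
      + inn torus (fourier (\<lambda>n. \<i> * a n)) (\<lambda>\<theta>. complex_of_real (cos_sym j \<theta> ^ k) * fourier v \<theta>)
    = of_real (- 2 * sign (r $ j) * real k) *
        inn torus (fourier u) (\<lambda>\<theta>. complex_of_real (cos_sym j \<theta> ^ k - cos_sym j \<theta> ^ Suc k) * fourier v \<theta>)"
proof -
  let ?c = "complex_of_real (- 2 * sign (r $ j) * real k)"
  define t where "t k \<theta> = cos_sym j \<theta> ^ k" for k \<theta>
  have tm: "t k \<in> borel_measurable torus" for k unfolding t_def by measurable
  have tb: "\<bar>t k \<theta>\<bar> \<le> 1" for k \<theta> unfolding t_def by (rule cos_sym_power_bounds)
  have dm: "(\<lambda>\<theta>. t k \<theta> - t (Suc k) \<theta>) \<in> borel_measurable torus" using tm by measurable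
  have db: "\<bar>t k \<theta> - t (Suc k) \<theta>\<bar> \<le> 1" for \<theta>
  proof -
    have "0 \<le> t k \<theta>" "0 \<le> t (Suc k) \<theta>" using cos_sym_bounds[of j \<theta>] by (simp_all add: t_def)
    then show ?thesis using tb[of k \<theta>] tb[of "Suc k" \<theta>] by linarith
  qed
  \<comment> \<open>On finitely supported vectors both sides become inner products with lattice
    powers of \<open>cos_op j\<close>; antisymmetry of \<open>iconj\<close> then cancels the terms
    free of commutators.\<close>
  have fin: "inn torus (fourier x) (t k \<odot> fourier (iconj r y))
      + inn torus (fourier (iconj r x)) (t k \<odot> fourier y)
    = ?c * inn torus (fourier x) (\<lambda>\<theta>. complex_of_real (t k \<theta> - t (Suc k) \<theta>) * fourier y \<theta>)"
    if x: "fin_supp x" and y: "fin_supp y" for x y :: "int^'d \<Rightarrow> complex"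
  proof -
    note e = fin_supp_ell2 fin_supp_iconj fin_supp_cos_op_power
    have tr: "inn torus (fourier p) (t k \<odot> fourier q) = ip p ((cos_op j ^^ k) q)"
      if "p \<in> ell2" "q \<in> ell2" for p q k
      using ip_inv_fourier[OF fourier_L2[OF that(1)] L2_unit_mult[OF fourier_L2[OF that(2)] tm[of k] tb[of k]]]
        cos_op_power_inv_fourier[OF fourier_L2[OF that(2)], of k j] that
      by (simp add: inv_fourier_fourier t_def)
    have d: "inn torus (fourier x) (\<lambda>\<theta>. complex_of_real (t k \<theta> - t (Suc k) \<theta>) * fourier y \<theta>) =
       ip x ((cos_op j ^^ k) y) - ip x ((cos_op j ^^ Suc k) y)"
      unfolding tr[OF e(1)[OF x] e(1)[OF y], symmetric] of_real_diff left_diff_distrib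
      by (rule inn_diff_right) (intro fourier_L2 L2_unit_mult e x y tm tb)+
    let ?y = "(cos_op j ^^ k) y" and ?y' = "(cos_op j ^^ Suc k) y"
    have "ip x ((cos_op j ^^ k) (iconj r y)) = ip x (iconj r ?y) + ?c * (ip x ?y - ip x ?y')"
    proof -
      have "(cos_op j ^^ k) (iconj r y) = (\<lambda>n. iconj r ?y n + ?c * (?y n + (-1) * ?y' n))"
        unfolding cos_op_power_commutator by simp
      moreover have "ip x (\<lambda>n. iconj r ?y n + ?c * (?y n + (-1) * ?y' n)) = ip x (iconj r ?y) + ?c * (ip x ?y + (-1) * ip x ?y')"
      proof -
        have m: "x \<in> ell2" "iconj r ?y \<in> ell2" "?y \<in> ell2" "?y' \<in> ell2" by (intro e x y)+
        have m': "(\<lambda>n. (-1) * ?y' n) \<in> ell2" by (rule ell2_scale[OF m(4)])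
        have m'': "(\<lambda>n. ?c * (?y n + (-1) * ?y' n)) \<in> ell2" by (rule ell2_scale[OF ell2_add[OF m(3) m']])
        show ?thesis unfolding ip_add_right[OF m(1,2) m''] ip_scale_right ip_add_right[OF m(1,3) m'] ..
      qed
      ultimately show ?thesis by (simp only:) simp
    qed
    then show ?thesis
      unfolding tr[OF e(1)[OF x] e(1)[OF e(2)[OF y]]] tr[OF e(1)[OF e(2)[OF x]] e(1)[OF y]] d
      by (simp add: iconj_antisym[OF x e(3)[OF y]])
  qed
  obtain F where F: "\<And>k. fin_supp (F k)" "l2_lim F u" "l2_lim (\<lambda>k. conj_op_pre r (F k)) a" "u \<in> ell2" "a \<in> ell2"
    using u by (rule conj_op_cases) blast
  obtain G where G: "\<And>k. fin_supp (G k)" "l2_lim G v" "l2_lim (\<lambda>k. conj_op_pre r (G k)) b" "v \<in> ell2" "b \<in> ell2"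
    using v by (rule conj_op_cases) blast
  have ic: "l2_lim (\<lambda>k. iconj r (X k)) (\<lambda>n. \<i> * x n)" if "l2_lim (\<lambda>k. conj_op_pre r (X k)) x" for X x
    using l2_lim_scale[OF that, of \<i>] by (simp add: iconj_def[abs_def])
  have 1: "L2lim torus (\<lambda>k. fourier (F k)) (fourier u)" "L2lim torus (\<lambda>k. fourier (G k)) (fourier v)"
    "L2lim torus (\<lambda>k. fourier (iconj r (F k))) (fourier (\<lambda>n. \<i> * a n))"
    "L2lim torus (\<lambda>k. fourier (iconj r (G k))) (fourier (\<lambda>n. \<i> * b n))"
    using F G by (auto intro!: L2lim_fourier ic fin_supp_ell2 fin_supp_iconj ell2_scale)
  have 2: "fourier (F k) \<in> L2 torus" "fourier (G k) \<in> L2 torus" "fourier (iconj r (F k)) \<in> L2 torus" "fourier (iconj r (G k)) \<in> L2 torus"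
    "fourier u \<in> L2 torus" "fourier v \<in> L2 torus" "fourier (\<lambda>n. \<i> * a n) \<in> L2 torus" "fourier (\<lambda>n. \<i> * b n) \<in> L2 torus" for k
    using F G by (auto intro!: fourier_L2 fin_supp_ell2 fin_supp_iconj ell2_scale)
  note T = L2_unit_mult[OF _ tm tb] L2lim_unit_mult[OF _ _ _ tm tb] L2_unit_mult[OF _ dm db] L2lim_unit_mult[OF _ _ _ dm db]
  have l1: "(\<lambda>N. inn torus (fourier (F N)) (t k \<odot> fourier (iconj r (G N)))) \<longlonglongrightarrow>
      inn torus (fourier u) (t k \<odot> fourier (\<lambda>n. \<i> * b n))"
    by (rule L2lim_inn) (intro T 1 2)+
  have l2: "(\<lambda>N. inn torus (fourier (iconj r (F N))) (t k \<odot> fourier (G N))) \<longlonglongrightarrow>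
      inn torus (fourier (\<lambda>n. \<i> * a n)) (t k \<odot> fourier v)"
    by (rule L2lim_inn) (intro T 1 2)+
  have l3: "(\<lambda>N. inn torus (fourier (F N)) (\<lambda>\<theta>. complex_of_real (t k \<theta> - t (Suc k) \<theta>) * fourier (G N) \<theta>)) \<longlonglongrightarrow>
      inn torus (fourier u) (\<lambda>\<theta>. complex_of_real (t k \<theta> - t (Suc k) \<theta>) * fourier v \<theta>)"
    by (rule L2lim_inn) (intro T 1 2)+
  have "inn torus (fourier u) (t k \<odot> fourier (\<lambda>n. \<i> * b n))
      + inn torus (fourier (\<lambda>n. \<i> * a n)) (t k \<odot> fourier v)
    = ?c * inn torus (fourier u) (\<lambda>\<theta>. complex_of_real (t k \<theta> - t (Suc k) \<theta>) * fourier v \<theta>)"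
    using tendsto_add[OF l1 l2] tendsto_mult[OF tendsto_const[of ?c] l3] unfolding fin[OF F(1) G(1)]
    by (rule LIMSEQ_unique)
  then show ?thesis unfolding t_def .
qed

section \<open>Binomial series for fractional powers\<close>

text \<open>The Taylor coefficients at 0 of \<open>(1 - t) powr s\<close>; the sign of
  \<open>- t\<close> is absorbed.\<close>

definition binom_coeff :: "real \<Rightarrow> nat \<Rightarrow> real" where
  "binom_coeff s k = (-1) ^ k * (s gchoose k)"

lemma binom_coeff_Suc: "binom_coeff s (Suc k) = binom_coeff s k * (real k - s) / (real k + 1)"
proof -
  have h: "(s gchoose Suc k) = (s gchoose k) * (s - real k) / (real k + 1)"
    by (simp add: gbinomial_prod_rev field_simps)
  show ?thesis unfolding binom_coeff_def h by (simp add: minus_divide_left[symmetric] right_diff_distrib)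
qed

lemma binom_coeff_absorb: "real (Suc k) * binom_coeff s (Suc k) = - s * binom_coeff (s - 1) k"
  using gbinomial_absorption[of k s] by (simp add: binom_coeff_def)

lemma binom_series:
  assumes "0 \<le> t" "t < 1"
  shows "(\<lambda>k. binom_coeff s k * t ^ k) sums ((1 - t) powr s)"
proof -
  have "(\<lambda>k. (s gchoose k) * (- t) ^ k) sums (1 + (- t)) powr s"
    by (rule gen_binomial_real) (use assms in auto)
  moreover have "(s gchoose k) * (- t) ^ k = binom_coeff s k * t ^ k" for k
    by (simp add: binom_coeff_def power_minus[of t])
  ultimately show ?thesis by simp
qed

lemma binom_series_deriv:
  assumes "0 \<le> t" "t < 1"
  shows "(\<lambda>k. real k * binom_coeff s k * t ^ k) sums (- s * t * (1 - t) powr (s - 1))"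
proof -
  have "(\<lambda>k. (- s * t) * (binom_coeff (s - 1) k * t ^ k)) sums ((- s * t) * (1 - t) powr (s - 1))"
    by (rule sums_mult[OF binom_series[OF assms]])
  moreover have "(- s * t) * (binom_coeff (s - 1) k * t ^ k) = real (Suc k) * binom_coeff s (Suc k) * t ^ Suc k" for k
    unfolding binom_coeff_absorb by simp
  ultimately have "(\<lambda>k. real (Suc k) * binom_coeff s (Suc k) * t ^ Suc k) sums ((- s * t) * (1 - t) powr (s - 1))"
    by simp
  from sums_Suc[OF this] show ?thesis by simp
qed

text \<open>The ratio of consecutive coefficients is \<open>(k - s) / (k + 1)\<close>, which is
  nonnegative once \<open>k\<close> is at least \<open>s\<close>.\<close>

lemma binom_coeff_sign: "\<exists>\<sigma>::real. \<bar>\<sigma>\<bar> = 1 \<and> (\<forall>k \<ge> nat \<lceil>s\<rceil>. 0 \<le> \<sigma> * binom_coeff s k)"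
proof -
  let ?K = "nat \<lceil>s\<rceil>"
  define \<sigma> :: real where "\<sigma> = (if 0 \<le> binom_coeff s ?K then 1 else -1)"
  have "0 \<le> \<sigma> * binom_coeff s k" if "k \<ge> ?K" for k
    using that
  proof (induction k rule: dec_induct)
    case base
    show ?case by (simp add: \<sigma>_def)
  next
    case (step k)
    have "s \<le> real k" using step(1) by linarith
    then have "0 \<le> (\<sigma> * binom_coeff s k) * ((real k - s) / (real k + 1))"
      using mult_nonneg_nonneg[OF step(3), of "(real k - s) / (real k + 1)"] by simp
    then show ?case by (simp add: binom_coeff_Suc mult.assoc)
  qed
  moreover have "\<bar>\<sigma>\<bar> = 1" by (simp add: \<sigma>_def)
  ultimately show ?thesis by blast
qed

text \<open>From index \<open>K\<close> on the partial sums are monotone, hence they stay between the \<open>K\<close>-th one and the limit.\<close>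

lemma eventually_monotone_partial_sums_bound:
  fixes a :: "nat \<Rightarrow> real"
  assumes sums: "a sums S" and \<sigma>: "\<bar>\<sigma>\<bar> = 1" "\<And>k. k \<ge> K \<Longrightarrow> 0 \<le> \<sigma> * a k"
  shows "\<bar>\<Sum>k<n. a k\<bar> \<le> \<bar>S\<bar> + (\<Sum>k<K. \<bar>a k\<bar>)"
proof (cases "n \<le> K")
  case True
  have "\<bar>\<Sum>k<n. a k\<bar> \<le> (\<Sum>k<n. \<bar>a k\<bar>)" by (rule sum_abs)
  also have "\<dots> \<le> (\<Sum>k<K. \<bar>a k\<bar>)" using True by (intro sum_mono2) auto
  finally show ?thesis by simp
next
  case False
  have mono: "\<sigma> * (\<Sum>k<m. a k) \<le> \<sigma> * (\<Sum>k<m'. a k)" if "K \<le> m" "m \<le> m'" for m m'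
    unfolding sum_distrib_left by (rule sum_mono2) (use that \<sigma> in auto)
  have "(\<lambda>m. \<sigma> * (\<Sum>k<m. a k)) \<longlonglongrightarrow> \<sigma> * S"
    using sums unfolding sums_def by (intro tendsto_mult tendsto_const)
  then have "\<sigma> * (\<Sum>k<n. a k) \<le> \<sigma> * S"
    by (rule LIMSEQ_le_const) (use mono False in \<open>auto intro!: exI[of _ n]\<close>)
  moreover have "\<sigma> * (\<Sum>k<K. a k) \<le> \<sigma> * (\<Sum>k<n. a k)" using mono False by simp
  moreover have "\<sigma> = 1 \<or> \<sigma> = -1" using \<sigma>(1) by linarith
  moreover have "\<bar>\<Sum>k<K. a k\<bar> \<le> (\<Sum>k<K. \<bar>a k\<bar>)" by (rule sum_abs)
  ultimately show ?thesis by (auto simp: abs_if split: if_splits)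
qed

text \<open>The two sums are those of the symbol and of its commutator. In the second, the factor
  \<open>1 - t\<close> stems from \<open>t^k - t^(k + 1)\<close> and restores the power lost by
  differentiation, so both are bounded by the same function, uniformly in \<open>n\<close> and
  \<open>t\<close>.\<close>

lemma binom_partial_sums_bound:
  "\<exists>C\<ge>0. \<forall>t. 0 \<le> t \<longrightarrow> t < 1 \<longrightarrow> (\<forall>n. \<bar>\<Sum>k<n. binom_coeff s k * t ^ k\<bar> \<le> C * (1 + (1 - t) powr s) \<and>
     \<bar>(1 - t) * (\<Sum>k<n. real k * binom_coeff s k * t ^ k)\<bar> \<le> C * (1 + (1 - t) powr s))"
proof -
  let ?K = "nat \<lceil>s\<rceil>"
  obtain \<sigma> :: real where \<sigma>: "\<bar>\<sigma>\<bar> = 1" "\<And>k. k \<ge> ?K \<Longrightarrow> 0 \<le> \<sigma> * binom_coeff s k"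
    using binom_coeff_sign[of s] by blast
  \<comment> \<open>Bounds the finitely many terms before the signs settle; the weight
    \<open>1 + k\<close> serves both series.\<close>
  define C0 where "C0 = (\<Sum>k<?K. (1 + real k) * \<bar>binom_coeff s k\<bar>)"
  define C where "C = 1 + \<bar>s\<bar> + C0"
  have C0: "0 \<le> C0" by (auto simp: C0_def intro!: sum_nonneg)
  have "\<bar>\<Sum>k<n. binom_coeff s k * t ^ k\<bar> \<le> C * (1 + (1 - t) powr s) \<and>
     \<bar>(1 - t) * (\<Sum>k<n. real k * binom_coeff s k * t ^ k)\<bar> \<le> C * (1 + (1 - t) powr s)"
    if t: "0 \<le> t" "t < 1" for t n
  proof -
    let ?p = "(1 - t) powr s"
    have p: "0 \<le> ?p" by simp
    have tk: "t ^ k \<le> 1" "0 \<le> t ^ k" for k using t by (auto simp: power_le_one)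
    have "\<bar>\<Sum>k<n. binom_coeff s k * t ^ k\<bar> \<le> \<bar>?p\<bar> + (\<Sum>k<?K. \<bar>binom_coeff s k * t ^ k\<bar>)"
    proof (rule eventually_monotone_partial_sums_bound[OF binom_series[OF t] \<sigma>(1)])
      fix k assume "k \<ge> ?K"
      from mult_nonneg_nonneg[OF \<sigma>(2)[OF this] tk(2)[of k]]
      show "0 \<le> \<sigma> * (binom_coeff s k * t ^ k)" by (simp only: mult.assoc)
    qed
    also have "(\<Sum>k<?K. \<bar>binom_coeff s k * t ^ k\<bar>) \<le> C0"
      unfolding C0_def
    proof (rule sum_mono)
      fix k
      show "\<bar>binom_coeff s k * t ^ k\<bar> \<le> (1 + real k) * \<bar>binom_coeff s k\<bar>"
        using mult_mono[of "t ^ k" "1 + real k" "\<bar>binom_coeff s k\<bar>" "\<bar>binom_coeff s k\<bar>"] tk[of k]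
        by (simp add: abs_mult mult.commute)
    qed
    finally have 1: "\<bar>\<Sum>k<n. binom_coeff s k * t ^ k\<bar> \<le> ?p + C0" using p by simp
    have "\<bar>\<Sum>k<n. real k * binom_coeff s k * t ^ k\<bar> \<le> \<bar>- s * t * (1 - t) powr (s - 1)\<bar> + (\<Sum>k<?K. \<bar>real k * binom_coeff s k * t ^ k\<bar>)"
    proof (rule eventually_monotone_partial_sums_bound[OF binom_series_deriv[OF t] \<sigma>(1)])
      fix k assume "k \<ge> ?K"
      then have "0 \<le> (real k * t ^ k) * (\<sigma> * binom_coeff s k)"
        using \<sigma>(2)[of k] mult_nonneg_nonneg[OF of_nat_0_le_iff tk(2), of k k] by (intro mult_nonneg_nonneg[of "real k * t ^ k"])
      then show "0 \<le> \<sigma> * (real k * binom_coeff s k * t ^ k)" by (simp add: mult_ac)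
    qed
    also have "(\<Sum>k<?K. \<bar>real k * binom_coeff s k * t ^ k\<bar>) \<le> C0"
      unfolding C0_def
    proof (rule sum_mono)
      fix k
      have "(real k * \<bar>binom_coeff s k\<bar>) * t ^ k \<le> (real k * \<bar>binom_coeff s k\<bar>) * 1" using tk by (intro mult_left_mono) auto
      also have "\<dots> \<le> (1 + real k) * \<bar>binom_coeff s k\<bar>" by (simp add: algebra_simps)
      finally show "\<bar>real k * binom_coeff s k * t ^ k\<bar> \<le> (1 + real k) * \<bar>binom_coeff s k\<bar>"
        using tk[of k] by (simp add: abs_mult)
    qed
    finally have "(1 - t) * \<bar>\<Sum>k<n. real k * binom_coeff s k * t ^ k\<bar> \<le> (1 - t) * (\<bar>- s * t * (1 - t) powr (s - 1)\<bar> + C0)"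
      using t by (intro mult_left_mono) auto
    also have "\<dots> = \<bar>s\<bar> * t * ((1 - t) * (1 - t) powr (s - 1)) + (1 - t) * C0"
      using t by (simp add: abs_mult algebra_simps)
    also have "(1 - t) * (1 - t) powr (s - 1) = ?p"
      using t powr_mult_base[of "1 - t" "s - 1"] by simp
    also have "\<bar>s\<bar> * t * ?p + (1 - t) * C0 \<le> \<bar>s\<bar> * 1 * ?p + 1 * C0"
      using t C0 by (intro add_mono mult_right_mono mult_left_mono) auto
    finally have 2: "\<bar>(1 - t) * (\<Sum>k<n. real k * binom_coeff s k * t ^ k)\<bar> \<le> \<bar>s\<bar> * ?p + C0"
      using t by (simp add: abs_mult)
    have "C * (1 + ?p) = 1 + \<bar>s\<bar> + C0 + ?p + \<bar>s\<bar> * ?p + C0 * ?p" by (simp add: C_def algebra_simps)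
    moreover have "0 \<le> C0 * ?p" "0 \<le> \<bar>s\<bar> * ?p" using C0 p by auto
    ultimately show ?thesis using 1 2 p by linarith
  qed
  moreover have "C \<ge> 0" using C0 by (simp add: C_def)
  ultimately show ?thesis by blast
qed

section \<open>The symbols and their polynomial approximations\<close>

definition frac_term :: "real^'d \<Rightarrow> 'd \<Rightarrow> real^'d \<Rightarrow> real" where
  "frac_term r j \<theta> = 4 powr (r $ j) * (1 - cos_sym j \<theta>) powr (r $ j)"

text \<open>On the Fourier side, the commutator is multiplication by this function.\<close>

definition comm_symbol :: "real^'d \<Rightarrow> real^'d \<Rightarrow> real" where
  "comm_symbol r \<theta> = (\<Sum>j\<in>UNIV. 2 * \<bar>r $ j\<bar> * cos_sym j \<theta> * frac_term r j \<theta>)"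

lemma frac_term_eq: "frac_term r j \<theta> = (2 - 2 * cos (\<theta> $ j)) powr (r $ j)"
proof -
  have eq: "2 - 2 * cos (\<theta> $ j) = 4 * (1 - cos_sym j \<theta>)" by (simp add: cos_sym_def field_simps)
  show ?thesis unfolding eq frac_term_def by (rule powr_mult[symmetric])
qed

lemma frac_symbol_eq: "frac_symbol r \<theta> = (\<Sum>j\<in>UNIV. frac_term r j \<theta>)"
  by (simp add: frac_symbol_def frac_term_eq)

lemma frac_term_nonneg [simp]: "0 \<le> frac_term r j \<theta>"
  by (simp add: frac_term_def)

lemma frac_term_le_symbol: "frac_term r j \<theta> \<le> frac_symbol r \<theta>"
  unfolding frac_symbol_eq by (rule member_le_sum) auto

lemma frac_symbol_nonneg [simp]: "0 \<le> frac_symbol r \<theta>"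
  unfolding frac_symbol_eq by (rule sum_nonneg) simp

lemma frac_term_measurable [measurable]: "frac_term r j \<in> borel_measurable torus"
  unfolding frac_term_def by measurable

lemma frac_symbol_measurable [measurable]: "frac_symbol r \<in> borel_measurable torus"
  unfolding frac_symbol_eq[abs_def] by measurable

lemma comm_symbol_measurable [measurable]: "comm_symbol r \<in> borel_measurable torus"
  unfolding comm_symbol_def by measurable

lemma comm_symbol_nonneg: "0 \<le> comm_symbol r \<theta>"
  unfolding comm_symbol_def using cos_sym_bounds by (intro sum_nonneg mult_nonneg_nonneg) auto

lemma comm_symbol_le: "comm_symbol r \<theta> \<le> (\<Sum>j\<in>UNIV. 2 * \<bar>r $ j\<bar>) * frac_symbol r \<theta>"
  unfolding comm_symbol_def sum_distrib_right
proof (rule sum_mono)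
  fix j
  have "2 * \<bar>r $ j\<bar> * cos_sym j \<theta> \<le> 2 * \<bar>r $ j\<bar> * 1"
    using cos_sym_bounds by (intro mult_left_mono) auto
  then show "2 * \<bar>r $ j\<bar> * cos_sym j \<theta> * frac_term r j \<theta> \<le> 2 * \<bar>r $ j\<bar> * frac_symbol r \<theta>"
    using mult_mono[OF _ frac_term_le_symbol[of r j \<theta>], of "2 * \<bar>r $ j\<bar> * cos_sym j \<theta>" "2 * \<bar>r $ j\<bar>"] by simp
qed

text \<open>Off this null set the binomial series converge and \<open>powr\<close> is never
  evaluated at base 0.\<close>

lemma AE_cos_sym_less: "AE \<theta> in (torus :: (real^'d) measure). \<forall>j. cos_sym j \<theta> < 1"
proof -
  have "AE \<theta> in (torus :: (real^'d) measure). \<forall>j. \<theta> $ j \<noteq> 0"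
    by (simp add: AE_torus_component_neq AE_all_countable)
  then show ?thesis using AE_space
  proof eventually_elim
    case (elim \<theta>)
    have "cos (\<theta> $ j) < 1" for j
    proof -
      have "- pi \<le> \<theta> $ j" "\<theta> $ j \<le> pi" using elim(2) by (auto simp: space_torus mem_box_cart)
      then have "cos \<bar>\<theta> $ j\<bar> < cos 0" using elim(1) by (intro cos_monotone_0_pi) auto
      then show ?thesis by simp
    qed
    then show ?case by (simp add: cos_sym_def)
  qed
qed

definition approx_symbol :: "real^'d \<Rightarrow> nat \<Rightarrow> real^'d \<Rightarrow> real" where
  "approx_symbol r N \<theta> = (\<Sum>j\<in>UNIV. \<Sum>k<N. 4 powr (r $ j) * binom_coeff (r $ j) k * cos_sym j \<theta> ^ k)"

text \<open>What \<open>form_identity_power\<close> produces from \<open>approx_symbol\<close> term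
  by term.\<close>

definition approx_comm :: "real^'d \<Rightarrow> nat \<Rightarrow> real^'d \<Rightarrow> real" where
  "approx_comm r N \<theta> = (\<Sum>j\<in>UNIV. \<Sum>k<N. 4 powr (r $ j) * binom_coeff (r $ j) k *
     (- 2 * sign (r $ j) * real k * (cos_sym j \<theta> ^ k - cos_sym j \<theta> ^ Suc k)))"

lemma approx_measurable [measurable]:
  "approx_symbol r N \<in> borel_measurable torus" "approx_comm r N \<in> borel_measurable torus"
  unfolding approx_symbol_def approx_comm_def by measurable

lemma approx_symbol_eq: "approx_symbol r N \<theta> = (\<Sum>j\<in>UNIV. 4 powr (r $ j) * (\<Sum>k<N. binom_coeff (r $ j) k * cos_sym j \<theta> ^ k))"
  by (simp add: approx_symbol_def sum_distrib_left mult.assoc)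

lemma approx_comm_eq: "approx_comm r N \<theta> = (\<Sum>j\<in>UNIV. - 2 * sign (r $ j) * 4 powr (r $ j) *
    ((1 - cos_sym j \<theta>) * (\<Sum>k<N. real k * binom_coeff (r $ j) k * cos_sym j \<theta> ^ k)))"
  by (simp add: approx_comm_def sum_distrib_left algebra_simps)

lemma approx_tendsto:
  assumes "\<forall>j. cos_sym j \<theta> < 1"
  shows "(\<lambda>N. approx_symbol r N \<theta>) \<longlonglongrightarrow> frac_symbol r \<theta>" "(\<lambda>N. approx_comm r N \<theta>) \<longlonglongrightarrow> comm_symbol r \<theta>"
proof -
  have t: "0 \<le> cos_sym j \<theta>" "cos_sym j \<theta> < 1" for j using assms cos_sym_bounds by auto
  show "(\<lambda>N. approx_symbol r N \<theta>) \<longlonglongrightarrow> frac_symbol r \<theta>"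
    unfolding approx_symbol_eq frac_symbol_eq frac_term_def
    by (intro tendsto_sum tendsto_mult tendsto_const binom_series[OF t, unfolded sums_def])
  have "(\<lambda>N. approx_comm r N \<theta>) \<longlonglongrightarrow> (\<Sum>j\<in>UNIV. - 2 * sign (r $ j) * 4 powr (r $ j) *
      ((1 - cos_sym j \<theta>) * (- (r $ j) * cos_sym j \<theta> * (1 - cos_sym j \<theta>) powr (r $ j - 1))))"
    unfolding approx_comm_eq
    by (intro tendsto_sum tendsto_mult tendsto_const binom_series_deriv[OF t, unfolded sums_def])
  also have "(\<Sum>j\<in>UNIV. - 2 * sign (r $ j) * 4 powr (r $ j) *
      ((1 - cos_sym j \<theta>) * (- (r $ j) * cos_sym j \<theta> * (1 - cos_sym j \<theta>) powr (r $ j - 1)))) = comm_symbol r \<theta>"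
    unfolding comm_symbol_def
  proof (rule sum.cong[OF refl])
    fix j
    have p: "(1 - cos_sym j \<theta>) * (1 - cos_sym j \<theta>) powr (r $ j - 1) = (1 - cos_sym j \<theta>) powr (r $ j)"
      using t[of j] powr_mult_base[of "1 - cos_sym j \<theta>" "r $ j - 1"] by simp
    \<comment> \<open>The sign built into the conjugate operator meets the exponent coming from
      differentiation; their product is what makes the commutator nonnegative for either sign of
      \<open>r $ j\<close>.\<close>
    have s: "sign (r $ j) * (r $ j) = \<bar>r $ j\<bar>" by (simp add: sign_def)
    have "- 2 * sign (r $ j) * 4 powr (r $ j) *
      ((1 - cos_sym j \<theta>) * (- (r $ j) * cos_sym j \<theta> * (1 - cos_sym j \<theta>) powr (r $ j - 1))) =
      2 * (sign (r $ j) * (r $ j)) * cos_sym j \<theta> * (4 powr (r $ j) * ((1 - cos_sym j \<theta>) * (1 - cos_sym j \<theta>) powr (r $ j - 1)))"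
      by (simp only: mult_ac mult_minus_left mult_minus_right minus_minus)
    then show "- 2 * sign (r $ j) * 4 powr (r $ j) *
      ((1 - cos_sym j \<theta>) * (- (r $ j) * cos_sym j \<theta> * (1 - cos_sym j \<theta>) powr (r $ j - 1))) =
      2 * \<bar>r $ j\<bar> * cos_sym j \<theta> * frac_term r j \<theta>"
      unfolding s p frac_term_def .
  qed
  finally show "(\<lambda>N. approx_comm r N \<theta>) \<longlonglongrightarrow> comm_symbol r \<theta>" .
qed

text \<open>A bound uniform in \<open>N\<close>: on the domain of multiplication by
  \<open>frac_symbol\<close> the right-hand side times the vector is square integrable, which is the
  majorant for dominated convergence.\<close>

lemma approx_bound:
  fixes r :: "real^'d"
  obtains C where "C \<ge> 0" "\<And>\<theta> N. \<forall>j. cos_sym j \<theta> < 1 \<Longrightarrow>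
    \<bar>approx_symbol r N \<theta>\<bar> \<le> C * (1 + frac_symbol r \<theta>) \<and> \<bar>approx_comm r N \<theta>\<bar> \<le> C * (1 + frac_symbol r \<theta>)"
proof -
  have "\<forall>s. \<exists>C\<ge>0. \<forall>t. 0 \<le> t \<longrightarrow> t < 1 \<longrightarrow> (\<forall>n. \<bar>\<Sum>k<n. binom_coeff s k * t ^ k\<bar> \<le> C * (1 + (1 - t) powr s) \<and>
     \<bar>(1 - t) * (\<Sum>k<n. real k * binom_coeff s k * t ^ k)\<bar> \<le> C * (1 + (1 - t) powr s))"
    using binom_partial_sums_bound by blast
  from choice[OF this] obtain c where c0: "\<And>s. 0 \<le> c s" and c: "\<And>s t n. 0 \<le> t \<Longrightarrow> t < 1 \<Longrightarrow>
     \<bar>\<Sum>k<n. binom_coeff s k * t ^ k\<bar> \<le> c s * (1 + (1 - t) powr s) \<and>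
     \<bar>(1 - t) * (\<Sum>k<n. real k * binom_coeff s k * t ^ k)\<bar> \<le> c s * (1 + (1 - t) powr s)"
    by blast
  \<comment> \<open>The factor \<open>4 powr (r $ j) + 1\<close> comes from
    \<open>p + x \<le> (p + 1) (1 + s)\<close> with \<open>p = 4 powr (r $ j)\<close>, and the 2
    from the coefficient in \<open>approx_comm\<close>.\<close>
  define C where "C = (\<Sum>j\<in>UNIV. 2 * c (r $ j) * (4 powr (r $ j) + 1))"
  have bnd: "4 powr (r $ j) * (c (r $ j) * (1 + (1 - cos_sym j \<theta>) powr (r $ j))) \<le>
      c (r $ j) * (4 powr (r $ j) + 1) * (1 + frac_symbol r \<theta>)" for j \<theta>
  proof -
    have "4 powr (r $ j) * (c (r $ j) * (1 + (1 - cos_sym j \<theta>) powr (r $ j))) = c (r $ j) * (4 powr (r $ j) + frac_term r j \<theta>)"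
      by (simp add: frac_term_def algebra_simps)
    also have "\<dots> \<le> c (r $ j) * ((4 powr (r $ j) + 1) * (1 + frac_symbol r \<theta>))"
    proof (rule mult_left_mono[OF _ c0])
      have "p + x \<le> (p + 1) * (1 + s)" if "0 \<le> p" "0 \<le> s" "x \<le> s" for p s x :: real
        using mult_nonneg_nonneg[OF that(1,2)] that(3) by (simp add: algebra_simps)
      then show "4 powr (r $ j) + frac_term r j \<theta> \<le> (4 powr (r $ j) + 1) * (1 + frac_symbol r \<theta>)"
        using frac_term_le_symbol[of r j \<theta>] by simp
    qed
    finally show ?thesis by (simp add: mult.assoc)
  qed
  have "\<bar>approx_symbol r N \<theta>\<bar> \<le> C * (1 + frac_symbol r \<theta>) \<and> \<bar>approx_comm r N \<theta>\<bar> \<le> C * (1 + frac_symbol r \<theta>)"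
    if "\<forall>j. cos_sym j \<theta> < 1" for \<theta> N
  proof
    have t: "0 \<le> cos_sym j \<theta>" "cos_sym j \<theta> < 1" for j using that cos_sym_bounds by auto
    have pos: "0 \<le> c (r $ j) * (4 powr (r $ j) + 1) * (1 + frac_symbol r \<theta>)" for j
      using c0 by (intro mult_nonneg_nonneg) (auto intro: add_nonneg_nonneg)
    show "\<bar>approx_symbol r N \<theta>\<bar> \<le> C * (1 + frac_symbol r \<theta>)"
      unfolding approx_symbol_eq C_def sum_distrib_right
    proof (rule order_trans[OF sum_abs sum_mono])
      fix j
      have "\<bar>4 powr (r $ j) * (\<Sum>k<N. binom_coeff (r $ j) k * cos_sym j \<theta> ^ k)\<bar> \<le>
        4 powr (r $ j) * (c (r $ j) * (1 + (1 - cos_sym j \<theta>) powr (r $ j)))"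
        unfolding abs_mult using c[OF t] by (intro mult_mono) auto
      also note bnd[of j \<theta>]
      finally show "\<bar>4 powr (r $ j) * (\<Sum>k<N. binom_coeff (r $ j) k * cos_sym j \<theta> ^ k)\<bar> \<le>
        2 * c (r $ j) * (4 powr (r $ j) + 1) * (1 + frac_symbol r \<theta>)"
        using pos[of j] by linarith
    qed
    show "\<bar>approx_comm r N \<theta>\<bar> \<le> C * (1 + frac_symbol r \<theta>)"
      unfolding approx_comm_eq C_def sum_distrib_right
    proof (rule order_trans[OF sum_abs sum_mono])
      fix j
      let ?S = "(1 - cos_sym j \<theta>) * (\<Sum>k<N. real k * binom_coeff (r $ j) k * cos_sym j \<theta> ^ k)"
      have "\<bar>- 2 * sign (r $ j) * 4 powr (r $ j) * ?S\<bar> = 2 * (4 powr (r $ j) * \<bar>?S\<bar>)"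
        by (simp add: abs_mult sign_def)
      also have "\<dots> \<le> 2 * (4 powr (r $ j) * (c (r $ j) * (1 + (1 - cos_sym j \<theta>) powr (r $ j))))"
        using c[OF t] by (intro mult_left_mono) auto
      also have "\<dots> \<le> 2 * (c (r $ j) * (4 powr (r $ j) + 1) * (1 + frac_symbol r \<theta>))"
        using bnd[of j \<theta>] by (rule mult_left_mono) simp
      finally show "\<bar>- 2 * sign (r $ j) * 4 powr (r $ j) * ?S\<bar> \<le> 2 * c (r $ j) * (4 powr (r $ j) + 1) * (1 + frac_symbol r \<theta>)"
        by (simp add: mult.assoc)
    qed
  qed
  moreover have "C \<ge> 0" unfolding C_def using c0 by (intro sum_nonneg mult_nonneg_nonneg) auto
  ultimately show ?thesis using that by blast
qed

section \<open>The commutator form as a multiplication operator\<close>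

lemma inn_real_mult: "inn M f (\<lambda>x. complex_of_real (m x) * g x) = inn M (\<lambda>x. complex_of_real (m x) * f x) g"
  unfolding inn_def by (rule Bochner_Integration.integral_cong) auto

lemma form_identity_approx:
  fixes r :: "real^'d" and u v a b :: "int^'d \<Rightarrow> complex"
  assumes u: "(u, a) \<in> conj_op r" and v: "(v, b) \<in> conj_op r"
  shows "inn torus (fourier u) (approx_symbol r N \<odot> fourier (\<lambda>n. \<i> * b n))
      + inn torus (fourier (\<lambda>n. \<i> * a n)) (approx_symbol r N \<odot> fourier v)
    = inn torus (fourier u) (approx_comm r N \<odot> fourier v)"
proof -
  let ?B = "fourier (\<lambda>n. \<i> * b n)" and ?A = "fourier (\<lambda>n. \<i> * a n)"
  have e: "u \<in> ell2" "v \<in> ell2" "a \<in> ell2" "b \<in> ell2"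
    using u v by (auto elim!: conj_op_cases)
  have L: "fourier u \<in> L2 torus" "fourier v \<in> L2 torus" "?A \<in> L2 torus" "?B \<in> L2 torus"
    using e by (auto intro!: fourier_L2 ell2_scale)
  \<comment> \<open>Bundling the identity with the memberships in \<open>L2\<close> makes it stable
    under scaling and finite sums, so it extends from powers to polynomials.\<close>
  define Q where "Q m m' \<longleftrightarrow> (m \<odot> ?B) \<in> L2 torus \<and> (m \<odot> fourier v) \<in> L2 torus \<and>
    (m' \<odot> fourier v) \<in> L2 torus \<and>
    inn torus (fourier u) (m \<odot> ?B) + inn torus ?A (m \<odot> fourier v)
    = inn torus (fourier u) (m' \<odot> fourier v)" for m m' :: "real^'d \<Rightarrow> real"
  have Q_scale: "Q (\<lambda>\<theta>. c * m \<theta>) (\<lambda>\<theta>. c * m' \<theta>)" if "Q m m'" for c m m'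
  proof -
    have eq: "(\<lambda>\<theta>. complex_of_real (c * n \<theta>) * h \<theta>) = (\<lambda>\<theta>. complex_of_real c * (complex_of_real (n \<theta>) * h \<theta>))" for n :: "real^'d \<Rightarrow> real" and h
      by (simp add: mult.assoc)
    show ?thesis using that unfolding Q_def eq inn_scale_right distrib_left[symmetric] by auto
  qed
  have Q_sum: "Q (\<lambda>\<theta>. \<Sum>i\<in>I. m i \<theta>) (\<lambda>\<theta>. \<Sum>i\<in>I. m' i \<theta>)" if "\<And>i. i \<in> I \<Longrightarrow> Q (m i) (m' i)"
    for I :: "'i set" and m m' :: "'i \<Rightarrow> real^'d \<Rightarrow> real"
  proof -
    have eq: "(\<lambda>\<theta>. complex_of_real (\<Sum>i\<in>I. n i \<theta>) * h \<theta>) = (\<lambda>\<theta>. \<Sum>i\<in>I. complex_of_real (n i \<theta>) * h \<theta>)" for n :: "'i \<Rightarrow> real^'d \<Rightarrow> real" and h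
      by (simp add: sum_distrib_right)
    have s: "inn torus f (\<lambda>\<theta>. \<Sum>i\<in>I. g i \<theta>) = (\<Sum>i\<in>I. inn torus f (g i))"
      if "f \<in> L2 torus" "\<And>i. i \<in> I \<Longrightarrow> g i \<in> L2 torus" for f :: "real^'d \<Rightarrow> complex" and g
      by (rule inn_sum_right[OF that])
    have q: "(m i \<odot> ?B) \<in> L2 torus" "(m i \<odot> fourier v) \<in> L2 torus"
      "(m' i \<odot> fourier v) \<in> L2 torus"
      "inn torus (fourier u) (m i \<odot> ?B) + inn torus ?A (m i \<odot> fourier v)
         = inn torus (fourier u) (m' i \<odot> fourier v)" if "i \<in> I" for i
      using \<open>\<And>i. i \<in> I \<Longrightarrow> Q (m i) (m' i)\<close>[OF that] unfolding Q_def by auto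
    show ?thesis
      unfolding Q_def eq
    proof (intro conjI)
      show "inn torus (fourier u) (\<lambda>\<theta>. \<Sum>i\<in>I. complex_of_real (m i \<theta>) * ?B \<theta>) + inn torus ?A (\<lambda>\<theta>. \<Sum>i\<in>I. complex_of_real (m i \<theta>) * fourier v \<theta>)
        = inn torus (fourier u) (\<lambda>\<theta>. \<Sum>i\<in>I. complex_of_real (m' i \<theta>) * fourier v \<theta>)"
        using s[OF L(1) q(1)] s[OF L(3) q(2)] s[OF L(1) q(3)] q(4) by (simp add: sum.distrib[symmetric])
    qed (use q in \<open>auto intro!: L2_sum\<close>)
  qed
  have Q_power: "Q (\<lambda>\<theta>. cos_sym j \<theta> ^ k) (\<lambda>\<theta>. - 2 * sign (r $ j) * real k * (cos_sym j \<theta> ^ k - cos_sym j \<theta> ^ Suc k))" for j k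
  proof -
    have m: "(\<lambda>\<theta>. cos_sym j \<theta> ^ k) \<in> borel_measurable torus" by measurable
    have d: "\<bar>cos_sym j \<theta> ^ k - cos_sym j \<theta> ^ Suc k\<bar> \<le> 1" for \<theta>
    proof -
      have "cos_sym j \<theta> ^ k - cos_sym j \<theta> ^ Suc k = cos_sym j \<theta> ^ k * (1 - cos_sym j \<theta>)" by (simp add: algebra_simps)
      then show ?thesis using cos_sym_power_bounds[of j \<theta> k] cos_sym_bounds[of j \<theta>] by (simp add: abs_mult mult_le_one)
    qed
    have dL: "(\<lambda>\<theta>. complex_of_real (cos_sym j \<theta> ^ k - cos_sym j \<theta> ^ Suc k) * fourier v \<theta>) \<in> L2 torus"
      by (rule L2_unit_mult[OF L(2) _ d]) measurable
    have eq: "(\<lambda>\<theta>. complex_of_real (- 2 * sign (r $ j) * real k * (cos_sym j \<theta> ^ k - cos_sym j \<theta> ^ Suc k)) * fourier v \<theta>) =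
      (\<lambda>\<theta>. complex_of_real (- 2 * sign (r $ j) * real k) * (complex_of_real (cos_sym j \<theta> ^ k - cos_sym j \<theta> ^ Suc k) * fourier v \<theta>))"
      by (simp only: of_real_mult mult.assoc)
    show ?thesis
      unfolding Q_def eq inn_scale_right
      using form_identity_power[OF u v, of j k] L2_unit_mult[OF L(4) m cos_sym_power_bounds] L2_unit_mult[OF L(2) m cos_sym_power_bounds]
        L2_scale[OF dL] by blast
  qed
  have "Q (approx_symbol r N) (approx_comm r N)"
    unfolding approx_symbol_def[abs_def] approx_comm_def[abs_def] by (intro Q_sum Q_scale Q_power)
  then show ?thesis unfolding Q_def by blast
qed

text \<open>The limit of \<open>form_identity_approx\<close>. Only the multiplied vectors
  \<open>u\<close> and \<open>v\<close> need convergence, and both lie in the domain of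
  \<open>frac_laplacian\<close>; their images under the conjugate operator stay fixed.\<close>

lemma commutator_form_eq:
  fixes r :: "real^'d" and u v :: "int^'d \<Rightarrow> complex"
  assumes u: "u \<in> Domain (frac_laplacian r) \<inter> Domain (conj_op r)"
    and v: "v \<in> Domain (frac_laplacian r) \<inter> Domain (conj_op r)"
  shows "commutator_form (frac_laplacian r) (conj_op r) u v =
    inn torus (fourier u) (comm_symbol r \<odot> fourier v)"
proof -
  obtain a b where a: "(u, a) \<in> conj_op r" and b: "(v, b) \<in> conj_op r" using u v by blast
  let ?B = "fourier (\<lambda>n. \<i> * b n)" and ?A = "fourier (\<lambda>n. \<i> * a n)" and ?U = "fourier u" and ?V = "fourier v"
  let ?\<phi> = "frac_symbol r"
  have e: "u \<in> ell2" "v \<in> ell2" "a \<in> ell2" "b \<in> ell2"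
    using a b by (auto elim!: conj_op_cases)
  have L: "?U \<in> L2 torus" "?V \<in> L2 torus" "?A \<in> L2 torus" "?B \<in> L2 torus"
    using e by (auto intro!: fourier_L2 ell2_scale)
  note \<phi>m = frac_symbol_measurable[of r]
  have dom: "(?\<phi> \<odot> fourier w) \<in> L2 torus"
    "app (frac_laplacian r) w = inv_fourier (?\<phi> \<odot> fourier w)"
    if "w \<in> Domain (frac_laplacian r)" "w \<in> ell2" for w
  proof -
    have w: "inv_fourier (fourier w) = w" "fourier w \<in> L2 torus" using that by (simp_all add: inv_fourier_fourier fourier_L2)
    show 1: "(?\<phi> \<odot> fourier w) \<in> L2 torus"
      using that(1) Domain_fourier_mult_iff[OF w(2) \<phi>m] unfolding frac_laplacian_def w(1) by blast
    show "app (frac_laplacian r) w = inv_fourier (?\<phi> \<odot> fourier w)"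
      using app_fourier_mult[OF w(2) \<phi>m 1] unfolding frac_laplacian_def w(1) .
  qed
  have U\<phi>: "(?\<phi> \<odot> ?U) \<in> L2 torus" and V\<phi>: "(?\<phi> \<odot> ?V) \<in> L2 torus"
    using dom u v e by auto
  have AB: "(\<lambda>n. \<i> * app (conj_op r) u n) = inv_fourier ?A" "(\<lambda>n. \<i> * app (conj_op r) v n) = inv_fourier ?B"
    using e by (simp_all add: app_conj_op[OF a] app_conj_op[OF b] inv_fourier_fourier)
  have lhs: "commutator_form (frac_laplacian r) (conj_op r) u v =
     inn torus (?\<phi> \<odot> ?U) ?B + inn torus ?A (?\<phi> \<odot> ?V)"
    unfolding commutator_form_def AB using dom(2)[of u] dom(2)[of v] u v e
    by (simp add: ip_inv_fourier[OF U\<phi> L(4)] ip_inv_fourier[OF L(3) V\<phi>])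
  obtain C where C: "C \<ge> 0" "\<And>\<theta> N. \<forall>j. cos_sym j \<theta> < 1 \<Longrightarrow>
    \<bar>approx_symbol r N \<theta>\<bar> \<le> C * (1 + frac_symbol r \<theta>) \<and> \<bar>approx_comm r N \<theta>\<bar> \<le> C * (1 + frac_symbol r \<theta>)"
    using approx_bound[of r] by blast
  have conv: "L2lim torus (\<lambda>N \<theta>. complex_of_real (approx_symbol r N \<theta>) * w \<theta>) (?\<phi> \<odot> w)"
     "L2lim torus (\<lambda>N \<theta>. complex_of_real (approx_comm r N \<theta>) * w \<theta>) (comm_symbol r \<odot> w)"
     "(comm_symbol r \<odot> w) \<in> L2 torus"
     "\<And>N. (approx_symbol r N \<odot> w) \<in> L2 torus"
     "\<And>N. (approx_comm r N \<odot> w) \<in> L2 torus"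
    if w: "w \<in> L2 torus" "(?\<phi> \<odot> w) \<in> L2 torus" for w
  proof -
    have [measurable]: "w \<in> borel_measurable torus" using w(1) by (rule L2_measurable)
    \<comment> \<open>The majorant \<open>C (1 + \<phi>) |w|\<close>, square integrable because
      \<open>w\<close> is in the domain of multiplication by \<phi>.\<close>
    define W where "W = (\<lambda>\<theta>. complex_of_real C * (w \<theta> + complex_of_real (?\<phi> \<theta>) * w \<theta>))"
    have W: "W \<in> L2 torus" unfolding W_def by (intro L2_scale L2_add w)
    have Wn: "cmod (W \<theta>) = C * (1 + ?\<phi> \<theta>) * cmod (w \<theta>)" for \<theta>
    proof -
      have "W \<theta> = complex_of_real (C * (1 + ?\<phi> \<theta>)) * w \<theta>" by (simp add: W_def algebra_simps)
      moreover have "\<bar>C * (1 + ?\<phi> \<theta>)\<bar> = C * (1 + ?\<phi> \<theta>)"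
        by (rule abs_of_nonneg, rule mult_nonneg_nonneg[OF C(1)]) simp
      ultimately show ?thesis by (simp only: norm_mult norm_of_real)
    qed
    have b1: "AE \<theta> in torus. cmod (complex_of_real (approx_symbol r N \<theta>) * w \<theta>) \<le> cmod (W \<theta>)" for N
      using AE_cos_sym_less by eventually_elim (use C(2) in \<open>auto simp: Wn norm_mult intro!: mult_right_mono\<close>)
    have b2: "AE \<theta> in torus. cmod (complex_of_real (approx_comm r N \<theta>) * w \<theta>) \<le> cmod (W \<theta>)" for N
      using AE_cos_sym_less by eventually_elim (use C(2) in \<open>auto simp: Wn norm_mult intro!: mult_right_mono\<close>)
    have t1: "AE \<theta> in torus. (\<lambda>N. complex_of_real (approx_symbol r N \<theta>) * w \<theta>) \<longlonglongrightarrow> complex_of_real (?\<phi> \<theta>) * w \<theta>"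
      using AE_cos_sym_less by eventually_elim (intro tendsto_mult tendsto_of_real approx_tendsto tendsto_const)
    have t2: "AE \<theta> in torus. (\<lambda>N. complex_of_real (approx_comm r N \<theta>) * w \<theta>) \<longlonglongrightarrow> complex_of_real (comm_symbol r \<theta>) * w \<theta>"
      using AE_cos_sym_less by eventually_elim (intro tendsto_mult tendsto_of_real approx_tendsto tendsto_const)
    show "L2lim torus (\<lambda>N \<theta>. complex_of_real (approx_symbol r N \<theta>) * w \<theta>) (?\<phi> \<odot> w)"
      by (rule L2lim_dominated_convergence(2)[OF _ _ W b1 t1]) measurable
    show "L2lim torus (\<lambda>N \<theta>. complex_of_real (approx_comm r N \<theta>) * w \<theta>) (comm_symbol r \<odot> w)"
      by (rule L2lim_dominated_convergence(2)[OF _ _ W b2 t2]) measurable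
    show "(comm_symbol r \<odot> w) \<in> L2 torus"
      by (rule L2lim_dominated_convergence(1)[OF _ _ W b2 t2]) measurable
    show "(approx_symbol r N \<odot> w) \<in> L2 torus" for N
      by (rule L2_dominated[OF W, where C = 1]) (use b1 in auto)
    show "(approx_comm r N \<odot> w) \<in> L2 torus" for N
      by (rule L2_dominated[OF W, where C = 1]) (use b2 in auto)
  qed
  note cU = conv[OF L(1) U\<phi>] and cV = conv[OF L(2) V\<phi>]
  have 1: "(\<lambda>N. inn torus (approx_symbol r N \<odot> ?U) ?B) \<longlonglongrightarrow> inn torus (?\<phi> \<odot> ?U) ?B"
    by (rule L2lim_inn[OF cU(4) L(4) U\<phi> L(4) cU(1) L2lim_const])
  have 2: "(\<lambda>N. inn torus ?A (approx_symbol r N \<odot> ?V)) \<longlonglongrightarrow> inn torus ?A (?\<phi> \<odot> ?V)"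
    by (rule L2lim_inn[OF L(3) cV(4) L(3) V\<phi> L2lim_const cV(1)])
  have 3: "(\<lambda>N. inn torus ?U (approx_comm r N \<odot> ?V)) \<longlonglongrightarrow> inn torus ?U (comm_symbol r \<odot> ?V)"
    by (rule L2lim_inn[OF L(1) cV(5) L(1) cV(3) L2lim_const cV(2)])
  have "inn torus (?\<phi> \<odot> ?U) ?B + inn torus ?A (?\<phi> \<odot> ?V) =
     inn torus ?U (comm_symbol r \<odot> ?V)"
    \<comment> \<open>Real multipliers may change slots, which aligns the first inner product with
      the form used in \<open>form_identity_approx\<close>.\<close>
    using tendsto_add[OF 1 2] 3 unfolding inn_real_mult[symmetric] form_identity_approx[OF a b] by (rule LIMSEQ_unique)
  then show ?thesis unfolding lhs .
qed

text \<open>In the variables \<open>y\<^sub>j = (2 - 2 cos \<theta>\<^sub>j)\<^bsup>r\<^sub>j\<^esup>\<close> the set where the symbol lies in \<open>{a..b}\<close> becomes compact and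
  the commutator symbol extends to a continuous function whose zeros are exactly the threshold configurations.\<close>

lemma comm_symbol_lower_bound:
  fixes r :: "real^'d"
  assumes thr: "{a..b} \<inter> thresholds r = {}"
  shows "\<exists>c>0. \<forall>\<theta>. (\<forall>j. cos_sym j \<theta> < 1) \<longrightarrow> frac_symbol r \<theta> \<in> {a..b} \<longrightarrow> c \<le> comm_symbol r \<theta>"
proof -
  \<comment> \<open>For a negative exponent \<open>y_j\<close> ranges over a half-line starting at
    \<open>4 powr (r $ j)\<close>; it is capped by \<open>b\<close> because all coordinates are
    nonnegative and their sum is at most \<open>b\<close>. For exponent 0 both bounds are 1.\<close>
  define lo hi :: "real^'d" where "lo = (\<chi> j. if r $ j > 0 then 0 else 4 powr (r $ j))"
    and "hi = (\<chi> j. if r $ j < 0 then b else 4 powr (r $ j))"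
  define K where "K = cbox lo hi \<inter> {y. (\<Sum>j\<in>UNIV. y $ j) \<in> {a..b}}"
  \<comment> \<open>The power \<open>1 / r_j\<close> recovers \<open>x_j\<close> from
    \<open>y_j\<close>. It is continuous at \<open>y_j = 0\<close>, which occurs only for
    \<open>r_j > 0\<close>. For \<open>r_j = 0\<close> the factor \<open>|r_j|\<close> removes the
    term.\<close>
  define F where "F y = (\<Sum>j\<in>UNIV. \<bar>r $ j\<bar> / 2 * ((4 - y $ j powr (1 / r $ j)) * y $ j))" for y :: "real^'d"
  have "closed ({y::real^'d. a \<le> (\<Sum>j\<in>UNIV. y $ j)} \<inter> {y. (\<Sum>j\<in>UNIV. y $ j) \<le> b})"
    by (intro closed_Int closed_Collect_le continuous_intros)
  also have "{y::real^'d. a \<le> (\<Sum>j\<in>UNIV. y $ j)} \<inter> {y. (\<Sum>j\<in>UNIV. y $ j) \<le> b} = {y. (\<Sum>j\<in>UNIV. y $ j) \<in> {a..b}}" by auto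
  finally have K: "compact K" unfolding K_def by (intro compact_Int_closed compact_cbox)
  have inK: "lo $ j \<le> y $ j \<and> y $ j \<le> hi $ j" if "y \<in> K" for y j
    using that by (auto simp: K_def mem_box_cart)
  have y0: "0 \<le> y $ j" and y1: "r $ j \<le> 0 \<Longrightarrow> 0 < y $ j" if "y \<in> K" for y j
  proof -
    have p: "0 < (4::real) powr (r $ j)" by simp
    show pos: "0 < y $ j" if "r $ j \<le> 0"
    proof -
      have "4 powr (r $ j) \<le> y $ j" using inK[OF \<open>y \<in> K\<close>, of j] that by (simp add: lo_def)
      then show ?thesis by (rule less_le_trans[OF p])
    qed
    show "0 \<le> y $ j"
    proof (cases "r $ j \<le> 0")
      case True
      then show ?thesis using pos by simp
    next
      case False
      then show ?thesis using inK[OF \<open>y \<in> K\<close>, of j] by (simp add: lo_def)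
    qed
  qed
  have Fc: "continuous_on K F"
    unfolding F_def
  proof (intro continuous_on_sum continuous_on_mult continuous_on_const continuous_on_diff continuous_on_powr')
    fix j
    show "\<forall>y\<in>K. 0 \<le> y $ j \<and> (y $ j = 0 \<longrightarrow> 0 < 1 / r $ j)"
      using y0 y1 by (metis less_irrefl not_le zero_less_divide_1_iff)
  qed (intro continuous_intros)+
  have root: "(4 powr s) powr (1 / s) = 4" if "s \<noteq> 0" for s :: real using that by (simp add: powr_powr)
  have le4: "y $ j powr (1 / r $ j) \<le> 4" if y: "y \<in> K" and j: "r $ j \<noteq> 0" for y j
  proof (cases "r $ j > 0")
    case True
    then have "y $ j powr (1 / r $ j) \<le> (4 powr (r $ j)) powr (1 / r $ j)"
      using inK[OF y, of j] y0[OF y, of j] by (intro powr_mono2) (auto simp: hi_def)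
    then show ?thesis by (simp add: root[OF j])
  next
    case False
    then have "y $ j powr (1 / r $ j) \<le> (4 powr (r $ j)) powr (1 / r $ j)"
      using inK[OF y, of j] j by (intro powr_mono2') (auto simp: lo_def)
    then show ?thesis by (simp add: root[OF j])
  qed
  have tnn: "0 \<le> \<bar>r $ j\<bar> / 2 * ((4 - y $ j powr (1 / r $ j)) * y $ j)" if y: "y \<in> K" for y j
    using le4[OF y, of j] y0[OF y, of j] by (cases "r $ j = 0") auto
  have pos: "0 < F y" if y: "y \<in> K" for y
  proof (rule ccontr)
    assume "\<not> 0 < F y"
    moreover have "0 \<le> F y" unfolding F_def by (rule sum_nonneg) (rule tnn[OF y])
    ultimately have "F y = 0" by simp
    then have z: "\<bar>r $ j\<bar> / 2 * ((4 - y $ j powr (1 / r $ j)) * y $ j) = 0" for j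
      unfolding F_def using sum_nonneg_eq_0_iff[of UNIV "\<lambda>j. \<bar>r $ j\<bar> / 2 * ((4 - y $ j powr (1 / r $ j)) * y $ j)"] tnn[OF y] by simp
    have val: "y $ j = 4 powr (r $ j) \<or> (r $ j > 0 \<and> y $ j = 0)" for j
    proof (cases "r $ j = 0")
      case True
      then show ?thesis using inK[OF y, of j] by (simp add: lo_def hi_def)
    next
      case False
      show ?thesis
      proof (cases "y $ j = 0")
        case True
        then show ?thesis using y1[OF y, of j] by force
      next
        case ne: False
        then have "y $ j powr (1 / r $ j) = 4" using z[of j] False by simp
        then have "(y $ j powr (1 / r $ j)) powr (r $ j) = 4 powr (r $ j)" by simp
        then show ?thesis using False ne y0[OF y, of j] by (simp add: powr_powr)
      qed
    qed
    \<comment> \<open>Records which coordinates with positive exponent sit at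
      \<open>x_j = 4\<close>, the others sitting at \<open>x_j = 0\<close>; with it a zero of
      \<open>F\<close> exhibits the value of the symbol as a threshold.\<close>
    define \<epsilon> where "\<epsilon> j = (if r $ j > 0 \<and> y $ j \<noteq> 0 then 1 else 0 :: real)" for j
    have "(\<Sum>j\<in>UNIV. y $ j) = (\<Sum>j\<in>UNIV. (if r $ j < 0 then 4 powr (r $ j) else 0) + (if r $ j = 0 then 1 else 0)
        + (if r $ j > 0 then \<epsilon> j * 4 powr (r $ j) else 0))"
    proof (rule sum.cong[OF refl])
      fix j
      show "y $ j = (if r $ j < 0 then 4 powr (r $ j) else 0) + (if r $ j = 0 then 1 else 0)
        + (if r $ j > 0 then \<epsilon> j * 4 powr (r $ j) else 0)"
        using val[of j] by (auto simp: \<epsilon>_def)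
    qed
    also have "\<dots> = (\<Sum>j | r $ j < 0. 4 powr (r $ j)) + real (card {j. r $ j = 0}) + (\<Sum>j | r $ j > 0. \<epsilon> j * 4 powr (r $ j))"
      by (simp add: sum.distrib sum.If_cases)
    finally have sum_eq: "(\<Sum>j\<in>UNIV. y $ j) = (\<Sum>j | r $ j < 0. 4 powr (r $ j)) + real (card {j. r $ j = 0}) + (\<Sum>j | r $ j > 0. \<epsilon> j * 4 powr (r $ j))" .
    have "\<forall>j. \<epsilon> j \<in> {0, 1}" by (simp add: \<epsilon>_def)
    with sum_eq have "(\<Sum>j\<in>UNIV. y $ j) \<in> thresholds r"
      unfolding thresholds_def mem_Collect_eq by (intro exI conjI)
    moreover have "(\<Sum>j\<in>UNIV. y $ j) \<in> {a..b}" using y by (simp add: K_def)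
    ultimately show False using thr by blast
  qed
  have "\<exists>c>0. \<forall>y\<in>K. c \<le> F y"
  proof (cases "K = {}")
    case False
    obtain z where "z \<in> K" "\<forall>y\<in>K. F z \<le> F y" using continuous_attains_inf[OF K False Fc] by blast
    then show ?thesis using pos by blast
  qed (auto intro: exI[of _ 1])
  then obtain c where c: "c > 0" "\<And>y. y \<in> K \<Longrightarrow> c \<le> F y" by blast
  have "c \<le> comm_symbol r \<theta>" if t: "\<forall>j. cos_sym j \<theta> < 1" and ab: "frac_symbol r \<theta> \<in> {a..b}" for \<theta>
  proof -
    define y :: "real^'d" where "y = (\<chi> j. frac_term r j \<theta>)"
    have x: "0 < 4 * (1 - cos_sym j \<theta>)" "4 * (1 - cos_sym j \<theta>) \<le> 4" for j using t cos_sym_bounds[of j \<theta>] by auto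
    have ft: "frac_term r j \<theta> = (4 * (1 - cos_sym j \<theta>)) powr (r $ j)" for j
      unfolding frac_term_def by (rule powr_mult[symmetric])
    have "y \<in> K"
      unfolding K_def
    proof
      show "y \<in> cbox lo hi"
      proof (unfold mem_box_cart, intro allI conjI)
        fix j
        show "lo $ j \<le> y $ j"
        proof (cases "r $ j > 0")
          case False
          then have "4 powr (r $ j) \<le> (4 * (1 - cos_sym j \<theta>)) powr (r $ j)" using x[of j] by (intro powr_mono2') auto
          then show ?thesis using False by (simp add: lo_def y_def ft)
        qed (simp add: lo_def y_def)
        show "y $ j \<le> hi $ j"
        proof (cases "r $ j < 0")
          case True
          then show ?thesis using frac_term_le_symbol[of r j \<theta>] ab by (simp add: hi_def y_def)
        next
          case False
          then have "(4 * (1 - cos_sym j \<theta>)) powr (r $ j) \<le> 4 powr (r $ j)" using x[of j] by (intro powr_mono2) auto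
          then show ?thesis using False by (simp add: hi_def y_def ft)
        qed
      qed
      show "y \<in> {y. (\<Sum>j\<in>UNIV. y $ j) \<in> {a..b}}" using ab by (simp add: y_def frac_symbol_eq)
    qed
    then have "c \<le> F y" by (rule c(2))
    also have "F y = comm_symbol r \<theta>"
      unfolding F_def comm_symbol_def
    proof (rule sum.cong[OF refl])
      fix j
      have "y $ j powr (1 / r $ j) = 4 * (1 - cos_sym j \<theta>)" if "r $ j \<noteq> 0"
        using that x[of j] by (simp only: y_def vec_lambda_beta ft powr_powr) simp
      then show "\<bar>r $ j\<bar> / 2 * ((4 - y $ j powr (1 / r $ j)) * y $ j) = 2 * \<bar>r $ j\<bar> * cos_sym j \<theta> * frac_term r j \<theta>"
        by (cases "r $ j = 0") (simp_all add: y_def)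
    qed
    finally show ?thesis .
  qed
  then show ?thesis using c(1) by blast
qed

section \<open>Approximation in the graph norm\<close>

lemma fin_supp_inv_fourier_trig_sum: "finite S \<Longrightarrow> fin_supp (inv_fourier (trig_sum a S))"
  unfolding fin_supp_def by (rule finite_subset[of _ S]) (auto simp: inv_fourier_trig_sum split: if_splits)

text \<open>A polynomial in the \<open>cos_sym j\<close>, so it preserves finite support, and it
  vanishes to high order where negative powers blow up.\<close>

definition weight :: "nat \<Rightarrow> 'd set \<Rightarrow> real^'d \<Rightarrow> real" where
  "weight m J \<theta> = (\<Prod>j\<in>J. (1 - cos_sym j \<theta>) ^ m)"

lemma weight_bounds: "0 \<le> weight m J \<theta>" "weight m J \<theta> \<le> 1"
  unfolding weight_def using cos_sym_bounds by (auto intro!: prod_nonneg prod_le_1 power_le_one zero_le_power)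

lemma weight_measurable [measurable]: "weight m J \<in> borel_measurable torus"
  unfolding weight_def by measurable

lemma fin_supp_weight:
  fixes g :: "real^'d \<Rightarrow> complex"
  assumes g: "g \<in> L2 torus" "fin_supp (inv_fourier g)"
  shows "(weight m J \<odot> g) \<in> L2 torus \<and> fin_supp (inv_fourier (weight m J \<odot> g))"
proof -
  have one: "(\<lambda>\<theta>. complex_of_real (1 - cos_sym j \<theta>) * g \<theta>) \<in> L2 torus \<and> fin_supp (inv_fourier (\<lambda>\<theta>. complex_of_real (1 - cos_sym j \<theta>) * g \<theta>))"
    if g: "g \<in> L2 torus" "fin_supp (inv_fourier g)" for g :: "real^'d \<Rightarrow> complex" and j
  proof -
    have c: "(cos_sym j \<odot> g) \<in> L2 torus"
      by (rule L2_unit_mult[OF g(1)]) (use cos_sym_power_bounds[of j _ 1] in auto)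
    have eq: "(\<lambda>\<theta>. complex_of_real (1 - cos_sym j \<theta>) * g \<theta>) = (\<lambda>\<theta>. g \<theta> - complex_of_real (cos_sym j \<theta>) * g \<theta>)"
      by (simp add: left_diff_distrib)
    show ?thesis
      unfolding eq inv_fourier_diff[OF g(1) c] cos_op_inv_fourier[OF g(1), symmetric]
      using g c by (intro conjI L2_diff fin_supp_diff fin_supp_cos_op)
  qed
  have pow: "(\<lambda>\<theta>. complex_of_real ((1 - cos_sym j \<theta>) ^ k) * g \<theta>) \<in> L2 torus \<and> fin_supp (inv_fourier (\<lambda>\<theta>. complex_of_real ((1 - cos_sym j \<theta>) ^ k) * g \<theta>))"
    if g: "g \<in> L2 torus" "fin_supp (inv_fourier g)" for g :: "real^'d \<Rightarrow> complex" and j k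
  proof (induction k)
    case (Suc k)
    then show ?case using one[of "\<lambda>\<theta>. complex_of_real ((1 - cos_sym j \<theta>) ^ k) * g \<theta>" j]
      by (simp only: power_Suc of_real_mult mult.assoc)
  qed (use g in simp)
  show ?thesis
    unfolding weight_def
  proof (induction J rule: infinite_finite_induct)
    case (insert j J)
    have "(\<lambda>\<theta>. complex_of_real (\<Prod>i\<in>insert j J. (1 - cos_sym i \<theta>) ^ m) * g \<theta>) =
      (\<lambda>\<theta>. complex_of_real ((1 - cos_sym j \<theta>) ^ m) * (complex_of_real (\<Prod>i\<in>J. (1 - cos_sym i \<theta>) ^ m) * g \<theta>))"
      unfolding prod.insert[OF insert(1,2)] of_real_mult mult.assoc ..
    then show ?case using pow[of "\<lambda>\<theta>. complex_of_real (\<Prod>i\<in>J. (1 - cos_sym i \<theta>) ^ m) * g \<theta>" j m] insert(3) by simp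
  qed (use g in auto)
qed

lemma L2lim_trans:
  assumes A: "\<And>k. A k \<in> L2 M" and B: "\<And>k. B k \<in> L2 M" and f: "f \<in> L2 M"
    and lim: "L2lim M A f" and diff: "(\<lambda>k. sqn M (\<lambda>x. B k x - A k x)) \<longlonglongrightarrow> 0"
  shows "L2lim M B f"
  unfolding L2lim_def
proof (rule Lim_null_comparison)
  show "(\<lambda>k. 2 * sqn M (\<lambda>x. B k x - A k x) + 2 * sqn M (\<lambda>x. A k x - f x)) \<longlonglongrightarrow> 0"
    using lim diff by (auto simp: L2lim_def intro!: tendsto_eq_intros)
  have "sqn M (\<lambda>x. B k x - f x) \<le> 2 * sqn M (\<lambda>x. B k x - A k x) + 2 * sqn M (\<lambda>x. A k x - f x)" for k
    using sqn_add_le[OF L2_diff[OF B[of k] A[of k]] L2_diff[OF A[of k] f]] by simp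
  then show "\<forall>\<^sub>F k in sequentially. norm (sqn M (\<lambda>x. B k x - f x)) \<le> 2 * sqn M (\<lambda>x. B k x - A k x) + 2 * sqn M (\<lambda>x. A k x - f x)"
    by simp
qed

text \<open>Approximate a truncation of \<open>g / w\<close> by trigonometric polynomials
  \<open>p M\<close> and take \<open>w * p M\<close>. Since \<open>w\<close> and \<open>w\<close>
  times the symbol are bounded, the error of \<open>p M\<close> in \<open>L2\<close> controls the
  error in the graph norm.\<close>

lemma graph_approx_exists:
  fixes r :: "real^'d"
  assumes g: "g \<in> L2 torus" and \<phi>g: "(frac_symbol r \<odot> g) \<in> L2 torus"
  shows "\<exists>F. graph_approx (frac_laplacian r) (Domain (frac_laplacian r) \<inter> Domain (conj_op r)) F (inv_fourier g)"
proof -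
  let ?\<phi> = "frac_symbol r"
  note \<phi>m = frac_symbol_measurable[of r]
  \<comment> \<open>Any order at least every \<open>|r $ j|\<close> works: it makes
    \<open>(1 - t_j) powr (m + r_j)\<close> bounded by 1.\<close>
  define m where "m = nat \<lceil>\<Sum>j\<in>UNIV. \<bar>r $ j\<bar>\<rceil>"
  have m: "0 \<le> real m + r $ j" for j
  proof -
    have "\<bar>r $ j\<bar> \<le> (\<Sum>j\<in>UNIV. \<bar>r $ j\<bar>)" by (rule member_le_sum) auto
    also have "\<dots> \<le> real m" unfolding m_def by linarith
    finally show ?thesis by linarith
  qed
  define w where "w = weight m {j. r $ j < 0}"
  have wb: "0 \<le> w \<theta>" "w \<theta> \<le> 1" for \<theta> unfolding w_def by (rule weight_bounds)+
  have wm [measurable]: "w \<in> borel_measurable torus" unfolding w_def by measurable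
  have wpos: "0 < w \<theta>" if "\<forall>j. cos_sym j \<theta> < 1" for \<theta>
    unfolding w_def weight_def using that by (intro prod_pos) auto
  define C where "C = (\<Sum>j\<in>UNIV. 4 powr (r $ j))"
  have w\<phi>: "0 \<le> ?\<phi> \<theta> * w \<theta>" "?\<phi> \<theta> * w \<theta> \<le> C" for \<theta>
  proof -
    show "0 \<le> ?\<phi> \<theta> * w \<theta>" using wb by simp
    show "?\<phi> \<theta> * w \<theta> \<le> C"
      unfolding frac_symbol_eq C_def sum_distrib_right
    proof (rule sum_mono)
      fix j
      let ?s = "1 - cos_sym j \<theta>"
      have s: "0 \<le> ?s" "?s \<le> 1" using cos_sym_bounds[of j \<theta>] by auto
      have "?s powr (r $ j) * w \<theta> \<le> 1"
      proof (cases "r $ j < 0")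
        case True
        have "w \<theta> = ?s ^ m * (\<Prod>i\<in>{j. r $ j < 0} - {j}. (1 - cos_sym i \<theta>) ^ m)"
          unfolding w_def weight_def using True by (subst prod.remove[of _ j]) auto
        also have "\<dots> \<le> ?s ^ m * 1"
          using s cos_sym_bounds by (intro mult_left_mono prod_le_1 conjI power_le_one) auto
        finally have "?s powr (r $ j) * w \<theta> \<le> ?s powr (r $ j) * ?s ^ m" by (simp add: mult_left_mono)
        also have "\<dots> \<le> 1"
        proof (cases "?s = 0")
          case False
          then have "?s powr (r $ j) * ?s ^ m = ?s powr (real m + r $ j)"
            using s by (simp add: powr_realpow[symmetric] powr_add mult.commute)
          also have "\<dots> \<le> 1" using s m[of j] by (intro powr_le1) auto
          finally show ?thesis .
        qed simp
        finally show ?thesis .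
      next
        case False
        have "?s powr (r $ j) \<le> 1" using s False by (intro powr_le1) auto
        then show ?thesis using wb[of \<theta>] by (intro mult_le_one) auto
      qed
      then have "4 powr (r $ j) * (?s powr (r $ j) * w \<theta>) \<le> 4 powr (r $ j) * 1" by (intro mult_left_mono) auto
      then show "frac_term r j \<theta> * w \<theta> \<le> 4 powr (r $ j)" by (simp add: frac_term_def mult.assoc)
    qed
  qed
  \<comment> \<open>Truncation to the set where dividing by \<open>w\<close> is bounded by
    \<open>M + 1\<close>; almost every point is eventually in it.\<close>
  define cut where "cut M \<theta> = (if w \<theta> \<ge> inverse (real (Suc M)) then 1 else 0 :: real)" for M \<theta>
  have cut_meas [measurable]: "cut M \<in> borel_measurable torus" for M unfolding cut_def by measurable
  define h where "h M \<theta> = complex_of_real (cut M \<theta> / w \<theta>) * g \<theta>" for M \<theta>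
  have h: "h M \<in> L2 torus" for M
    unfolding h_def
  proof (rule L2_bounded_mult[OF g, where C = "real (Suc M)"])
    fix \<theta>
    show "cmod (complex_of_real (cut M \<theta> / w \<theta>)) \<le> real (Suc M)"
    proof (cases "w \<theta> \<ge> inverse (real (Suc M))")
      case True
      then have "inverse (w \<theta>) \<le> real (Suc M)" using le_imp_inverse_le[OF True] by simp
      then show ?thesis using True wb[of \<theta>] by (simp add: cut_def divide_inverse norm_inverse del: of_nat_Suc)
    qed (simp add: cut_def)
  qed measurable
  have "\<exists>S. finite S \<and> sqn torus (\<lambda>\<theta>. trig_sum (inv_fourier (h M)) S \<theta> - h M \<theta>) < inverse (real (Suc M))" for M
  proof -
    obtain S where S: "\<And>k. finite (S k)" "L2lim torus (\<lambda>k. trig_sum (inv_fourier (h M)) (S k)) (h M)"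
      using trig_sum_approx[OF h] by blast
    have "\<forall>\<^sub>F k in sequentially. sqn torus (\<lambda>\<theta>. trig_sum (inv_fourier (h M)) (S k) \<theta> - h M \<theta>) < inverse (real (Suc M))"
      using S(2) unfolding L2lim_def by (rule order_tendstoD) simp
    then show ?thesis using S(1) by (auto simp: eventually_sequentially)
  qed
  then obtain S where S: "\<And>M. finite (S M)" "\<And>M. sqn torus (\<lambda>\<theta>. trig_sum (inv_fourier (h M)) (S M) \<theta> - h M \<theta>) < inverse (real (Suc M))"
    by metis
  define p where "p M = trig_sum (inv_fourier (h M)) (S M)" for M
  have p: "p M \<in> L2 torus" for M by (simp add: p_def)
  have ph: "(\<lambda>M. sqn torus (\<lambda>\<theta>. p M \<theta> - h M \<theta>)) \<longlonglongrightarrow> 0"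
  proof (rule Lim_null_comparison)
    show "\<forall>\<^sub>F M in sequentially. norm (sqn torus (\<lambda>\<theta>. p M \<theta> - h M \<theta>)) \<le> inverse (real (Suc M))"
    proof (intro always_eventually allI)
      fix M
      show "norm (sqn torus (\<lambda>\<theta>. p M \<theta> - h M \<theta>)) \<le> inverse (real (Suc M))"
        using less_imp_le[OF S(2)[of M]] by (simp add: p_def)
    qed
  qed (rule LIMSEQ_inverse_real_of_nat)
  have cut_lim: "AE \<theta> in torus. (\<lambda>M. cut M \<theta>) \<longlonglongrightarrow> 1"
    using AE_cos_sym_less
  proof eventually_elim
    case (elim \<theta>)
    obtain M0 where M0: "inverse (real (Suc M0)) < w \<theta>" using reals_Archimedean[OF wpos[OF elim]] by blast
    have "cut M \<theta> = 1" if "M \<ge> M0" for M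
    proof -
      have "inverse (real (Suc M)) \<le> inverse (real (Suc M0))" using that by (simp add: le_imp_inverse_le)
      from order_trans[OF this less_imp_le[OF M0]] show ?thesis by (simp add: cut_def)
    qed
    then show ?case by (intro tendsto_eventually) (auto simp: eventually_sequentially intro!: exI[of _ M0])
  qed
  \<comment> \<open>Used twice, with \<open>q = 1\<close> for convergence of the vectors and with
    \<open>q\<close> the symbol for convergence of their images.\<close>
  have lim: "L2lim torus (\<lambda>M \<theta>. complex_of_real (q \<theta> * w \<theta>) * p M \<theta>) (q \<odot> g)"
    and mem: "\<And>M. (\<lambda>\<theta>. complex_of_real (q \<theta> * w \<theta>) * p M \<theta>) \<in> L2 torus"
    if qm [measurable]: "q \<in> borel_measurable torus" and qb: "\<And>\<theta>. \<bar>q \<theta> * w \<theta>\<bar> \<le> B" and qg: "(q \<odot> g) \<in> L2 torus" for q B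
  proof -
    have [measurable]: "g \<in> borel_measurable torus" using g by (rule L2_measurable)
    have qw: "(\<lambda>\<theta>. complex_of_real (q \<theta> * w \<theta>) * f \<theta>) \<in> L2 torus" if "f \<in> L2 torus" for f
    proof (rule L2_bounded_mult[OF that, where C = B])
      show "cmod (complex_of_real (q \<theta> * w \<theta>)) \<le> B" for \<theta> using qb by (simp only: norm_of_real)
    qed measurable
    show "(\<lambda>\<theta>. complex_of_real (q \<theta> * w \<theta>) * p M \<theta>) \<in> L2 torus" for M by (rule qw[OF p])
    show "L2lim torus (\<lambda>M \<theta>. complex_of_real (q \<theta> * w \<theta>) * p M \<theta>) (q \<odot> g)"
    proof (rule L2lim_trans[where A = "\<lambda>M \<theta>. complex_of_real (q \<theta> * w \<theta>) * h M \<theta>"])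
      have hm [measurable]: "h M \<in> borel_measurable torus" for M using h by (rule L2_measurable)
      \<comment> \<open>Multiplying back by \<open>w\<close> undoes the division; where
        \<open>w\<close> vanishes the cutoff does too.\<close>
      have eq: "complex_of_real (q \<theta> * w \<theta>) * h M \<theta> = complex_of_real (cut M \<theta>) * (complex_of_real (q \<theta>) * g \<theta>)"
        for M \<theta>
      proof (cases "w \<theta> = 0")
        case True
        then show ?thesis by (simp add: h_def cut_def)
      qed (simp add: h_def)
      show "L2lim torus (\<lambda>M \<theta>. complex_of_real (q \<theta> * w \<theta>) * h M \<theta>) (q \<odot> g)"
        unfolding eq
      proof (rule L2lim_dominated_convergence(2)[OF _ _ qg])
        show "AE \<theta> in torus. cmod (complex_of_real (cut M \<theta>) * (complex_of_real (q \<theta>) * g \<theta>)) \<le> cmod (complex_of_real (q \<theta>) * g \<theta>)" for M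
          by (rule AE_I2) (simp add: cut_def)
        show "AE \<theta> in torus. (\<lambda>M. complex_of_real (cut M \<theta>) * (complex_of_real (q \<theta>) * g \<theta>)) \<longlonglongrightarrow> complex_of_real (q \<theta>) * g \<theta>"
          using cut_lim
        proof eventually_elim
          case (elim \<theta>)
          from tendsto_mult[OF tendsto_of_real[OF elim] tendsto_const[of "complex_of_real (q \<theta>) * g \<theta>"]]
          show ?case by simp
        qed
      qed measurable
      have le: "sqn torus (\<lambda>\<theta>. complex_of_real (q \<theta> * w \<theta>) * p M \<theta> - complex_of_real (q \<theta> * w \<theta>) * h M \<theta>) \<le>
          B\<^sup>2 * sqn torus (\<lambda>\<theta>. p M \<theta> - h M \<theta>)" for M
      proof -
        have "sqn torus (\<lambda>\<theta>. complex_of_real (q \<theta> * w \<theta>) * p M \<theta> - complex_of_real (q \<theta> * w \<theta>) * h M \<theta>) \<le>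
          sqn torus (\<lambda>\<theta>. complex_of_real B * (p M \<theta> - h M \<theta>))"
        proof (rule sqn_mono_AE[OF L2_scale[OF L2_diff[OF p h]] L2_diff[OF qw[OF p] qw[OF h]]], rule AE_I2)
          fix \<theta>
          show "cmod (complex_of_real (q \<theta> * w \<theta>) * p M \<theta> - complex_of_real (q \<theta> * w \<theta>) * h M \<theta>) \<le> cmod (complex_of_real B * (p M \<theta> - h M \<theta>))"
            unfolding right_diff_distrib[symmetric] norm_mult norm_of_real
            using qb[of \<theta>] by (intro mult_right_mono) auto
        qed
        then show ?thesis by (simp add: sqn_scale)
      qed
      show "(\<lambda>M. sqn torus (\<lambda>\<theta>. complex_of_real (q \<theta> * w \<theta>) * p M \<theta> - complex_of_real (q \<theta> * w \<theta>) * h M \<theta>)) \<longlonglongrightarrow> 0"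
      proof (rule Lim_null_comparison)
        show "(\<lambda>M. B\<^sup>2 * sqn torus (\<lambda>\<theta>. p M \<theta> - h M \<theta>)) \<longlonglongrightarrow> 0"
          using tendsto_mult[OF tendsto_const[of "B\<^sup>2"] ph] by simp
      qed (use le in auto)
    qed (use qw p h qg in auto)
  qed
  define F where "F M = inv_fourier (w \<odot> p M)" for M
  have wp: "(w \<odot> p M) \<in> L2 torus" and fs: "fin_supp (F M)" for M
    using fin_supp_weight[OF p fin_supp_inv_fourier_trig_sum[OF S(1), of "inv_fourier (h M)" M, folded p_def], of m "{j. r $ j < 0}"]
    unfolding F_def w_def by auto
  have \<phi>B: "\<bar>?\<phi> \<theta> * w \<theta>\<bar> \<le> C" for \<theta> using w\<phi>[of \<theta>] by simp
  have \<phi>wp: "(\<lambda>\<theta>. complex_of_real (?\<phi> \<theta>) * (complex_of_real (w \<theta>) * p M \<theta>)) \<in> L2 torus" for M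
    using mem[OF \<phi>m \<phi>B \<phi>g, of M] by (simp add: mult.assoc)
  have app: "app (frac_laplacian r) (F M) = inv_fourier (\<lambda>\<theta>. complex_of_real (?\<phi> \<theta>) * (complex_of_real (w \<theta>) * p M \<theta>))" for M
    unfolding frac_laplacian_def F_def by (rule app_fourier_mult[OF wp \<phi>m \<phi>wp])
  have app': "app (frac_laplacian r) (inv_fourier g) = inv_fourier (?\<phi> \<odot> g)"
    unfolding frac_laplacian_def by (rule app_fourier_mult[OF g \<phi>m \<phi>g])
  have "graph_approx (frac_laplacian r) (Domain (frac_laplacian r) \<inter> Domain (conj_op r)) F (inv_fourier g)"
    unfolding graph_approx_def
  proof (intro conjI allI)
    fix M
    have "F M \<in> Domain (frac_laplacian r)"
      unfolding frac_laplacian_def F_def Domain_fourier_mult_iff[OF wp \<phi>m] by (rule \<phi>wp)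
    moreover have "F M \<in> Domain (conj_op r)" using fin_supp_conj_op[OF fs] by blast
    ultimately show "F M \<in> Domain (frac_laplacian r) \<inter> Domain (conj_op r)" ..
  next
    have "L2lim torus (\<lambda>M \<theta>. complex_of_real (w \<theta>) * p M \<theta>) g"
      using lim[of "\<lambda>_. 1" 1] wb g by simp
    then show "l2_lim F (inv_fourier g)" unfolding F_def l2_lim_inv_fourier[OF wp g] .
    have "L2lim torus (\<lambda>M \<theta>. complex_of_real (?\<phi> \<theta>) * (complex_of_real (w \<theta>) * p M \<theta>)) (?\<phi> \<odot> g)"
      using lim[OF \<phi>m \<phi>B \<phi>g] by (simp add: mult.assoc)
    then show "l2_lim (\<lambda>M. app (frac_laplacian r) (F M)) (app (frac_laplacian r) (inv_fourier g))"
      unfolding app app' l2_lim_inv_fourier[OF \<phi>wp \<phi>g] .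
  qed
  then show ?thesis by blast
qed

section \<open>The Mourre estimate\<close>

theorem theorem2p20:
  fixes r :: "real^'d" and a b :: real
  assumes "r \<noteq> 0"
    and "a \<le> b"
    and "{a..b} \<subseteq> interior (real_spectrum (frac_laplacian r)) - thresholds r"
  shows "\<exists>B. is_compressed_commutator (frac_laplacian r) (conj_op r) {a..b} B \<and>
    (\<exists>c>0. \<forall>f \<in> ell2.
       (let E = spectral_proj (frac_laplacian r) {a..b} in
          ip f (E (B (E f))) \<in> \<real> \<and>
          Re (ip f (E (B (E f)))) \<ge> c * Re (ip f (E f))))"
proof -
  let ?\<phi> = "frac_symbol r" and ?\<psi> = "comm_symbol r" and ?H = "frac_laplacian r" and ?I = "{a..b}"
  let ?D = "Domain ?H \<inter> Domain (conj_op r)"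
  note \<phi>m = frac_symbol_measurable[of r] and \<psi>m = comm_symbol_measurable[of r]
  define E where "E = spectral_proj ?H ?I"
  define R where "R = E ` ell2"
  have I: "?I \<in> sets borel" by simp
  have E_eq: "E f = mult_proj ?\<phi> ?I f" if "f \<in> ell2" for f
    unfolding E_def frac_laplacian_def by (rule spectral_proj_fourier_mult[OF \<phi>m that assms(2)])
  have E_inv: "E (inv_fourier g) = inv_fourier (\<lambda>\<theta>. indicator ?I (?\<phi> \<theta>) * g \<theta>)" if "g \<in> L2 torus" for g
    using E_eq[OF inv_fourier_ell2[OF that]] mult_proj_inv_fourier[OF \<phi>m that I] by simp
  have Ig: "(\<lambda>\<theta>. indicator ?I (?\<phi> \<theta>) * g \<theta>) \<in> L2 torus" if "g \<in> L2 torus" for g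
    by (rule indicator_symbol_L2[OF \<phi>m that I])
  \<comment> \<open>The representative vanishes everywhere off the energy set, not merely almost
    everywhere, so later bounds can be checked pointwise.\<close>
  have R_cases: "\<exists>g. g \<in> L2 torus \<and> f = inv_fourier g \<and> (\<forall>\<theta>. ?\<phi> \<theta> \<notin> ?I \<longrightarrow> g \<theta> = 0)" if "f \<in> R" for f
  proof -
    from that obtain h where "h \<in> ell2" "f = E h" by (auto simp: R_def)
    then obtain g where g: "g \<in> L2 torus" "f = E (inv_fourier g)" using ell2_cases by metis
    show ?thesis
      by (rule exI[of _ "\<lambda>\<theta>. indicator ?I (?\<phi> \<theta>) * g \<theta>"]) (use Ig[OF g(1)] E_inv[OF g(1)] g(2) in auto)
  qed
  have R_intro: "inv_fourier g \<in> R" if "g \<in> L2 torus" "\<And>\<theta>. ?\<phi> \<theta> \<notin> ?I \<Longrightarrow> g \<theta> = 0" for g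
  proof -
    have "(\<lambda>\<theta>. indicator ?I (?\<phi> \<theta>) * g \<theta>) = g" using that(2) by (auto simp: indicator_def fun_eq_iff)
    then have "inv_fourier g = E (inv_fourier g)" using E_inv[OF that(1)] by simp
    then show ?thesis using inv_fourier_ell2[OF that(1)] unfolding R_def by blast
  qed
  define L where "L = (\<Sum>j\<in>UNIV. 2 * \<bar>r $ j\<bar>)"
  have L: "0 \<le> L" unfolding L_def by (rule sum_nonneg) simp
  have \<psi>L: "\<bar>?\<psi> \<theta>\<bar> \<le> L * ?\<phi> \<theta>" for \<theta>
    using comm_symbol_le[of r \<theta>] comm_symbol_nonneg[of r \<theta>] by (simp add: L_def)
  \<comment> \<open>The compressed commutator is multiplication by this function, bounded because
    the symbol is at most \<open>b\<close> where the indicator is nonzero.\<close>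
  define m where "m \<theta> = indicator ?I (?\<phi> \<theta>) * complex_of_real (?\<psi> \<theta>)" for \<theta>
  have mm: "m \<in> borel_measurable torus"
    unfolding m_def using indicator_symbol_measurable[OF \<phi>m I] \<psi>m by measurable
  have mb: "cmod (m \<theta>) \<le> L * \<bar>b\<bar>" for \<theta>
  proof (cases "?\<phi> \<theta> \<in> ?I")
    case True
    then have "L * ?\<phi> \<theta> \<le> L * \<bar>b\<bar>" using L by (intro mult_left_mono) auto
    then show ?thesis using True \<psi>L[of \<theta>] by (simp add: m_def)
  qed (use L in \<open>simp add: m_def\<close>)
  have mg: "(\<lambda>\<theta>. m \<theta> * g \<theta>) \<in> L2 torus" if "g \<in> L2 torus" for g
    by (rule L2_bounded_mult[OF that mm mb])
  define B where "B = mult_op m"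
  have B_inv: "B (inv_fourier g) = inv_fourier (\<lambda>\<theta>. m \<theta> * g \<theta>)" if "g \<in> L2 torus" for g
    unfolding B_def by (rule mult_op_inv_fourier[OF that mm])
  have \<phi>g: "(?\<phi> \<odot> g) \<in> L2 torus"
    if g: "g \<in> L2 torus" "\<forall>\<theta>. ?\<phi> \<theta> \<notin> ?I \<longrightarrow> g \<theta> = 0" for g
  proof (rule L2_dominated[OF g(1), where C = "\<bar>b\<bar>"])
    show "(?\<phi> \<odot> g) \<in> borel_measurable torus"
      using L2_measurable[OF g(1)] \<phi>m by measurable
    show "AE \<theta> in torus. cmod (complex_of_real (?\<phi> \<theta>) * g \<theta>) \<le> \<bar>b\<bar> * cmod (g \<theta>)"
    proof (rule AE_I2)
      fix \<theta>
      show "cmod (complex_of_real (?\<phi> \<theta>) * g \<theta>) \<le> \<bar>b\<bar> * cmod (g \<theta>)"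
        by (cases "?\<phi> \<theta> \<in> ?I") (use g(2) in \<open>auto simp: norm_mult intro!: mult_right_mono\<close>)
    qed
  qed
  have R_dom: "R \<subseteq> Domain ?H"
  proof
    fix f assume "f \<in> R"
    then obtain g where g: "g \<in> L2 torus" "f = inv_fourier g" "\<forall>\<theta>. ?\<phi> \<theta> \<notin> ?I \<longrightarrow> g \<theta> = 0" using R_cases by blast
    show "f \<in> Domain ?H"
      unfolding g(2) frac_laplacian_def Domain_fourier_mult_iff[OF g(1) \<phi>m] by (rule \<phi>g[OF g(1,3)])
  qed
  have B_bounded: "bounded_operator_on R B"
    unfolding bounded_operator_on_def
  proof (intro conjI ballI allI)
    fix f assume "f \<in> R"
    then obtain g where g: "g \<in> L2 torus" "f = inv_fourier g" "\<forall>\<theta>. ?\<phi> \<theta> \<notin> ?I \<longrightarrow> g \<theta> = 0" using R_cases by blast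
    show "B f \<in> R"
      unfolding g(2) B_inv[OF g(1)] by (rule R_intro[OF mg[OF g(1)]]) (use g(3) in auto)
    show "B (\<lambda>n. z * f n) = (\<lambda>n. z * B f n)" for z
      unfolding g(2) inv_fourier_scale[symmetric] B_inv[OF L2_scale[OF g(1)]] B_inv[OF g(1)]
      by (simp add: mult.left_commute)
    fix h assume "h \<in> R"
    then obtain k where k: "k \<in> L2 torus" "h = inv_fourier k" using R_cases by blast
    show "B (\<lambda>n. f n + h n) = (\<lambda>n. B f n + B h n)"
      unfolding g(2) k(2) inv_fourier_add[OF g(1) k(1), symmetric] B_inv[OF L2_add[OF g(1) k(1)]] B_inv[OF g(1)] B_inv[OF k(1)]
        inv_fourier_add[OF mg[OF g(1)] mg[OF k(1)], symmetric]
      by (simp add: distrib_left)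
  next
    have "l2norm (B f) \<le> (L * \<bar>b\<bar>) * l2norm f" if "f \<in> R" for f
    proof -
      from R_cases[OF that] obtain g where g: "g \<in> L2 torus" "f = inv_fourier g" by blast
      have "sqn torus (\<lambda>\<theta>. m \<theta> * g \<theta>) \<le> sqn torus (\<lambda>\<theta>. complex_of_real (L * \<bar>b\<bar>) * g \<theta>)"
      proof (rule sqn_mono_AE[OF L2_scale[OF g(1)] mg[OF g(1)]], rule AE_I2)
        fix \<theta>
        show "cmod (m \<theta> * g \<theta>) \<le> cmod (complex_of_real (L * \<bar>b\<bar>) * g \<theta>)"
          unfolding norm_mult[of "m \<theta>"] norm_mult[of "complex_of_real (L * \<bar>b\<bar>)"] norm_of_real
          using order_trans[OF mb[of \<theta>] abs_ge_self] by (rule mult_right_mono) simp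
      qed
      also have "\<dots> = (L * \<bar>b\<bar>)\<^sup>2 * sqn torus g" by (simp only: sqn_scale norm_of_real power2_abs)
      finally have "sqrt (sqn torus (\<lambda>\<theta>. m \<theta> * g \<theta>)) \<le> sqrt ((L * \<bar>b\<bar>)\<^sup>2 * sqn torus g)" by (rule real_sqrt_le_mono)
      also have "\<dots> = (L * \<bar>b\<bar>) * sqrt (sqn torus g)" using L by (simp add: real_sqrt_mult)
      finally show ?thesis unfolding g(2) B_inv[OF g(1)] l2norm_inv_fourier[OF mg[OF g(1)]] l2norm_inv_fourier[OF g(1)] .
    qed
    then show "\<exists>C. \<forall>f\<in>R. l2norm (B f) \<le> C * l2norm f" by blast
  qed
  have approx: "\<exists>F. graph_approx ?H ?D F f" if "f \<in> R" for f
  proof -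
    from R_cases[OF that] obtain g where g: "g \<in> L2 torus" "f = inv_fourier g" "\<forall>\<theta>. ?\<phi> \<theta> \<notin> ?I \<longrightarrow> g \<theta> = 0" by blast
    show ?thesis unfolding g(2) by (rule graph_approx_exists[OF g(1) \<phi>g[OF g(1,3)]])
  qed
  have limit: "(\<lambda>k. commutator_form ?H (conj_op r) (F k) (G k)) \<longlonglongrightarrow> ip f (B h)"
    if f: "f \<in> R" and h: "h \<in> R" and F: "graph_approx ?H ?D F f" and G: "graph_approx ?H ?D G h" for f h F G
  proof -
    obtain u where u: "u \<in> L2 torus" "f = inv_fourier u" "\<forall>\<theta>. ?\<phi> \<theta> \<notin> ?I \<longrightarrow> u \<theta> = 0" using R_cases[OF f] by blast
    obtain v where v: "v \<in> L2 torus" "h = inv_fourier v" "\<forall>\<theta>. ?\<phi> \<theta> \<notin> ?I \<longrightarrow> v \<theta> = 0" using R_cases[OF h] by blast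
    have FD: "F k \<in> ?D" and GD: "G k \<in> ?D" for k using F G by (auto simp: graph_approx_def)
    have ell: "x \<in> ell2" if "x \<in> ?D" for x using that fourier_mult_subset[of ?\<phi>] unfolding frac_laplacian_def by blast
    have FL: "fourier (F k) \<in> L2 torus" and GL: "fourier (G k) \<in> L2 torus" for k
      using ell[OF FD] ell[OF GD] by (auto intro: fourier_L2)
    have Finv: "inv_fourier (fourier (F k)) = F k" and Ginv: "inv_fourier (fourier (G k)) = G k" for k
      using ell[OF FD] ell[OF GD] by (auto intro: inv_fourier_fourier)
    have G\<phi>: "(?\<phi> \<odot> fourier (G k)) \<in> L2 torus" for k
      using GD[of k] Domain_fourier_mult_iff[OF GL \<phi>m, of k] unfolding frac_laplacian_def Ginv by blast
    have Fl: "L2lim torus (\<lambda>k. fourier (F k)) u"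
    proof (rule iffD1[OF l2_lim_inv_fourier[OF _ u(1)]])
      show "l2_lim (\<lambda>k. inv_fourier (fourier (F k))) (inv_fourier u)"
        using F unfolding Finv graph_approx_def u(2) by blast
    qed (rule FL)
    \<comment> \<open>Graph convergence of \<open>G\<close> gives convergence after multiplication
      by \<phi>, and \<open>\<psi> \<le> L \<phi>\<close> transfers it to the commutator
      symbol.\<close>
    have Gl: "L2lim torus (\<lambda>k \<theta>. complex_of_real (?\<phi> \<theta>) * fourier (G k) \<theta>) (?\<phi> \<odot> v)"
    proof -
      have 1: "app ?H (G k) = inv_fourier (?\<phi> \<odot> fourier (G k))" for k
        using app_fourier_mult[OF GL \<phi>m G\<phi>, of k] unfolding frac_laplacian_def Ginv .
      have 2: "app ?H h = inv_fourier (?\<phi> \<odot> v)"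
        unfolding frac_laplacian_def v(2) by (rule app_fourier_mult[OF v(1) \<phi>m \<phi>g[OF v(1,3)]])
      have "l2_lim (\<lambda>k. app ?H (G k)) (app ?H h)" using G by (simp add: graph_approx_def)
      then show ?thesis unfolding 1 2 l2_lim_inv_fourier[OF G\<phi> \<phi>g[OF v(1,3)]] .
    qed
    have le: "cmod (complex_of_real (?\<psi> \<theta>) * x) \<le> L * cmod (complex_of_real (?\<phi> \<theta>) * x)" for \<theta> x
      using mult_right_mono[OF \<psi>L[of \<theta>] norm_ge_zero[of x]] by (simp add: norm_mult mult.assoc)
    have mult_meas: "(?\<psi> \<odot> x) \<in> borel_measurable torus" if "x \<in> L2 torus" for x
      using L2_measurable[OF that] \<psi>m by measurable
    have G\<psi>: "(?\<psi> \<odot> fourier (G k)) \<in> L2 torus" for k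
      by (rule L2_dominated[OF G\<phi> mult_meas[OF GL]]) (use le in auto)
    have v\<psi>: "(?\<psi> \<odot> v) \<in> L2 torus"
      by (rule L2_dominated[OF \<phi>g[OF v(1,3)] mult_meas[OF v(1)]]) (use le in auto)
    have G\<psi>l: "L2lim torus (\<lambda>k \<theta>. complex_of_real (?\<psi> \<theta>) * fourier (G k) \<theta>) (?\<psi> \<odot> v)"
      by (rule L2lim_dominated_mult[OF G\<phi> \<phi>g[OF v(1,3)] mult_meas[OF GL] mult_meas[OF v(1)] Gl, where C = L])
         (use le in \<open>simp add: right_diff_distrib[symmetric]\<close>)
    have "(\<lambda>k. inn torus (fourier (F k)) (?\<psi> \<odot> fourier (G k))) \<longlonglongrightarrow> inn torus u (?\<psi> \<odot> v)"
      by (rule L2lim_inn[OF FL G\<psi> u(1) v\<psi> Fl G\<psi>l])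
    moreover have "(?\<psi> \<odot> v) = (\<lambda>\<theta>. m \<theta> * v \<theta>)"
      using v(3) by (auto simp: m_def indicator_def fun_eq_iff)
    ultimately show ?thesis
      unfolding commutator_form_eq[OF FD GD] u(2) v(2) B_inv[OF v(1)] ip_inv_fourier[OF u(1) mg[OF v(1)]] by simp
  qed
  have comm: "is_compressed_commutator ?H (conj_op r) ?I B"
    unfolding is_compressed_commutator_def Let_def E_def[symmetric] R_def[symmetric]
    by (intro conjI ballI allI impI R_dom B_bounded approx limit)
  have "?I \<inter> thresholds r = {}" using assms(3) by blast
  \<comment> \<open>The constant of the estimate: the positive minimum of the commutator symbol over
    the energy set, which avoids all thresholds.\<close>
  then obtain c where c: "c > 0" "\<And>\<theta>. \<forall>j. cos_sym j \<theta> < 1 \<Longrightarrow> ?\<phi> \<theta> \<in> ?I \<Longrightarrow> c \<le> ?\<psi> \<theta>"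
    using comm_symbol_lower_bound[of a b r] by blast
  have "ip f (E (B (E f))) \<in> \<real> \<and> Re (ip f (E (B (E f)))) \<ge> c * Re (ip f (E f))" if f: "f \<in> ell2" for f
  proof -
    obtain g where g: "g \<in> L2 torus" "f = inv_fourier g" using f by (rule ell2_cases)
    define h where "h \<theta> = indicator ?I (?\<phi> \<theta>) * g \<theta>" for \<theta>
    have h: "h \<in> L2 torus" unfolding h_def by (rule Ig[OF g(1)])
    have Ef: "E f = inv_fourier h" unfolding g(2) E_inv[OF g(1)] h_def ..
    have EB: "E (B (E f)) = inv_fourier (\<lambda>\<theta>. indicator ?I (?\<phi> \<theta>) * (m \<theta> * h \<theta>))"
      unfolding Ef B_inv[OF h] E_inv[OF mg[OF h]] ..
    have 1: "ip f (E (B (E f))) = complex_of_real (LINT \<theta>|torus. ?\<psi> \<theta> * (cmod (h \<theta>))\<^sup>2)"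
      unfolding EB unfolding g(2) ip_inv_fourier[OF g(1) Ig[OF mg[OF h]]] inn_def integral_complex_of_real[symmetric]
      by (rule Bochner_Integration.integral_cong) (auto simp: h_def m_def indicator_def complex_norm_square[symmetric] mult_ac)
    have 2: "ip f (E f) = complex_of_real (LINT \<theta>|torus. (cmod (h \<theta>))\<^sup>2)"
      unfolding Ef unfolding g(2) ip_inv_fourier[OF g(1) h] inn_def integral_complex_of_real[symmetric]
      by (rule Bochner_Integration.integral_cong) (auto simp: h_def indicator_def complex_norm_square[symmetric] mult_ac)
    have hm: "h \<in> borel_measurable torus" using h by (rule L2_measurable)
    have "c * (LINT \<theta>|torus. (cmod (h \<theta>))\<^sup>2) = (LINT \<theta>|torus. c * (cmod (h \<theta>))\<^sup>2)" by simp
    also have "\<dots> \<le> (LINT \<theta>|torus. ?\<psi> \<theta> * (cmod (h \<theta>))\<^sup>2)"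
    proof (rule integral_mono_AE)
      show "integrable torus (\<lambda>\<theta>. c * (cmod (h \<theta>))\<^sup>2)" using L2_integrable[OF h] by simp
      show "integrable torus (\<lambda>\<theta>. ?\<psi> \<theta> * (cmod (h \<theta>))\<^sup>2)"
      proof (rule Bochner_Integration.integrable_bound[where f = "\<lambda>\<theta>. (L * \<bar>b\<bar>) * (cmod (h \<theta>))\<^sup>2"])
        show "integrable torus (\<lambda>\<theta>. (L * \<bar>b\<bar>) * (cmod (h \<theta>))\<^sup>2)" using L2_integrable[OF h] by simp
        show "(\<lambda>\<theta>. ?\<psi> \<theta> * (cmod (h \<theta>))\<^sup>2) \<in> borel_measurable torus" using hm \<psi>m by measurable
        show "AE \<theta> in torus. norm (?\<psi> \<theta> * (cmod (h \<theta>))\<^sup>2) \<le> norm ((L * \<bar>b\<bar>) * (cmod (h \<theta>))\<^sup>2)"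
        proof (rule AE_I2)
          fix \<theta>
          show "norm (?\<psi> \<theta> * (cmod (h \<theta>))\<^sup>2) \<le> norm ((L * \<bar>b\<bar>) * (cmod (h \<theta>))\<^sup>2)"
          proof (cases "?\<phi> \<theta> \<in> ?I")
            case True
            then have "\<bar>?\<psi> \<theta>\<bar> \<le> L * \<bar>b\<bar>" using mb[of \<theta>] by (simp add: m_def)
            then show ?thesis using L mult_right_mono[of "\<bar>?\<psi> \<theta>\<bar>" "L * \<bar>b\<bar>" "(cmod (h \<theta>))\<^sup>2"] by (simp add: abs_mult)
          qed (simp add: h_def)
        qed
      qed
      \<comment> \<open>On the energy set the lower bound applies off a null set; elsewhere
        \<open>h\<close> is 0.\<close>
      show "AE \<theta> in torus. c * (cmod (h \<theta>))\<^sup>2 \<le> ?\<psi> \<theta> * (cmod (h \<theta>))\<^sup>2"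
        using AE_cos_sym_less
      proof eventually_elim
        case (elim \<theta>)
        show ?case
        proof (cases "?\<phi> \<theta> \<in> ?I")
          case True
          show ?thesis by (rule mult_right_mono[OF c(2)[OF elim True]]) simp
        qed (simp add: h_def)
      qed
    qed
    finally show ?thesis unfolding 1 2 by simp
  qed
  then have "\<exists>c>0. \<forall>f \<in> ell2. (let E = spectral_proj ?H ?I in
      ip f (E (B (E f))) \<in> \<real> \<and> Re (ip f (E (B (E f)))) \<ge> c * Re (ip f (E f)))"
    using c(1) unfolding Let_def E_def by blast
  with comm show ?thesis by blast
qed

end
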